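(* (i) Any conic complex manifold is a special complex manifold. (ii) Any conic symplectic manifold is a special symplectic manifold. (iii) Any conic Kähler manifold is a special Kähler manifold.
   Context: A local holomorphic $\mathbb{C}^*$-action on a complex manifold $M$ is a holomorphic map $(\lambda,p)\mapsto\varphi_\lambda(p)\in M$ defined on an open neighbourhood $W$ of $\{1\}\times M$ in $\mathbb{C}^*\times M$ such that $\varphi_1(p)=p$ for all $p$ and $\varphi_\lambda(\varphi_\mu(p))=\varphi_{\lambda\mu}(p)$ whenever both sides are defined. Equations involving $\varphi_\lambda$ are meant to hold locally, i.e. on any open set on which $\varphi_\lambda$ is defined and is a diffeomorphism onto its image. Let $(M,J,\nabla)$ be a complex manifold with a flat torsionfree connection (on the real tangent bundle). It is a conic complex manifold if it admits a local holomorphic $\mathbb{C}^*$-action $\varphi_\lambda$ such that locally $d\varphi_\lambda X=re^{\theta J}X=r(\cos\theta)X+r(\sin\theta)JX$ for all (local) $\nabla$-parallel vector fields $X$, where $\lambda=re^{i\theta}$, $r>0$. A conic symplectic manifold is a conic complex manifold together with a $\nabla$-parallel symplectic form $\omega$; it is a conic Kähler manifold if $\omega$ is $J$-invariant. $(M,J,\nabla)$ is a special complex manifold if $d^\nabla J=0$, i.e. $(\nabla_XJ)Y=(\nabla_YJ)X$ for all $X,Y$. A special symplectic manifold is a special complex manifold together with a $\nabla$-parallel symplectic form $\omega$; it is a special Kähler manifold if $\omega$ is $J$-invariant. *)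

theory Defs
  imports "HOL-Analysis.Analysis" "HOL-Library.Function_Algebras"
begin

instantiation "fun" :: (type, real_vector) real_vector
begin

definition scaleR_fun :: "real \<Rightarrow> ('a \<Rightarrow> 'b) \<Rightarrow> 'a \<Rightarrow> 'b"
  where "r *\<^sub>R f = (\<lambda>x. r *\<^sub>R f x)"

instance
  by standard (auto simp: scaleR_fun_def fun_eq_iff scaleR_add_right scaleR_add_left)

end


(* Only used on open sets S. *)
fun Ck_on :: "nat \<Rightarrow> 'v::real_normed_vector set \<Rightarrow> ('v \<Rightarrow> 'w::real_normed_vector) \<Rightarrow> bool"
  where
    "Ck_on 0 S f \<longleftrightarrow> continuous_on S f"
  | "Ck_on (Suc k) S f \<longleftrightarrow>
       (\<forall>x\<in>S. f differentiable (at x)) \<and> (\<forall>v. Ck_on k S (\<lambda>x. frechet_derivative f (at x) v))"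

definition smooth_on :: "'v::real_normed_vector set \<Rightarrow> ('v \<Rightarrow> 'w::real_normed_vector) \<Rightarrow> bool"
  where "smooth_on S f \<longleftrightarrow> (\<forall>k. Ck_on k S f)"

(* Holomorphic maps between open subsets of real vector spaces with complex structures j1, j2:
   smooth maps whose differential is complex linear. *)
definition holomorphic_map_on ::
    "('v::real_normed_vector \<Rightarrow> 'v) \<Rightarrow> ('w::real_normed_vector \<Rightarrow> 'w) \<Rightarrow> 'v set \<Rightarrow> ('v \<Rightarrow> 'w) \<Rightarrow> bool"
  where "holomorphic_map_on j1 j2 S f \<longleftrightarrow> smooth_on S f \<and>
    (\<forall>x\<in>S. \<forall>v. frechet_derivative f (at x) (j1 v) = j2 (frechet_derivative f (at x) v))"


(* A chart is a pair (domain, coordinate map); the values of the coordinate map outside the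
   domain are irrelevant. *)
type_synonym ('a, 'n) chart = "'a set \<times> ('a \<Rightarrow> complex ^ 'n)"

abbreviation cdom :: "('a, 'n) chart \<Rightarrow> 'a set" where "cdom c \<equiv> fst c"
abbreviation cmap :: "('a, 'n) chart \<Rightarrow> 'a \<Rightarrow> complex ^ 'n" where "cmap c \<equiv> snd c"
abbreviation cinv :: "('a, 'n) chart \<Rightarrow> complex ^ 'n \<Rightarrow> 'a" where "cinv c \<equiv> inv_into (cdom c) (cmap c)"

(* A tangent vector is given by its components in all charts around its base point, see
   tangent_space below. A vector field on an open set U is a function whose values outside U are
   irrelevant. *)
type_synonym ('a, 'n) tvec = "('a, 'n) chart \<Rightarrow> complex ^ 'n"
type_synonym ('a, 'n) vfield = "'a \<Rightarrow> ('a, 'n) tvec"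

locale complex_manifold =
  fixes X :: "'a topology" and A :: "('a, 'n::finite) chart set"
  assumes Hausdorff: "Hausdorff_space X"
    and second_countable: "second_countable X"
    and chart_open: "c \<in> A \<Longrightarrow> openin X (cdom c) \<and> open (cmap c ` cdom c)"
    and chart_homeo: "c \<in> A \<Longrightarrow>
      homeomorphic_map (subtopology X (cdom c)) (top_of_set (cmap c ` cdom c)) (cmap c)"
    and charts_cover: "(\<Union>c\<in>A. cdom c) = topspace X"
    and charts_compatible: "c \<in> A \<Longrightarrow> d \<in> A \<Longrightarrow>
      holomorphic_map_on (\<lambda>v. \<i> *s v) (\<lambda>v. \<i> *s v) (cmap c ` (cdom c \<inter> cdom d)) (cmap d \<circ> cinv c)"
begin

definition tangent_space :: "'a \<Rightarrow> ('a, 'n) tvec set"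
  where "tangent_space p = {v.
    (\<forall>c\<in>A. \<forall>d\<in>A. p \<in> cdom c \<and> p \<in> cdom d \<longrightarrow>
       v d = frechet_derivative (cmap d \<circ> cinv c) (at (cmap c p)) (v c)) \<and>
    (\<forall>c. \<not> (c \<in> A \<and> p \<in> cdom c) \<longrightarrow> v c = 0)}"

definition J :: "('a, 'n) tvec \<Rightarrow> ('a, 'n) tvec"
  where "J v = (\<lambda>c. \<i> *s v c)"

definition chart_at :: "'a \<Rightarrow> ('a, 'n) chart"
  where "chart_at p = (SOME c. c \<in> A \<and> p \<in> cdom c)"

definition smooth_fun :: "'a set \<Rightarrow> ('a \<Rightarrow> real) \<Rightarrow> bool"
  where "smooth_fun U f \<longleftrightarrow> (\<forall>c\<in>A. smooth_on (cmap c ` (U \<inter> cdom c)) (f \<circ> cinv c))"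

definition smooth_field :: "'a set \<Rightarrow> ('a, 'n) vfield \<Rightarrow> bool"
  where "smooth_field U Y \<longleftrightarrow> (\<forall>p\<in>U. Y p \<in> tangent_space p) \<and>
    (\<forall>c\<in>A. smooth_on (cmap c ` (U \<inter> cdom c)) (\<lambda>x. Y (cinv c x) c))"

definition smooth_map :: "'a set \<Rightarrow> ('a \<Rightarrow> 'a) \<Rightarrow> bool"
  where "smooth_map U f \<longleftrightarrow> continuous_map (subtopology X U) X f \<and>
    (\<forall>c\<in>A. \<forall>d\<in>A. smooth_on (cmap c ` {p \<in> U \<inter> cdom c. f p \<in> cdom d}) (cmap d \<circ> f \<circ> cinv c))"

definition diffeo_onto_image :: "'a set \<Rightarrow> ('a \<Rightarrow> 'a) \<Rightarrow> bool"
  where "diffeo_onto_image U f \<longleftrightarrow> openin X U \<and> openin X (f ` U) \<and> inj_on f U \<and>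
    smooth_map U f \<and> smooth_map (f ` U) (inv_into U f)"

definition differential :: "('a \<Rightarrow> 'a) \<Rightarrow> 'a \<Rightarrow> ('a, 'n) tvec \<Rightarrow> ('a, 'n) tvec"
  where "differential f p v = (\<lambda>d. if d \<in> A \<and> f p \<in> cdom d
    then frechet_derivative (cmap d \<circ> f \<circ> cinv (chart_at p)) (at (cmap (chart_at p) p)) (v (chart_at p))
    else 0)"

definition deriv_along :: "('a, 'n) vfield \<Rightarrow> ('a \<Rightarrow> real) \<Rightarrow> 'a \<Rightarrow> real"
  where "deriv_along Y f p =
    frechet_derivative (f \<circ> cinv (chart_at p)) (at (cmap (chart_at p) p)) (Y p (chart_at p))"

definition bracket :: "('a, 'n) vfield \<Rightarrow> ('a, 'n) vfield \<Rightarrow> ('a, 'n) vfield"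
  where "bracket Y Z p = (\<lambda>c. if c \<in> A \<and> p \<in> cdom c
    then frechet_derivative (\<lambda>x. Z (cinv c x) c) (at (cmap c p)) (Y p c)
       - frechet_derivative (\<lambda>x. Y (cinv c x) c) (at (cmap c p)) (Z p c)
    else 0)"

(* A connection on the real tangent bundle, as an operator on vector fields over arbitrary open
   sets that is compatible with restriction. *)
definition connection :: "(('a, 'n) vfield \<Rightarrow> ('a, 'n) vfield \<Rightarrow> ('a, 'n) vfield) \<Rightarrow> bool"
  where "connection nabla \<longleftrightarrow> (\<forall>U. openin X U \<longrightarrow>
    (\<forall>Y Z. smooth_field U Y \<and> smooth_field U Z \<longrightarrow> smooth_field U (nabla Y Z)) \<and>
    (\<forall>Y Y' Z Z'. smooth_field U Y \<and> smooth_field U Z \<and>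
       (\<forall>p\<in>U. Y' p = Y p) \<and> (\<forall>p\<in>U. Z' p = Z p) \<longrightarrow> (\<forall>p\<in>U. nabla Y' Z' p = nabla Y Z p)) \<and>
    (\<forall>Y Y' Z. smooth_field U Y \<and> smooth_field U Y' \<and> smooth_field U Z \<longrightarrow>
       (\<forall>p\<in>U. nabla (Y + Y') Z p = nabla Y Z p + nabla Y' Z p)) \<and>
    (\<forall>f Y Z. smooth_fun U f \<and> smooth_field U Y \<and> smooth_field U Z \<longrightarrow>
       (\<forall>p\<in>U. nabla (\<lambda>q. f q *\<^sub>R Y q) Z p = f p *\<^sub>R nabla Y Z p)) \<and>
    (\<forall>Y Z Z'. smooth_field U Y \<and> smooth_field U Z \<and> smooth_field U Z' \<longrightarrow>
       (\<forall>p\<in>U. nabla Y (Z + Z') p = nabla Y Z p + nabla Y Z' p)) \<and>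
    (\<forall>f Y Z. smooth_fun U f \<and> smooth_field U Y \<and> smooth_field U Z \<longrightarrow>
       (\<forall>p\<in>U. nabla Y (\<lambda>q. f q *\<^sub>R Z q) p = deriv_along Y f p *\<^sub>R Z p + f p *\<^sub>R nabla Y Z p)))"

definition torsionfree :: "(('a, 'n) vfield \<Rightarrow> ('a, 'n) vfield \<Rightarrow> ('a, 'n) vfield) \<Rightarrow> bool"
  where "torsionfree nabla \<longleftrightarrow>
    (\<forall>U Y Z. openin X U \<and> smooth_field U Y \<and> smooth_field U Z \<longrightarrow>
       (\<forall>p\<in>U. nabla Y Z p - nabla Z Y p - bracket Y Z p = 0))"

definition flat :: "(('a, 'n) vfield \<Rightarrow> ('a, 'n) vfield \<Rightarrow> ('a, 'n) vfield) \<Rightarrow> bool"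
  where "flat nabla \<longleftrightarrow>
    (\<forall>U Y Z S. openin X U \<and> smooth_field U Y \<and> smooth_field U Z \<and> smooth_field U S \<longrightarrow>
       (\<forall>p\<in>U. nabla Y (nabla Z S) p - nabla Z (nabla Y S) p - nabla (bracket Y Z) S p = 0))"

definition parallel_field ::
    "(('a, 'n) vfield \<Rightarrow> ('a, 'n) vfield \<Rightarrow> ('a, 'n) vfield) \<Rightarrow> 'a set \<Rightarrow> ('a, 'n) vfield \<Rightarrow> bool"
  where "parallel_field nabla U Y \<longleftrightarrow> smooth_field U Y \<and>
    (\<forall>V Z. openin X V \<and> V \<subseteq> U \<and> smooth_field V Z \<longrightarrow> (\<forall>p\<in>V. nabla Z Y p = 0))"

definition smooth_two_form :: "('a \<Rightarrow> ('a, 'n) tvec \<Rightarrow> ('a, 'n) tvec \<Rightarrow> real) \<Rightarrow> bool"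
  where "smooth_two_form \<omega> \<longleftrightarrow>
    (\<forall>p\<in>topspace X.
       (\<forall>u\<in>tangent_space p. \<forall>v\<in>tangent_space p. \<forall>w\<in>tangent_space p. \<forall>a b.
          \<omega> p (a *\<^sub>R u + b *\<^sub>R v) w = a * \<omega> p u w + b * \<omega> p v w) \<and>
       (\<forall>v\<in>tangent_space p. \<forall>w\<in>tangent_space p. \<omega> p v w = - \<omega> p w v)) \<and>
    (\<forall>U Y Z. openin X U \<and> smooth_field U Y \<and> smooth_field U Z \<longrightarrow>
       smooth_fun U (\<lambda>p. \<omega> p (Y p) (Z p)))"

definition nondegenerate :: "('a \<Rightarrow> ('a, 'n) tvec \<Rightarrow> ('a, 'n) tvec \<Rightarrow> real) \<Rightarrow> bool"
  where "nondegenerate \<omega> \<longleftrightarrow> (\<forall>p\<in>topspace X. \<forall>v\<in>tangent_space p.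
    (\<forall>w\<in>tangent_space p. \<omega> p v w = 0) \<longrightarrow> v = 0)"

definition closed_form :: "('a \<Rightarrow> ('a, 'n) tvec \<Rightarrow> ('a, 'n) tvec \<Rightarrow> real) \<Rightarrow> bool"
  where "closed_form \<omega> \<longleftrightarrow>
    (\<forall>U Y Z S. openin X U \<and> smooth_field U Y \<and> smooth_field U Z \<and> smooth_field U S \<longrightarrow>
       (\<forall>p\<in>U. deriv_along Y (\<lambda>q. \<omega> q (Z q) (S q)) p + deriv_along Z (\<lambda>q. \<omega> q (S q) (Y q)) p
             + deriv_along S (\<lambda>q. \<omega> q (Y q) (Z q)) p
             - \<omega> p (bracket Y Z p) (S p) - \<omega> p (bracket Z S p) (Y p) - \<omega> p (bracket S Y p) (Z p) = 0))"

definition symplectic_form :: "('a \<Rightarrow> ('a, 'n) tvec \<Rightarrow> ('a, 'n) tvec \<Rightarrow> real) \<Rightarrow> bool"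
  where "symplectic_form \<omega> \<longleftrightarrow> smooth_two_form \<omega> \<and> nondegenerate \<omega> \<and> closed_form \<omega>"

definition parallel_form ::
    "(('a, 'n) vfield \<Rightarrow> ('a, 'n) vfield \<Rightarrow> ('a, 'n) vfield) \<Rightarrow>
     ('a \<Rightarrow> ('a, 'n) tvec \<Rightarrow> ('a, 'n) tvec \<Rightarrow> real) \<Rightarrow> bool"
  where "parallel_form nabla \<omega> \<longleftrightarrow>
    (\<forall>U Y Z S. openin X U \<and> smooth_field U Y \<and> smooth_field U Z \<and> smooth_field U S \<longrightarrow>
       (\<forall>p\<in>U. deriv_along Y (\<lambda>q. \<omega> q (Z q) (S q)) p
             - \<omega> p (nabla Y Z p) (S p) - \<omega> p (Z p) (nabla Y S p) = 0))"

definition J_invariant :: "('a \<Rightarrow> ('a, 'n) tvec \<Rightarrow> ('a, 'n) tvec \<Rightarrow> real) \<Rightarrow> bool"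
  where "J_invariant \<omega> \<longleftrightarrow>
    (\<forall>p\<in>topspace X. \<forall>v\<in>tangent_space p. \<forall>w\<in>tangent_space p. \<omega> p (J v) (J w) = \<omega> p v w)"

definition nabla_J ::
    "(('a, 'n) vfield \<Rightarrow> ('a, 'n) vfield \<Rightarrow> ('a, 'n) vfield) \<Rightarrow>
     ('a, 'n) vfield \<Rightarrow> ('a, 'n) vfield \<Rightarrow> ('a, 'n) vfield"
  where "nabla_J nabla Y Z p = nabla Y (\<lambda>q. J (Z q)) p - J (nabla Y Z p)"

definition local_Cstar_action :: "(complex \<times> 'a) set \<Rightarrow> (complex \<Rightarrow> 'a \<Rightarrow> 'a) \<Rightarrow> bool"
  where "local_Cstar_action W \<phi> \<longleftrightarrow>
    openin (prod_topology euclidean X) W \<and> {1} \<times> topspace X \<subseteq> W \<and> W \<subseteq> (- {0}) \<times> topspace X \<and>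
    continuous_map (subtopology (prod_topology euclidean X) W) X (\<lambda>(l, p). \<phi> l p) \<and>
    (\<forall>c\<in>A. \<forall>d\<in>A. holomorphic_map_on (\<lambda>(a, v). (\<i> * a, \<i> *s v)) (\<lambda>v. \<i> *s v)
       ((\<lambda>(l, p). (l, cmap c p)) ` {(l, p) \<in> W. p \<in> cdom c \<and> \<phi> l p \<in> cdom d})
       (\<lambda>(l, x). cmap d (\<phi> l (cinv c x)))) \<and>
    (\<forall>p\<in>topspace X. \<phi> 1 p = p) \<and>
    (\<forall>l m p. (m, p) \<in> W \<and> (l, \<phi> m p) \<in> W \<and> (l * m, p) \<in> W \<longrightarrow> \<phi> l (\<phi> m p) = \<phi> (l * m) p)"

(* The identity d(phi_l) Y = r (cos t) Y + r (sin t) J Y, l = r exp(i t), for a parallel field Y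
   on U is required near (1, p) for every p in U. The identity compares Y at q with Y at phi_l(q),
   so it has no invariant meaning when U is not small: the components of U are unrelated, and Y
   may have monodromy. Since W may be shrunk, restricting to l near 1 is no loss. *)
definition conic_action ::
    "(('a, 'n) vfield \<Rightarrow> ('a, 'n) vfield \<Rightarrow> ('a, 'n) vfield) \<Rightarrow>
     (complex \<times> 'a) set \<Rightarrow> (complex \<Rightarrow> 'a \<Rightarrow> 'a) \<Rightarrow> bool"
  where "conic_action nabla W \<phi> \<longleftrightarrow>
    (\<forall>U Y. openin X U \<and> parallel_field nabla U Y \<longrightarrow>
      (\<forall>p\<in>U. \<exists>N V. open N \<and> 1 \<in> N \<and> openin X V \<and> p \<in> V \<and> V \<subseteq> U \<and>
        (\<forall>r t. \<forall>Q. r > 0 \<and> rcis r t \<in> N \<and> Q \<subseteq> V \<and> {rcis r t} \<times> Q \<subseteq> W \<and>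
             diffeo_onto_image Q (\<phi> (rcis r t)) \<and> \<phi> (rcis r t) ` Q \<subseteq> V \<longrightarrow>
           (\<forall>q\<in>Q. differential (\<phi> (rcis r t)) q (Y q) =
              (r * cos t) *\<^sub>R Y (\<phi> (rcis r t) q) + (r * sin t) *\<^sub>R J (Y (\<phi> (rcis r t) q))))))"

end

locale flat_complex_manifold = complex_manifold X A
  for X :: "'a topology" and A :: "('a, 'n::finite) chart set" +
  fixes nabla :: "('a, 'n) vfield \<Rightarrow> ('a, 'n) vfield \<Rightarrow> ('a, 'n) vfield"
  assumes nabla_connection: "connection nabla"
    and nabla_torsionfree: "torsionfree nabla"
    and nabla_flat: "flat nabla"

locale conic_complex_manifold = flat_complex_manifold +
  assumes conic: "\<exists>W \<phi>. local_Cstar_action W \<phi> \<and> conic_action nabla W \<phi>"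

locale conic_symplectic_manifold = conic_complex_manifold X A nabla
  for X :: "'a topology" and A :: "('a, 'n::finite) chart set"
    and nabla :: "('a, 'n) vfield \<Rightarrow> ('a, 'n) vfield \<Rightarrow> ('a, 'n) vfield" +
  fixes \<omega> :: "'a \<Rightarrow> ('a, 'n) tvec \<Rightarrow> ('a, 'n) tvec \<Rightarrow> real"
  assumes omega_symplectic: "symplectic_form \<omega>"
    and omega_parallel: "parallel_form nabla \<omega>"

locale conic_Kaehler_manifold = conic_symplectic_manifold +
  assumes omega_J_invariant: "J_invariant \<omega>"

locale special_complex_manifold = flat_complex_manifold +
  assumes special: "openin X U \<Longrightarrow> smooth_field U Y \<Longrightarrow> smooth_field U Z \<Longrightarrow> p \<in> U \<Longrightarrow>
    nabla_J nabla Y Z p = nabla_J nabla Z Y p"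

locale special_symplectic_manifold = special_complex_manifold X A nabla
  for X :: "'a topology" and A :: "('a, 'n::finite) chart set"
    and nabla :: "('a, 'n) vfield \<Rightarrow> ('a, 'n) vfield \<Rightarrow> ('a, 'n) vfield" +
  fixes \<omega> :: "'a \<Rightarrow> ('a, 'n) tvec \<Rightarrow> ('a, 'n) tvec \<Rightarrow> real"
  assumes omega_symplectic: "symplectic_form \<omega>"
    and omega_parallel: "parallel_form nabla \<omega>"

locale special_Kaehler_manifold = special_symplectic_manifold +
  assumes omega_J_invariant: "J_invariant \<omega>"

end

theory Submission
  imports Defs
begin

text \<open>Let \<open>\<eta>\<close> be the vector field generating the circle part of the action. For a parallel
  field \<open>Y\<close>, differentiating \<open>d\<phi>\<^sub>\<lambda> Y = cos t Y + sin t J Y\<close> at \<open>\<lambda> = 1\<close> gives \<open>[Y, \<eta>] = J Y\<close>, which is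
  \<open>\<nabla>\<^sub>Y \<eta> = J Y\<close> because \<open>\<nabla>\<close> is torsionfree. A flat connection has a parallel field through every
  tangent vector, so \<open>\<nabla>\<eta> = J\<close> everywhere, and \<open>d\<^sup>\<nabla> J = d\<^sup>\<nabla> d\<^sup>\<nabla> \<eta> = R \<eta> = 0\<close>. All of this is done in a
  chart, where the connection is a smooth family of bilinear maps.\<close>

section \<open>Smooth maps\<close>

text \<open>The conic condition constrains the differential of the action on parallel fields only,
  so it says something about every tangent vector only once enough parallel fields exist. This
  existence result, a Frobenius theorem, is the analytic core: integrating along rays solves an
  equation in the radial direction alone, and flatness is what makes the radial solution parallel in
  all directions. A second obstacle is that the condition may be applied only on a set where the map
  of the action is a diffeomorphism onto its image; such a set is cut out by requiring that both
  \<open>l\<close> and \<open>inverse l\<close> act. Symmetry of second derivatives is needed twice: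
  to exchange the time and space derivatives of the action, and to identify the square of the
  covariant exterior derivative with the curvature. The torsion enters because the exterior
  covariant derivative of \<open>J\<close>, as a one-form with values in the tangent bundle, equals
  the antisymmetrised covariant derivative of \<open>J\<close> only up to a torsion term.\<close>

lemma Ck_on_cong:
  assumes "open S" "\<And>x. x \<in> S \<Longrightarrow> f x = g x" "Ck_on k S f"
  shows "Ck_on k S g"
  using assms(2,3)
proof (induction k arbitrary: f g)
  case 0
  then show ?case by (simp cong: continuous_on_cong)
next
  case (Suc k)
  have eq: "frechet_derivative g (at x) = frechet_derivative f (at x)" if "x \<in> S" for x
    using frechet_derivative_transform_within_open[of f x S g] that Suc.prems assms(1) by auto
  have "g differentiable (at x)" if "x \<in> S" for x
    using Suc.prems that has_derivative_transform_within_open[OF _ assms(1) that, of f _ UNIV g]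
    by (metis Ck_on.simps(2) differentiable_def)
  moreover have "Ck_on k S (\<lambda>x. frechet_derivative g (at x) v)" for v
    by (rule Suc.IH[of "\<lambda>x. frechet_derivative f (at x) v"]) (use Suc.prems eq in auto)
  ultimately show ?case by simp
qed

lemma Ck_on_subset: "Ck_on k S f \<Longrightarrow> T \<subseteq> S \<Longrightarrow> Ck_on k T f"
  by (induction k arbitrary: f) (auto intro: continuous_on_subset)

lemma Ck_on_Suc_D: "Ck_on (Suc k) S f \<Longrightarrow> Ck_on k S f"
proof (induction k arbitrary: f)
  case 0
  then show ?case
    by (auto intro!: continuous_at_imp_continuous_on differentiable_imp_continuous_within)
next
  case (Suc k)
  have "Ck_on k S (\<lambda>x. frechet_derivative f (at x) v)" for v
    using Ck_on.simps(2)[THEN iffD1, OF Suc.prems] by (intro Suc.IH) blast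
  moreover have "\<forall>x\<in>S. f differentiable (at x)"
    using Ck_on.simps(2)[THEN iffD1, OF Suc.prems] by blast
  ultimately show ?case by simp
qed

section \<open>Closure of C^k maps under sums, bilinear products and composition\<close>

lemma Ck_on_const: "Ck_on k S (\<lambda>x. c)"
  by (induction k arbitrary: c) auto

text \<open>Lets the closure proofs below work with whatever derivative the differentiation rules
  produce, instead of the chosen \<open>frechet_derivative\<close>; the two agree on the open set
  \<open>S\<close>, so \<open>Ck_on_cong\<close> applies.\<close>

lemma Ck_on_SucI:
  assumes "open S" "\<And>x. x \<in> S \<Longrightarrow> (f has_derivative f' x) (at x)" "\<And>v. Ck_on k S (\<lambda>x. f' x v)"
  shows "Ck_on (Suc k) S f"
proof -
  have "Ck_on k S (\<lambda>x. frechet_derivative f (at x) v)" for v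
    using Ck_on_cong[OF assms(1) _ assms(3)[of v]] frechet_derivative_at[OF assms(2)] by simp
  then show ?thesis
    using assms(2) by (auto simp: differentiable_def)
qed

lemma Ck_on_Suc_has_derivative:
  "Ck_on (Suc k) S f \<Longrightarrow> x \<in> S \<Longrightarrow> (f has_derivative frechet_derivative f (at x)) (at x)"
  by (simp add: frechet_derivative_works)

lemma Ck_on_bounded_linear:
  assumes "open S" "bounded_linear f"
  shows "Ck_on k S f"
proof (cases k)
  case 0
  then show ?thesis
    using assms by (simp add: linear_continuous_on)
next
  case (Suc m)
  show ?thesis unfolding Suc
    by (rule Ck_on_SucI[where f' = "\<lambda>_. f"])
      (use assms in \<open>auto intro: Ck_on_const bounded_linear_imp_has_derivative\<close>)
qed

lemma Ck_on_add:
  assumes "open S"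
  shows "Ck_on k S f \<Longrightarrow> Ck_on k S g \<Longrightarrow> Ck_on k S (\<lambda>x. f x + g x)"
proof (induction k arbitrary: f g)
  case 0
  then show ?case by (auto intro: continuous_intros)
next
  case (Suc k)
  show ?case
    by (rule Ck_on_SucI[OF assms has_derivative_add[OF Suc.prems[THEN Ck_on_Suc_has_derivative]]])
      (use Suc in auto)
qed

lemma Ck_on_sum:
  assumes "open S"
  shows "(\<And>i. i \<in> I \<Longrightarrow> Ck_on k S (f i)) \<Longrightarrow> Ck_on k S (\<lambda>x. \<Sum>i\<in>I. f i x)"
  by (induction I rule: infinite_finite_induct) (auto intro: Ck_on_const Ck_on_add[OF assms])

lemma Ck_on_bounded_bilinear:
  assumes "open S" "bounded_bilinear h"
  shows "Ck_on k S f \<Longrightarrow> Ck_on k S g \<Longrightarrow> Ck_on k S (\<lambda>x. h (f x) (g x))"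
proof (induction k arbitrary: f g)
  case 0
  then show ?case by (auto intro: bounded_bilinear.continuous_on[OF assms(2)])
next
  case (Suc k)
  have "Ck_on k S f" "Ck_on k S g"
    using Suc.prems Ck_on_Suc_D by blast+
  then show ?case
    by (intro Ck_on_SucI[OF assms(1) bounded_bilinear.FDERIV[OF assms(2) Suc.prems[THEN Ck_on_Suc_has_derivative]]])
      (use Suc assms in \<open>auto intro!: Ck_on_add\<close>)
qed

lemma Ck_on_linear_comp:
  assumes "open S" "bounded_linear h"
  shows "Ck_on k S f \<Longrightarrow> Ck_on k S (\<lambda>x. h (f x))"
proof (induction k arbitrary: f)
  case 0
  then show ?case by (auto intro: bounded_linear.continuous_on[OF assms(2)])
next
  case (Suc k)
  show ?case
    by (rule Ck_on_SucI[OF assms(1) bounded_linear.has_derivative[OF assms(2) Suc.prems[THEN Ck_on_Suc_has_derivative]]])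
      (use Suc in auto)
qed

text \<open>\<open>Ck_on\<close> controls derivatives in fixed directions only. This expansion turns
  a linear map applied to a vector that moves with the point into finitely many fixed directions
  with scalar coefficients.\<close>

lemma linear_eq_sum_Basis:
  fixes h :: "'v::euclidean_space \<Rightarrow> 'w::real_vector"
  assumes "linear h"
  shows "h v = (\<Sum>b\<in>Basis. (v \<bullet> b) *\<^sub>R h b)"
proof -
  have "h v = h (\<Sum>b\<in>Basis. (v \<bullet> b) *\<^sub>R b)" by (simp add: euclidean_representation)
  then show ?thesis using assms by (simp add: linear_sum linear_scale)
qed

lemma Ck_on_compose:
  fixes g :: "'u::real_normed_vector \<Rightarrow> 'v::euclidean_space" and f :: "'v \<Rightarrow> 'w::real_normed_vector"
  assumes "open S"
  shows "Ck_on k T f \<Longrightarrow> Ck_on k S g \<Longrightarrow> g ` S \<subseteq> T \<Longrightarrow> Ck_on k S (\<lambda>x. f (g x))"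
proof (induction k arbitrary: f g)
  case 0
  then show ?case by (auto intro: continuous_on_compose2)
next
  case (Suc k)
  note df = Suc.prems(1)[THEN Ck_on_Suc_has_derivative] and dg = Suc.prems(2)[THEN Ck_on_Suc_has_derivative]
  \<comment> \<open>The chain rule applies the derivative of \<open>f\<close> in a direction that
    depends on \<open>x\<close>. Written over a basis it becomes a sum of products of maps to which
    the induction hypothesis applies.\<close>
  define h where "h x v = (\<Sum>b\<in>Basis. (frechet_derivative g (at x) v \<bullet> b) *\<^sub>R frechet_derivative f (at (g x)) b)" for x v
  show ?case
  proof (rule Ck_on_SucI[OF assms, where f' = h])
    fix x assume x: "x \<in> S"
    with Suc.prems have gx: "g x \<in> T" by auto
    have "h x = (\<lambda>v. frechet_derivative f (at (g x)) (frechet_derivative g (at x) v))"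
      unfolding h_def using linear_eq_sum_Basis has_derivative_linear[OF df[OF gx]] by metis
    then show "((\<lambda>x. f (g x)) has_derivative h x) (at x)"
      using has_derivative_compose[OF dg[OF x] df[OF gx]] by simp
  next
    fix v
    have g: "Ck_on k S g" using Suc.prems Ck_on_Suc_D by blast
    have "Ck_on k S (\<lambda>x. frechet_derivative f (at (g x)) b)" for b
      by (rule Suc.IH[OF _ g]) (use Suc.prems in auto)
    then show "Ck_on k S (\<lambda>x. h x v)"
      unfolding h_def
      by (intro Ck_on_sum Ck_on_bounded_bilinear[OF assms bounded_bilinear_scaleR]
          Ck_on_linear_comp[OF assms bounded_linear_inner_left] assms) (use Suc.prems in auto)
  qed
qed

lemma Ck_on_Pair:
  assumes "open S" "Ck_on k S f" "Ck_on k S g"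
  shows "Ck_on k S (\<lambda>x. (f x, g x))"
proof -
  have "Ck_on k S (\<lambda>x. (f x, 0) + (0, g x))"
    by (intro Ck_on_add Ck_on_linear_comp[OF assms(1), where h = "\<lambda>y. (y, 0)"]
        Ck_on_linear_comp[OF assms(1), where h = "\<lambda>y. (0, y)"] assms
        bounded_linear_Pair bounded_linear_zero bounded_linear_ident)
  then show ?thesis by simp
qed

section \<open>The same closure properties for smooth maps\<close>

lemma smooth_on_has_derivative:
  "smooth_on S f \<Longrightarrow> x \<in> S \<Longrightarrow> (f has_derivative frechet_derivative f (at x)) (at x)"
  using Ck_on_Suc_has_derivative unfolding smooth_on_def by blast

lemma smooth_on_derivative: "smooth_on S f \<Longrightarrow> smooth_on S (\<lambda>x. frechet_derivative f (at x) v)"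
  unfolding smooth_on_def using Ck_on.simps(2) by blast

lemma smooth_on_continuous_on: "smooth_on S f \<Longrightarrow> continuous_on S f"
  unfolding smooth_on_def using Ck_on.simps(1) by blast

lemma smooth_on_cong: "open S \<Longrightarrow> (\<And>x. x \<in> S \<Longrightarrow> f x = g x) \<Longrightarrow> smooth_on S f \<Longrightarrow> smooth_on S g"
  unfolding smooth_on_def using Ck_on_cong by blast

lemma smooth_on_subset: "smooth_on S f \<Longrightarrow> T \<subseteq> S \<Longrightarrow> smooth_on T f"
  unfolding smooth_on_def using Ck_on_subset by blast

lemma smooth_on_const [simp]: "smooth_on S (\<lambda>x. c)"
  unfolding smooth_on_def using Ck_on_const by blast

lemma smooth_on_bounded_linear: "open S \<Longrightarrow> bounded_linear f \<Longrightarrow> smooth_on S f"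
  unfolding smooth_on_def using Ck_on_bounded_linear by blast

lemma smooth_on_add: "open S \<Longrightarrow> smooth_on S f \<Longrightarrow> smooth_on S g \<Longrightarrow> smooth_on S (\<lambda>x. f x + g x)"
  unfolding smooth_on_def using Ck_on_add by blast

lemma smooth_on_sum:
  "open S \<Longrightarrow> (\<And>i. i \<in> I \<Longrightarrow> smooth_on S (f i)) \<Longrightarrow> smooth_on S (\<lambda>x. \<Sum>i\<in>I. f i x)"
  by (simp add: smooth_on_def Ck_on_sum)

lemma smooth_on_bounded_bilinear:
  "open S \<Longrightarrow> bounded_bilinear h \<Longrightarrow> smooth_on S f \<Longrightarrow> smooth_on S g \<Longrightarrow> smooth_on S (\<lambda>x. h (f x) (g x))"
  unfolding smooth_on_def using Ck_on_bounded_bilinear by blast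

lemmas smooth_on_scaleR = smooth_on_bounded_bilinear[OF _ bounded_bilinear_scaleR]

lemma smooth_on_linear_comp:
  "open S \<Longrightarrow> bounded_linear h \<Longrightarrow> smooth_on S f \<Longrightarrow> smooth_on S (\<lambda>x. h (f x))"
  unfolding smooth_on_def using Ck_on_linear_comp by blast

lemmas smooth_on_inner_const = smooth_on_linear_comp[OF _ bounded_linear_inner_left]

lemma smooth_on_compose:
  fixes g :: "'u::real_normed_vector \<Rightarrow> 'v::euclidean_space"
  shows "open S \<Longrightarrow> smooth_on T f \<Longrightarrow> smooth_on S g \<Longrightarrow> g ` S \<subseteq> T \<Longrightarrow> smooth_on S (\<lambda>x. f (g x))"
  unfolding smooth_on_def using Ck_on_compose by blast

lemma smooth_on_Pair:
  "open S \<Longrightarrow> smooth_on S f \<Longrightarrow> smooth_on S g \<Longrightarrow> smooth_on S (\<lambda>x. (f x, g x))"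
  unfolding smooth_on_def using Ck_on_Pair by blast

lemma smooth_on_ident [simp]: "open S \<Longrightarrow> smooth_on S (\<lambda>x. x)"
  by (rule smooth_on_bounded_linear[OF _ bounded_linear_ident])

text \<open>Regularity for first-order equations: when the derivative is expressed through
  \<open>f\<close> itself, each order of differentiability of \<open>f\<close> passes to the
  derivative and so yields one more order for \<open>f\<close>.\<close>

lemma smooth_on_bootstrap:
  assumes "open S" "\<And>x. x \<in> S \<Longrightarrow> (f has_derivative f' x) (at x)"
    and "\<And>k v. Ck_on k S f \<Longrightarrow> Ck_on k S (\<lambda>x. f' x v)"
  shows "smooth_on S f"
proof -
  have "Ck_on k S f" for k
  proof (induction k)
    case 0
    show ?case
      using assms(2) by (auto intro!: continuous_at_imp_continuous_on has_derivative_continuous)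
  next
    case (Suc k)
    then show ?case using Ck_on_SucI[OF assms(1,2)] assms(3) by blast
  qed
  then show ?thesis by (simp add: smooth_on_def)
qed

lemma smooth_on_derivative_along:
  fixes f :: "'v::euclidean_space \<Rightarrow> 'w::real_normed_vector"
  assumes "open S" "smooth_on S f" "smooth_on S g"
  shows "smooth_on S (\<lambda>x. frechet_derivative f (at x) (g x))"
proof (rule smooth_on_cong[OF assms(1)])
  show "smooth_on S (\<lambda>x. \<Sum>b\<in>Basis. (g x \<bullet> b) *\<^sub>R frechet_derivative f (at x) b)"
    using assms by (intro smooth_on_sum smooth_on_scaleR smooth_on_inner_const smooth_on_derivative)
  show "(\<Sum>b\<in>Basis. (g x \<bullet> b) *\<^sub>R frechet_derivative f (at x) b) = frechet_derivative f (at x) (g x)"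
    if "x \<in> S" for x
    using linear_eq_sum_Basis has_derivative_linear[OF smooth_on_has_derivative[OF assms(2) that]] by metis
qed

section \<open>Differentiation under the integral sign\<close>

lemma Ck_on_mono:
  assumes "j \<le> k" "Ck_on k S f"
  shows "Ck_on j S f"
  using assms(1) by (induction rule: inc_induct) (use assms(2) Ck_on_Suc_D in blast)+

lemma has_derivative_parametric_integral:
  fixes f :: "'v::euclidean_space \<times> real \<Rightarrow> 'w::euclidean_space"
  assumes "open S" "S \<times> {0..1} \<subseteq> T" "Ck_on (Suc 0) T f" "x \<in> S"
  shows "((\<lambda>x. integral {0..1} (\<lambda>t. f (x, t))) has_derivative
    (\<lambda>v. integral {0..1} (\<lambda>t. frechet_derivative f (at (x, t)) (v, 0)))) (at x)"
proof -
  obtain e where e: "e > 0" "ball x e \<subseteq> S"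
    using assms openE by blast
  define U where "U = ball x e"
  have U: "open U" "convex U" "x \<in> U" "U \<times> {0..1} \<subseteq> T"
    using e assms by (auto simp: U_def)
  \<comment> \<open>The Leibniz rule wants the derivative as a continuous family of bounded
    operators. In finite dimension its continuity can be tested on basis vectors, where it is
    continuity of a derivative in a fixed direction. The ball \<open>U\<close> supplies the
    convexity required by that rule.\<close>
  define F where "F y t = Blinfun (\<lambda>v. frechet_derivative f (at (y, t)) (v, 0))" for y t
  have df: "((\<lambda>y. f (y, t)) has_derivative (\<lambda>v. frechet_derivative f (at (y, t)) (v, 0))) (at y)"
    if "y \<in> U" "t \<in> {0..1}" for y t
  proof -
    have "(y, t) \<in> T" using that U by auto
    note d = Ck_on_Suc_has_derivative[OF assms(3) this]
    have "((\<lambda>y. (y, t)) has_derivative (\<lambda>v. (v, 0))) (at y)"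
      by (auto intro!: derivative_eq_intros)
    from has_derivative_compose[OF this, of f] d show ?thesis by simp
  qed
  have F: "blinfun_apply (F y t) = (\<lambda>v. frechet_derivative f (at (y, t)) (v, 0))"
    if "y \<in> U" "t \<in> {0..1}" for y t
    unfolding F_def using bounded_linear_Blinfun_apply has_derivative_bounded_linear[OF df[OF that]] .
  have cf: "continuous_on T f" "\<And>v. continuous_on T (\<lambda>z. frechet_derivative f (at z) v)"
    using Ck_on_Suc_D[OF assms(3)] assms(3) by auto
  have cF: "continuous_on (U \<times> {0..1}) (\<lambda>(y, t). F y t)"
  proof (rule continuous_on_blinfun_componentwise)
    fix b :: 'v
    have "continuous_on (U \<times> {0..1}) (\<lambda>z. frechet_derivative f (at z) (b, 0))"
      by (rule continuous_on_subset[OF cf(2) U(4)])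
    then show "continuous_on (U \<times> {0..1}) (\<lambda>z. blinfun_apply (case z of (y, t) \<Rightarrow> F y t) b)"
      by (rule continuous_on_cong[THEN iffD1, rotated 2]) (auto simp: F)
  qed
  have sec: "continuous_on {0..1} (\<lambda>t. g (y, t))"
    if "y \<in> U" "continuous_on (U \<times> {0..1}) g" for y and g :: "'v \<times> real \<Rightarrow> 'c::topological_space"
    by (rule continuous_on_compose2[OF that(2)]) (use that in \<open>auto intro!: continuous_intros\<close>)
  have Fint: "F x integrable_on {0..1}"
    using sec[OF U(3) cF] by (simp add: integrable_continuous_interval)
  have L: "((\<lambda>x. integral (cbox 0 1) (\<lambda>t. f (x, t))) has_derivative
      blinfun_apply (integral (cbox 0 1) (F x))) (at x within U)"
  proof (rule leibniz_rule[where U = U and fx = F])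
    show "((\<lambda>x. f (x, t)) has_derivative blinfun_apply (F y t)) (at y within U)"
      if "y \<in> U" "t \<in> cbox 0 1" for y t
      using df[of y t] F[of y t] that has_derivative_at_withinI by fastforce
    show "(\<lambda>t. f (y, t)) integrable_on cbox 0 1" if "y \<in> U" for y
      using sec[OF that continuous_on_subset[OF cf(1) U(4)]]
      by (simp add: integrable_continuous_interval)
    show "continuous_on (U \<times> cbox 0 1) (\<lambda>(y, t). F y t)" using cF by simp
  qed (use U in auto)
  have ap: "blinfun_apply (integral (cbox 0 1) (F x)) v =
      integral {0..1} (\<lambda>t. frechet_derivative f (at (x, t)) (v, 0))" for v
  proof -
    have "integral {0..1} ((\<lambda>h. blinfun_apply h v) \<circ> F x) = blinfun_apply (integral {0..1} (F x)) v"
      by (rule integral_linear[OF Fint]) (rule blinfun.bounded_linear_left)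
    moreover have "integral {0..1} ((\<lambda>h. blinfun_apply h v) \<circ> F x) =
      integral {0..1} (\<lambda>t. frechet_derivative f (at (x, t)) (v, 0))"
      by (rule integral_cong) (simp add: F U)
    ultimately show ?thesis by simp
  qed
  have "blinfun_apply (integral (cbox 0 1) (F x)) =
      (\<lambda>v. integral {0..1} (\<lambda>t. frechet_derivative f (at (x, t)) (v, 0)))"
    using ap by blast
  with L show ?thesis
    unfolding at_within_open[OF U(3,1)] by (simp only: box_real)
qed

text \<open>The derivative of a parametric integral is again a parametric integral, of an integrand
  one order less regular, so the induction runs on the order.\<close>

lemma Ck_on_parametric_integral:
  fixes f :: "'v::euclidean_space \<times> real \<Rightarrow> 'w::euclidean_space"
  assumes "open S" "S \<times> {0..1} \<subseteq> T"
  shows "Ck_on k T f \<Longrightarrow> Ck_on k S (\<lambda>x. integral {0..1} (\<lambda>t. f (x, t)))"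
proof (induction k arbitrary: f)
  case 0
  then have "continuous_on (S \<times> cbox 0 1) (\<lambda>(x, t). f (x, t))"
    using assms(2) continuous_on_subset by auto
  from integral_continuous_on_param[OF this] show ?case by simp
next
  case (Suc k)
  have C1: "Ck_on (Suc 0) T f"
    by (rule Ck_on_mono[OF _ Suc.prems]) simp
  show ?case
  proof (rule Ck_on_SucI[OF assms(1) has_derivative_parametric_integral[OF assms C1]])
    show "Ck_on k S (\<lambda>x. integral {0..1} (\<lambda>t. frechet_derivative f (at (x, t)) (v, 0)))" for v
      by (rule Suc.IH[where f = "\<lambda>z. frechet_derivative f (at z) (v, 0)"]) (use Suc.prems in auto)
  qed
qed

lemma smooth_on_parametric_integral:
  fixes f :: "'v::euclidean_space \<times> real \<Rightarrow> 'w::euclidean_space"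
  shows "open S \<Longrightarrow> S \<times> {0..1} \<subseteq> T \<Longrightarrow> smooth_on T f \<Longrightarrow>
    smooth_on S (\<lambda>x. integral {0..1} (\<lambda>t. f (x, t)))"
  unfolding smooth_on_def using Ck_on_parametric_integral by blast

section \<open>Symmetry of second derivatives\<close>

lemma has_vector_derivative_quotient:
  fixes f :: "real \<Rightarrow> 'w::real_normed_vector"
  assumes "(f has_vector_derivative D) (at 0)"
  shows "((\<lambda>h. (1 / h) *\<^sub>R (f h - f 0)) \<longlongrightarrow> D) (at 0)"
proof -
  have "((\<lambda>h. norm (f (0 + h) - f 0 - h *\<^sub>R D) / norm h) \<longlongrightarrow> 0) (at 0)"
    using assms unfolding has_vector_derivative_def has_derivative_at by blast
  moreover have "\<forall>\<^sub>F h in at 0. norm (f (0 + h) - f 0 - h *\<^sub>R D) / norm h = norm ((1 / h) *\<^sub>R (f h - f 0) - D)"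
    unfolding eventually_at
  proof (intro exI[of _ 1] conjI ballI impI)
    fix h :: real assume h: "h \<noteq> 0 \<and> dist h 0 < 1"
    then have "f (0 + h) - f 0 - h *\<^sub>R D = h *\<^sub>R ((1 / h) *\<^sub>R (f h - f 0) - D)"
      by (simp add: algebra_simps)
    then have "norm (f (0 + h) - f 0 - h *\<^sub>R D) = \<bar>h\<bar> * norm ((1 / h) *\<^sub>R (f h - f 0) - D)"
      by (metis norm_scaleR)
    then show "norm (f (0 + h) - f 0 - h *\<^sub>R D) / norm h = norm ((1 / h) *\<^sub>R (f h - f 0) - D)"
      using h by simp
  qed simp
  ultimately have "((\<lambda>h. norm ((1 / h) *\<^sub>R (f h - f 0) - D)) \<longlongrightarrow> 0) (at 0)"
    by (rule Lim_transform_eventually)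
  then show ?thesis
    by (subst Lim_null) (rule tendsto_norm_zero_cancel)
qed

text \<open>The difference quotients of \<open>f\<close> in direction \<open>v\<close> are parametric integrals of the
  derivative, which may be differentiated in direction \<open>u\<close> under the integral sign.\<close>

lemma smooth_on_derivative_commute:
  fixes f :: "'v::euclidean_space \<Rightarrow> 'w::euclidean_space"
  assumes "open S" "smooth_on S f" "x \<in> S"
  shows "frechet_derivative (\<lambda>y. frechet_derivative f (at y) v) (at x) u =
    frechet_derivative (\<lambda>y. frechet_derivative f (at y) u) (at x) v"
proof -
  define D where "D w y = frechet_derivative f (at y) w" for w y
  obtain r where r: "r > 0" "ball x r \<subseteq> S" using assms openE by blast
  \<comment> \<open>Chosen so that a shift by at most \<open>e\<close> along \<open>v\<close> moves
    a point by at most \<open>r / 2\<close>, which keeps points of the half-sized ball inside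
    \<open>ball x r\<close>. Adding 1 to the norm covers \<open>v = 0\<close>.\<close>
  define e where "e = r / (2 * (norm v + 1))"
  have nv: "norm v + 1 > 0" by (smt (verit) norm_ge_zero)
  have e0: "e > 0" using r nv by (simp add: e_def)
  have ev: "e * norm v \<le> r / 2"
  proof -
    have "e * norm v \<le> e * (norm v + 1)" using e0 by simp
    also have "\<dots> = r / 2" using nv by (simp add: e_def field_simps)
    finally show ?thesis .
  qed
  have inS: "y + (h * t) *\<^sub>R v \<in> S" if "y \<in> ball x (r/2)" "\<bar>h\<bar> < e" "t \<in> {0..1}" for y h t
  proof -
    have "\<bar>h\<bar> * \<bar>t\<bar> \<le> e * 1"
      by (rule mult_mono) (use that e0 in auto)
    then have "norm ((h * t) *\<^sub>R v) \<le> e * norm v"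
      by (simp add: abs_mult mult_right_mono)
    then have "dist x (y + (h * t) *\<^sub>R v) < r"
      using that(1) ev dist_triangle[of x "y + (h * t) *\<^sub>R v" y] by (simp add: dist_norm)
    then show ?thesis using r by auto
  qed
  have dD: "(D w has_derivative frechet_derivative (D w) (at y)) (at y)" if "y \<in> S" for w y
    unfolding D_def using smooth_on_has_derivative[OF smooth_on_derivative[OF assms(2)] that] .
  \<comment> \<open>\<open>K h\<close> averages the second derivative over the segment from
    \<open>x\<close> to \<open>x + h v\<close>. At \<open>h = 0\<close> it is one mixed derivative;
    for other small \<open>h\<close> it is a difference quotient converging to the other one.
    Continuity of \<open>K\<close> at 0 then identifies them.\<close>
  define K where "K h = integral {0..1} (\<lambda>t. frechet_derivative (D v) (at (x + (h * t) *\<^sub>R v)) u)" for h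
  \<comment> \<open>Both sides are the derivative at \<open>x\<close> in direction \<open>u\<close>
    of the difference quotient of \<open>f\<close> along \<open>v\<close>: the left side after
    writing the quotient as an integral of \<open>D v\<close> and differentiating under the
    integral, the right side directly.\<close>
  have K: "K h = (1 / h) *\<^sub>R (D u (x + h *\<^sub>R v) - D u x)" if h: "h \<noteq> 0" "\<bar>h\<bar> < e" for h
  proof -
    define B where "B = ball x (r/2)"
    have B: "open B" "x \<in> B" using r by (auto simp: B_def)
    \<comment> \<open>\<open>smooth_on\<close> is meaningful on open sets only, while the parameter
      ranges over a closed interval; \<open>T\<close> is an open neighbourhood of
      \<open>B \<times> {0..1}\<close> on which the integrand is still smooth.\<close>
    define T where "T = (\<lambda>z. fst z + (h * snd z) *\<^sub>R v) -` S"
    have T: "open T" unfolding T_def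
      by (intro open_vimage assms continuous_intros)
    have BT: "B \<times> {0..1} \<subseteq> T" using inS h by (auto simp: B_def T_def)
    define g where "g z = D v (fst z + (h * snd z) *\<^sub>R v)" for z
    have "smooth_on T (\<lambda>z. fst z + (h * snd z) *\<^sub>R v)"
      by (intro smooth_on_bounded_linear T bounded_linear_add bounded_linear_fst
          bounded_linear_compose[OF bounded_linear_scaleR_left]
          bounded_linear_compose[OF bounded_linear_mult_right] bounded_linear_snd)
    moreover have "smooth_on S (D v)"
      unfolding D_def by (rule smooth_on_derivative[OF assms(2)])
    ultimately have g: "smooth_on T g"
      unfolding g_def using smooth_on_compose[OF T, of S "D v"] by (simp add: T_def image_subset_iff)
    have dg: "frechet_derivative g (at (x, t)) (u, 0) = frechet_derivative (D v) (at (x + (h * t) *\<^sub>R v)) u"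
      if t: "t \<in> {0..1}" for t
    proof -
      have "((\<lambda>z. fst z + (h * snd z) *\<^sub>R v) has_derivative (\<lambda>w. fst w + (h * snd w) *\<^sub>R v)) (at (x, t))"
        by (auto intro!: derivative_eq_intros)
      moreover have "x + (h * t) *\<^sub>R v \<in> S" using inS[of x h t] h t r by auto
      ultimately have "(g has_derivative (\<lambda>w. frechet_derivative (D v) (at (x + (h * t) *\<^sub>R v)) (fst w + (h * snd w) *\<^sub>R v))) (at (x, t))"
        unfolding g_def using has_derivative_compose[of _ _ "(x, t)" UNIV "D v"] dD by fastforce
      from frechet_derivative_at[OF this, symmetric] show ?thesis by simp
    qed
    have "((\<lambda>y. integral {0..1} (\<lambda>t. g (y, t))) has_derivative
        (\<lambda>w. integral {0..1} (\<lambda>t. frechet_derivative g (at (x, t)) (w, 0)))) (at x)"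
      using has_derivative_parametric_integral[OF B(1) BT _ B(2)] g unfolding smooth_on_def by blast
    moreover have "integral {0..1} (\<lambda>t. g (y, t)) = (1 / h) *\<^sub>R (f (y + h *\<^sub>R v) - f y)" if y: "y \<in> B" for y
    proof -
      have "((\<lambda>t. h *\<^sub>R g (y, t)) has_integral f (y + (h * 1) *\<^sub>R v) - f (y + (h * 0) *\<^sub>R v)) {0..1}"
      proof (rule fundamental_theorem_of_calculus)
        fix t :: real assume t: "t \<in> {0..1}"
        have s: "y + (h * t) *\<^sub>R v \<in> S" using inS[of y h t] h t y by (auto simp: B_def)
        have "((\<lambda>t. y + (h * t) *\<^sub>R v) has_derivative (\<lambda>s. s *\<^sub>R (h *\<^sub>R v))) (at t within {0..1})"
          by (auto intro!: derivative_eq_intros)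
        from has_derivative_compose[OF this smooth_on_has_derivative[OF assms(2) s]]
        show "((\<lambda>t. f (y + (h * t) *\<^sub>R v)) has_vector_derivative h *\<^sub>R g (y, t)) (at t within {0..1})"
          unfolding has_vector_derivative_def g_def D_def
          using has_derivative_linear[OF smooth_on_has_derivative[OF assms(2) s]]
          by (simp add: linear_scale)
      qed simp
      from has_integral_cmul[OF this, of "1/h"] h show ?thesis
        by (simp add: integral_unique)
    qed
    ultimately have 1: "((\<lambda>y. (1 / h) *\<^sub>R (f (y + h *\<^sub>R v) - f y)) has_derivative
        (\<lambda>w. integral {0..1} (\<lambda>t. frechet_derivative g (at (x, t)) (w, 0)))) (at x)"
      by (rule has_derivative_transform_within_open[OF _ B])
    have xh: "x \<in> S" "x + h *\<^sub>R v \<in> S" using assms inS[of x h 1] h r by auto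
    have "((\<lambda>y. y + h *\<^sub>R v) has_derivative (\<lambda>w. w)) (at x)"
      by (auto intro!: derivative_eq_intros)
    from has_derivative_compose[OF this smooth_on_has_derivative[OF assms(2) xh(2)]]
    have "((\<lambda>y. (1 / h) *\<^sub>R (f (y + h *\<^sub>R v) - f y)) has_derivative
        (\<lambda>w. (1 / h) *\<^sub>R (D w (x + h *\<^sub>R v) - D w x))) (at x)"
      unfolding D_def by (intro has_derivative_scaleR_right has_derivative_diff smooth_on_has_derivative[OF assms(2) xh(1)])
    from has_derivative_unique[OF 1 this]
    have "integral {0..1} (\<lambda>t. frechet_derivative g (at (x, t)) (u, 0)) = (1 / h) *\<^sub>R (D u (x + h *\<^sub>R v) - D u x)"
      by (simp add: fun_eq_iff)
    moreover have "integral {0..1} (\<lambda>t. frechet_derivative g (at (x, t)) (u, 0)) = K h"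
      unfolding K_def using dg by (intro integral_cong) auto
    ultimately show ?thesis by simp
  qed
  have "continuous_on (ball 0 e \<times> cbox 0 1) (\<lambda>(h, t). frechet_derivative (D v) (at (x + (h * t) *\<^sub>R v)) u)"
  proof -
    have "continuous_on S (\<lambda>y. frechet_derivative (D v) (at y) u)"
      unfolding D_def by (intro smooth_on_continuous_on smooth_on_derivative assms)
    moreover have "continuous_on (ball 0 e \<times> cbox 0 1) (\<lambda>z::real \<times> real. x + (fst z * snd z) *\<^sub>R v)"
      by (intro continuous_intros)
    ultimately show ?thesis
      unfolding case_prod_beta by (rule continuous_on_compose2) (use inS[of x] r in auto)
  qed
  from integral_continuous_on_param[OF this]
  have "continuous_on (ball 0 e) K" by (simp add: K_def)
  then have "isCont K 0" using e0 by (simp add: continuous_on_eq_continuous_at)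
  then have lim1: "(K \<longlongrightarrow> K 0) (at 0)" by (simp add: isCont_def)
  have K0: "K 0 = frechet_derivative (D v) (at x) u" by (simp add: K_def)
  have "((\<lambda>h. x + h *\<^sub>R v) has_derivative (\<lambda>s. s *\<^sub>R v)) (at (0::real))"
    by (auto intro!: derivative_eq_intros)
  from has_derivative_compose[OF this, of "D u" "frechet_derivative (D u) (at x)"] dD[OF assms(3), of u]
  have "((\<lambda>h. D u (x + h *\<^sub>R v)) has_vector_derivative frechet_derivative (D u) (at x) v) (at 0)"
    using has_derivative_linear[OF dD[OF assms(3), of u]]
    by (simp add: has_vector_derivative_def linear_scale)
  then have "((\<lambda>h. (1 / h) *\<^sub>R (D u (x + h *\<^sub>R v) - D u x)) \<longlongrightarrow> frechet_derivative (D u) (at x) v) (at 0)"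
    by (rule has_vector_derivative_quotient[where f = "\<lambda>h. D u (x + h *\<^sub>R v)", simplified])
  then have "(K \<longlongrightarrow> frechet_derivative (D u) (at x) v) (at 0)"
  proof (rule Lim_transform_eventually)
    show "\<forall>\<^sub>F h in at 0. (1 / h) *\<^sub>R (D u (x + h *\<^sub>R v) - D u x) = K h"
      unfolding eventually_at using K e0 by (intro exI[of _ e]) auto
  qed
  with lim1 have "K 0 = frechet_derivative (D u) (at x) v"
    using LIM_unique by blast
  then show ?thesis using K0 by (simp add: D_def[abs_def])
qed

section \<open>Linear maps depending smoothly on a point, and one-forms\<close>

lemma frechet_derivative_linear_family:
  fixes \<alpha> :: "'v::real_normed_vector \<Rightarrow> 'u::euclidean_space \<Rightarrow> 'w::real_normed_vector"
  assumes "\<And>v. smooth_on S (\<lambda>x. \<alpha> x v)" "\<And>x. linear (\<alpha> x)" "x \<in> S"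
  shows "linear (\<lambda>u. frechet_derivative (\<lambda>y. \<alpha> y u) (at x) w)"
proof (rule linearI)
  note d = smooth_on_has_derivative[OF assms(1,3)]
  show "frechet_derivative (\<lambda>y. \<alpha> y (a + b)) (at x) w =
    frechet_derivative (\<lambda>y. \<alpha> y a) (at x) w + frechet_derivative (\<lambda>y. \<alpha> y b) (at x) w" for a b
    using frechet_derivative_at[OF has_derivative_add[OF d[of a] d[of b]], THEN fun_cong, of w]
    by (simp add: linear_add[OF assms(2)])
  show "frechet_derivative (\<lambda>y. \<alpha> y (c *\<^sub>R a)) (at x) w = c *\<^sub>R frechet_derivative (\<lambda>y. \<alpha> y a) (at x) w" for a c
    using frechet_derivative_at[OF has_derivative_scaleR_right[OF d[of a], of c], THEN fun_cong, of w]
    by (simp add: linear_scale[OF assms(2)])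
qed

text \<open>The product rule for evaluating a family of linear maps at a moving vector. Smoothness
  is assumed for each fixed vector, so the moving vector is expanded in a basis and the result
  reassembled, which uses that the derivative of the family is again linear in its vector
  argument.\<close>

lemma has_derivative_linear_family:
  fixes \<alpha> :: "'v::real_normed_vector \<Rightarrow> 'u::euclidean_space \<Rightarrow> 'w::real_normed_vector"
  assumes "\<And>v. smooth_on S (\<lambda>x. \<alpha> x v)" "\<And>x. linear (\<alpha> x)"
    and g: "(g has_derivative g') (at z)" and h: "(h has_derivative h') (at z)" and z: "g z \<in> S"
  shows "((\<lambda>z. \<alpha> (g z) (h z)) has_derivative
    (\<lambda>v. frechet_derivative (\<lambda>y. \<alpha> y (h z)) (at (g z)) (g' v) + \<alpha> (g z) (h' v))) (at z)"
proof -
  have "((\<lambda>z. \<Sum>b\<in>Basis. (h z \<bullet> b) *\<^sub>R \<alpha> (g z) b) has_derivative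
    (\<lambda>v. \<Sum>b\<in>Basis. (h z \<bullet> b) *\<^sub>R frechet_derivative (\<lambda>y. \<alpha> y b) (at (g z)) (g' v) + (h' v \<bullet> b) *\<^sub>R \<alpha> (g z) b)) (at z)"
    by (intro has_derivative_sum has_derivative_scaleR has_derivative_inner_left h
        has_derivative_compose[OF g smooth_on_has_derivative[OF assms(1) z]])
  moreover have "(\<lambda>z. \<Sum>b\<in>Basis. (h z \<bullet> b) *\<^sub>R \<alpha> (g z) b) = (\<lambda>z. \<alpha> (g z) (h z))"
    by (simp add: linear_eq_sum_Basis[OF assms(2), symmetric])
  moreover have "(\<Sum>b\<in>Basis. (h z \<bullet> b) *\<^sub>R frechet_derivative (\<lambda>y. \<alpha> y b) (at (g z)) (g' v) + (h' v \<bullet> b) *\<^sub>R \<alpha> (g z) b)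
    = frechet_derivative (\<lambda>y. \<alpha> y (h z)) (at (g z)) (g' v) + \<alpha> (g z) (h' v)" for v
    unfolding sum.distrib linear_eq_sum_Basis[OF assms(2), symmetric]
    by (subst linear_eq_sum_Basis[OF frechet_derivative_linear_family[OF assms(1,2) z], symmetric]) simp
  ultimately show ?thesis by simp
qed

lemma smooth_on_linear_family:
  fixes \<alpha> :: "'v::euclidean_space \<Rightarrow> 'u::euclidean_space \<Rightarrow> 'w::real_normed_vector"
  assumes "open T" "\<And>v. smooth_on S (\<lambda>x. \<alpha> x v)" "\<And>x. linear (\<alpha> x)"
    and "smooth_on T g" "smooth_on T h" "g ` T \<subseteq> S"
  shows "smooth_on T (\<lambda>z. \<alpha> (g z) (h z))"
proof -
  have "smooth_on T (\<lambda>z. \<Sum>b\<in>Basis. (h z \<bullet> b) *\<^sub>R \<alpha> (g z) b)"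
    by (intro smooth_on_sum smooth_on_scaleR smooth_on_inner_const assms
        smooth_on_compose[OF assms(1) assms(2) assms(4)])
  then show ?thesis
    by (simp add: linear_eq_sum_Basis[OF assms(3), symmetric])
qed

text \<open>The homotopy operator of the Poincare lemma, applied to a one-form \<open>\<alpha>\<close>.\<close>

lemma
  fixes \<alpha> :: "'v::euclidean_space \<Rightarrow> 'v \<Rightarrow> 'w::euclidean_space"
  assumes S: "open S" and star: "\<And>x t. x \<in> S \<Longrightarrow> t \<in> {0..1} \<Longrightarrow> t *\<^sub>R x \<in> S"
    and \<alpha>: "\<And>v. smooth_on S (\<lambda>x. \<alpha> x v)" "\<And>x. linear (\<alpha> x)"
  shows smooth_on_radial_integral: "smooth_on S (\<lambda>x. integral {0..1} (\<lambda>t. \<alpha> (t *\<^sub>R x) x))"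
    and has_derivative_radial_integral: "x \<in> S \<Longrightarrow>
      ((\<lambda>x. integral {0..1} (\<lambda>t. \<alpha> (t *\<^sub>R x) x)) has_derivative
       (\<lambda>v. \<alpha> x v + integral {0..1} (\<lambda>t. t *\<^sub>R (frechet_derivative (\<lambda>y. \<alpha> y x) (at (t *\<^sub>R x)) v
          - frechet_derivative (\<lambda>y. \<alpha> y v) (at (t *\<^sub>R x)) x)))) (at x)"
proof -
  define T where "T = (\<lambda>z::'v \<times> real. snd z *\<^sub>R fst z) -` S"
  \<comment> \<open>As for second derivatives, \<open>T\<close> is an open set around
    \<open>S \<times> {0..1}\<close>; it contains that product because \<open>S\<close> is
    star-shaped about 0.\<close>
  have T: "open T" unfolding T_def by (intro open_vimage S continuous_intros)
  have ST: "S \<times> {0..1} \<subseteq> T" using star by (auto simp: T_def)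
  define f where "f z = \<alpha> (snd z *\<^sub>R fst z) (fst z)" for z :: "'v \<times> real"
  have f: "smooth_on T f"
    unfolding f_def
  proof (rule smooth_on_linear_family[OF T \<alpha>])
    show "smooth_on T fst" by (rule smooth_on_bounded_linear[OF T bounded_linear_fst])
    then show "smooth_on T (\<lambda>z. snd z *\<^sub>R fst z)"
      by (intro smooth_on_scaleR T smooth_on_bounded_linear[OF T bounded_linear_snd])
  qed (auto simp: T_def)
  show "smooth_on S (\<lambda>x. integral {0..1} (\<lambda>t. \<alpha> (t *\<^sub>R x) x))"
    using smooth_on_parametric_integral[OF S ST f] by (simp add: f_def)
  assume x: "x \<in> S"
  have df: "frechet_derivative f (at (x, t)) (v, 0) =
      t *\<^sub>R frechet_derivative (\<lambda>y. \<alpha> y x) (at (t *\<^sub>R x)) v + \<alpha> (t *\<^sub>R x) v" if t: "t \<in> {0..1}" for t v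
  proof -
    have "((\<lambda>z. snd z *\<^sub>R fst z) has_derivative (\<lambda>w. t *\<^sub>R fst w + snd w *\<^sub>R x)) (at (x, t))"
      by (auto intro!: derivative_eq_intros)
    moreover have "(fst has_derivative fst) (at (x, t))"
      by (intro bounded_linear_imp_has_derivative bounded_linear_fst)
    ultimately have "(f has_derivative (\<lambda>w. frechet_derivative (\<lambda>y. \<alpha> y (fst (x, t))) (at (snd (x, t) *\<^sub>R fst (x, t))) (t *\<^sub>R fst w + snd w *\<^sub>R x)
      + \<alpha> (snd (x, t) *\<^sub>R fst (x, t)) (fst w))) (at (x, t))"
      unfolding f_def by (rule has_derivative_linear_family[OF \<alpha>]) (use star x t in auto)
    from frechet_derivative_at[OF this, symmetric] show ?thesis
      using has_derivative_linear[OF smooth_on_has_derivative[OF \<alpha>(1) star[OF x t]]]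
      by (simp add: linear_scale)
  qed
  have "((\<lambda>x. integral {0..1} (\<lambda>t. f (x, t))) has_derivative
      (\<lambda>v. integral {0..1} (\<lambda>t. frechet_derivative f (at (x, t)) (v, 0)))) (at x)"
    using has_derivative_parametric_integral[OF S ST _ x] f unfolding smooth_on_def by blast
  moreover have "integral {0..1} (\<lambda>t. frechet_derivative f (at (x, t)) (v, 0)) =
     \<alpha> x v + integral {0..1} (\<lambda>t. t *\<^sub>R (frechet_derivative (\<lambda>y. \<alpha> y x) (at (t *\<^sub>R x)) v
          - frechet_derivative (\<lambda>y. \<alpha> y v) (at (t *\<^sub>R x)) x))" for v
  proof -
    let ?A = "\<lambda>t. frechet_derivative f (at (x, t)) (v, 0)"
    \<comment> \<open>\<open>?B\<close> is the derivative in \<open>t\<close> of \<open>t\<close>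
      times \<open>\<alpha>\<close> at \<open>t x\<close> on \<open>v\<close>, so it integrates to
      \<open>\<alpha> x v\<close>. The difference of \<open>?A\<close> and \<open>?B\<close> is
      \<open>t\<close> times the exterior derivative of \<open>\<alpha>\<close>, which gives the
      error term of the homotopy formula.\<close>
    let ?B = "\<lambda>t. \<alpha> (t *\<^sub>R x) v + t *\<^sub>R frechet_derivative (\<lambda>y. \<alpha> y v) (at (t *\<^sub>R x)) x"
    have "continuous_on {0..1} (\<lambda>t. frechet_derivative f (at (x, t)) (v, 0))"
      by (rule continuous_on_compose2[OF smooth_on_continuous_on[OF smooth_on_derivative[OF f]]])
        (use ST x in \<open>auto intro!: continuous_intros\<close>)
    then have "?A integrable_on {0..1}"
      by (rule integrable_continuous_interval)
    then have A: "(?A has_integral integral {0..1} ?A) {0..1}"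
      by (rule integrable_integral)
    have B: "(?B has_integral 1 *\<^sub>R \<alpha> (1 *\<^sub>R x) v - 0 *\<^sub>R \<alpha> (0 *\<^sub>R x) v) {0..1}"
    proof (rule fundamental_theorem_of_calculus)
      fix t :: real assume t: "t \<in> {0..1}"
      note d = smooth_on_has_derivative[OF \<alpha>(1) star[OF x t], of v]
      have "((\<lambda>t. t *\<^sub>R x) has_derivative (\<lambda>s. s *\<^sub>R x)) (at t within {0..1})"
        by (auto intro!: derivative_eq_intros)
      from has_derivative_scaleR[OF has_derivative_ident has_derivative_compose[OF this d]]
      show "((\<lambda>t. t *\<^sub>R \<alpha> (t *\<^sub>R x) v) has_vector_derivative ?B t) (at t within {0..1})"
        unfolding has_vector_derivative_def
        by (simp add: linear_scale[OF has_derivative_linear[OF d]] scaleR_add_right add.commute mult.commute)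
    qed simp
    have "((\<lambda>t. ?A t - ?B t) has_integral integral {0..1} ?A - \<alpha> x v) {0..1}"
      using has_integral_diff[OF A B] by simp
    then have "((\<lambda>t. t *\<^sub>R (frechet_derivative (\<lambda>y. \<alpha> y x) (at (t *\<^sub>R x)) v
          - frechet_derivative (\<lambda>y. \<alpha> y v) (at (t *\<^sub>R x)) x)) has_integral integral {0..1} ?A - \<alpha> x v) {0..1}"
      by (rule has_integral_eq[rotated]) (simp add: df algebra_simps)
    then show ?thesis by (simp add: integral_unique)
  qed
  ultimately show "((\<lambda>x. integral {0..1} (\<lambda>t. \<alpha> (t *\<^sub>R x) x)) has_derivative
       (\<lambda>v. \<alpha> x v + integral {0..1} (\<lambda>t. t *\<^sub>R (frechet_derivative (\<lambda>y. \<alpha> y x) (at (t *\<^sub>R x)) v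
          - frechet_derivative (\<lambda>y. \<alpha> y v) (at (t *\<^sub>R x)) x)))) (at x)"
    by (simp add: f_def)
qed

section \<open>Parallel sections of flat connections\<close>

text \<open>Compactness bounds each of the finitely many coefficient functions on pairs of basis
  vectors, and bilinearity extends the bound to all arguments.\<close>

lemma bilinear_family_bounded:
  fixes \<Gamma> :: "'x::topological_space \<Rightarrow> 'u::euclidean_space \<Rightarrow> 'v::euclidean_space \<Rightarrow> 'w::real_normed_vector"
  assumes "compact K" "\<And>u w. continuous_on K (\<lambda>x. \<Gamma> x u w)"
    and "\<And>x u. linear (\<Gamma> x u)" "\<And>x w. linear (\<lambda>u. \<Gamma> x u w)"
  obtains C where "C > 0" "\<And>x u w. x \<in> K \<Longrightarrow> norm (\<Gamma> x u w) \<le> C * norm u * norm w"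
proof -
  have "\<forall>a b. \<exists>M\<ge>0. \<forall>x\<in>K. norm (\<Gamma> x a b) \<le> M"
  proof (intro allI)
    fix a b
    have "bounded ((\<lambda>x. \<Gamma> x a b) ` K)"
      using compact_continuous_image[OF assms(2,1)] compact_imp_bounded by blast
    then obtain M where "\<forall>y\<in>(\<lambda>x. \<Gamma> x a b) ` K. norm y \<le> M"
      unfolding bounded_iff by blast
    then show "\<exists>M\<ge>0. \<forall>x\<in>K. norm (\<Gamma> x a b) \<le> M"
      by (intro exI[of _ "max M 0"]) auto
  qed
  then obtain M where M: "\<And>a b. M a b \<ge> 0" "\<And>a b x. x \<in> K \<Longrightarrow> norm (\<Gamma> x a b) \<le> M a b"
    by metis
  \<comment> \<open>The summand 1 makes \<open>C\<close> strictly positive, so that a radius may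
    later be defined by dividing by it.\<close>
  define C where "C = 1 + (\<Sum>a\<in>Basis. \<Sum>b\<in>Basis. M a b)"
  have C: "C > 0" unfolding C_def using M(1) by (intro add_pos_nonneg sum_nonneg) auto
  show thesis
  proof (rule that[OF C])
    fix x u w assume x: "x \<in> K"
    have "\<Gamma> x u w = (\<Sum>a\<in>Basis. (u \<bullet> a) *\<^sub>R \<Gamma> x a w)"
      by (rule linear_eq_sum_Basis[OF assms(4)])
    also have "\<dots> = (\<Sum>a\<in>Basis. (u \<bullet> a) *\<^sub>R (\<Sum>b\<in>Basis. (w \<bullet> b) *\<^sub>R \<Gamma> x a b))"
      by (simp add: linear_eq_sum_Basis[OF assms(3), symmetric])
    also have "norm \<dots> \<le> (\<Sum>a\<in>Basis. norm u * (\<Sum>b\<in>Basis. norm w * M a b))"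
      by (intro order_trans[OF norm_sum] sum_mono)
        (auto intro!: mult_mono sum_nonneg order_trans[OF norm_sum] sum_mono
          simp: Basis_le_norm M x)
    also have "\<dots> = (C - 1) * norm u * norm w"
      by (simp add: C_def sum_distrib_left sum_distrib_right mult_ac)
    also have "\<dots> \<le> C * norm u * norm w"
      by (simp add: mult_right_mono)
    finally show "norm (\<Gamma> x u w) \<le> C * norm u * norm w" .
  qed
qed

text \<open>Picard iteration along rays. The defect \<open>E\<^sub>k = dY\<^sub>k + \<Gamma> Y\<^sub>k\<close> of the iterates
  satisfies a linear recursion because the curvature vanishes, and tends to zero geometrically.\<close>

lemma flat_section_exists_at_0:
  fixes \<Gamma> :: "'v::euclidean_space \<Rightarrow> 'v \<Rightarrow> 'w::euclidean_space \<Rightarrow> 'w"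
  assumes \<Omega>: "open \<Omega>" "0 \<in> \<Omega>"
    and sm: "\<And>u w. smooth_on \<Omega> (\<lambda>x. \<Gamma> x u w)"
    and lin: "\<And>x u. linear (\<Gamma> x u)" "\<And>x w. linear (\<lambda>u. \<Gamma> x u w)"
    and flat: "\<And>x u v w. x \<in> \<Omega> \<Longrightarrow>
      frechet_derivative (\<lambda>y. \<Gamma> y v w) (at x) u + \<Gamma> x u (\<Gamma> x v w) =
      frechet_derivative (\<lambda>y. \<Gamma> y u w) (at x) v + \<Gamma> x v (\<Gamma> x u w)"
  obtains r Y where "r > 0" "ball 0 r \<subseteq> \<Omega>" "smooth_on (ball 0 r) Y" "Y 0 = w"
    "\<And>x. x \<in> ball 0 r \<Longrightarrow> (Y has_derivative (\<lambda>v. - \<Gamma> x v (Y x))) (at x)"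
proof -
  obtain r0 where r0: "r0 > 0" "cball 0 r0 \<subseteq> \<Omega>"
    using \<Omega> open_contains_cball by blast
  obtain C where C: "C > 0" "\<And>x u w. x \<in> cball 0 r0 \<Longrightarrow> norm (\<Gamma> x u w) \<le> C * norm u * norm w"
    using bilinear_family_bounded[OF compact_cball
          continuous_on_subset[OF smooth_on_continuous_on[OF sm] r0(2)] lin] by blast
  \<comment> \<open>This gives \<open>C * norm x \<le> 1/8\<close> on \<open>S\<close>: small enough
    for the iterates to contract, and for each curvature term in the recursion for the defect to
    cost half of the available bound.\<close>
  define r where "r = min r0 (1 / (8 * C))"
  define S where "S = ball (0::'v) r"
  have r: "r > 0" using r0 C by (simp add: r_def)
  have S: "open S" "convex S" "0 \<in> S" using r by (auto simp: S_def)
  have S\<Omega>: "S \<subseteq> \<Omega>" using r0 by (auto simp: S_def r_def)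
  have star: "t *\<^sub>R x \<in> S" if "x \<in> S" "t \<in> {0..1}" for x t
    using that mult_left_le_one_le[of "norm x" t] by (auto simp: S_def)
  have CS: "norm (\<Gamma> x u w) \<le> C * norm u * norm w" if "x \<in> S" for x u w
    using that by (intro C) (auto simp: S_def r_def)
  have C8: "C * norm x \<le> 1/8" if "x \<in> S" for x
  proof -
    have "norm x \<le> 1 / (8 * C)" using that by (simp add: S_def r_def)
    then show ?thesis using C(1) by (simp add: field_simps)
  qed
  \<comment> \<open>Along the ray through \<open>x\<close> a parallel section with value
    \<open>w\<close> at 0 satisfies the linear equation whose right side is minus
    \<open>\<Gamma>\<close> at \<open>t x\<close> in direction \<open>x\<close>; its integrated form
    is the fixed point equation iterated here.\<close>
  define Y where "Y = rec_nat (\<lambda>_. w) (\<lambda>_ y x. w - integral {0..1} (\<lambda>t. \<Gamma> (t *\<^sub>R x) x (y (t *\<^sub>R x))))"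
  have Y0: "Y 0 = (\<lambda>_. w)" by (simp add: Y_def)
  have YS: "Y (Suc k) = (\<lambda>x. w - integral {0..1} (\<lambda>t. \<Gamma> (t *\<^sub>R x) x (Y k (t *\<^sub>R x))))" for k
    by (simp add: Y_def)
  have lin\<alpha>: "linear (\<lambda>v. \<Gamma> x v (Y k x))" for x k by (rule lin(2))
  have sm\<alpha>: "smooth_on S (\<lambda>x. \<Gamma> x v (Y k x))" if "smooth_on S (Y k)" for k v
    by (rule smooth_on_linear_family[OF S(1) sm lin(1) smooth_on_ident[OF S(1)] that])
      (use S\<Omega> in auto)
  have smY: "smooth_on S (Y k)" for k
  proof (induction k)
    case (Suc k)
    have "smooth_on S (\<lambda>x. integral {0..1} (\<lambda>t. \<Gamma> (t *\<^sub>R x) x (Y k (t *\<^sub>R x))))"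
      using smooth_on_radial_integral[OF S(1) star sm\<alpha>[OF Suc] lin\<alpha>] by blast
    from smooth_on_add[OF S(1) smooth_on_const smooth_on_linear_comp[OF S(1) bounded_linear_minus[OF bounded_linear_ident] this]]
    show ?case by (simp add: YS)
  qed (simp add: Y0)
  define Y' where "Y' k x = frechet_derivative (Y k) (at x)" for k x
  have dY: "(Y k has_derivative Y' k x) (at x)" if "x \<in> S" for k x
    unfolding Y'_def by (rule smooth_on_has_derivative[OF smY that])
  define E where "E k x v = Y' k x v + \<Gamma> x v (Y k x)" for k x v
  have d\<alpha>: "frechet_derivative (\<lambda>y. \<Gamma> y u (Y k y)) (at x) v =
      frechet_derivative (\<lambda>y. \<Gamma> y u (Y k x)) (at x) v + \<Gamma> x u (Y' k x v)" if "x \<in> S" for x u v k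
    using has_derivative_linear_family[OF sm lin(1) has_derivative_ident dY[OF that], of u] S\<Omega> that
    by (intro fun_cong[OF frechet_derivative_at[symmetric]]) auto
  \<comment> \<open>Here flatness enters. The left side is the exterior derivative of the one-form
    \<open>\<Gamma> Y\<close> for the iterate; replacing the derivative of the iterate by the defect
    minus \<open>\<Gamma> Y\<close> leaves the curvature, which vanishes, and terms linear in the
    defect.\<close>
  have curv: "frechet_derivative (\<lambda>y. \<Gamma> y u (Y k y)) (at x) v - frechet_derivative (\<lambda>y. \<Gamma> y v (Y k y)) (at x) u
      = \<Gamma> x u (E k x v) - \<Gamma> x v (E k x u)" if "x \<in> S" for x u v k
    using flat[of x u "Y k x" v] S\<Omega> that
    by (auto simp: d\<alpha>[OF that] E_def linear_add[OF lin(1)] algebra_simps)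
  \<comment> \<open>Differentiating the iteration formula by the homotopy formula produces
    \<open>\<Gamma>\<close> applied to the old iterate, whereas the defect contains
    \<open>\<Gamma>\<close> applied to the new one; this is the first difference. The integral is
    the exterior derivative rewritten by \<open>curv\<close>.\<close>
  have E_Suc: "E (Suc k) x v = \<Gamma> x v (Y (Suc k) x) - \<Gamma> x v (Y k x)
      - integral {0..1} (\<lambda>t. t *\<^sub>R (\<Gamma> (t *\<^sub>R x) x (E k (t *\<^sub>R x) v) - \<Gamma> (t *\<^sub>R x) v (E k (t *\<^sub>R x) x)))"
    if x: "x \<in> S" for k x v
  proof -
    have "(Y (Suc k) has_derivative (\<lambda>v. 0 - (\<Gamma> x v (Y k x) + integral {0..1} (\<lambda>t. t *\<^sub>R
        (frechet_derivative (\<lambda>y. \<Gamma> y x (Y k y)) (at (t *\<^sub>R x)) v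
          - frechet_derivative (\<lambda>y. \<Gamma> y v (Y k y)) (at (t *\<^sub>R x)) x))))) (at x)"
      unfolding YS
      by (intro has_derivative_diff has_derivative_const
          has_derivative_radial_integral[OF S(1) star sm\<alpha>[OF smY] lin\<alpha> x])
    from frechet_derivative_at[OF this]
    have "Y' (Suc k) x v = - (\<Gamma> x v (Y k x) + integral {0..1} (\<lambda>t. t *\<^sub>R
        (frechet_derivative (\<lambda>y. \<Gamma> y x (Y k y)) (at (t *\<^sub>R x)) v
          - frechet_derivative (\<lambda>y. \<Gamma> y v (Y k y)) (at (t *\<^sub>R x)) x)))"
      by (simp add: Y'_def fun_eq_iff)
    also have "integral {0..1} (\<lambda>t. t *\<^sub>R (frechet_derivative (\<lambda>y. \<Gamma> y x (Y k y)) (at (t *\<^sub>R x)) v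
          - frechet_derivative (\<lambda>y. \<Gamma> y v (Y k y)) (at (t *\<^sub>R x)) x)) =
       integral {0..1} (\<lambda>t. t *\<^sub>R (\<Gamma> (t *\<^sub>R x) x (E k (t *\<^sub>R x) v) - \<Gamma> (t *\<^sub>R x) v (E k (t *\<^sub>R x) x)))"
      by (intro integral_cong) (simp add: curv star x)
    finally show ?thesis by (simp add: E_def)
  qed
  \<comment> \<open>A non-integrable function has integral 0, and the bound at \<open>t = 0\<close>
    already shows \<open>B\<close> to be nonnegative, so the estimates below need no proof of
    integrability.\<close>
  have int_bound: "norm (integral {0..1} f) \<le> B"
    if le: "\<And>t. t \<in> {0..1} \<Longrightarrow> norm (f t) \<le> B" for f :: "real \<Rightarrow> 'w" and B
  proof (cases "f integrable_on {0..1}")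
    case True
    have "0 \<le> B" using order_trans[OF norm_ge_zero le[of 0]] by simp
    from has_integral_bound_real[OF this finite.emptyI integrable_integral[OF True]] le
    show ?thesis by simp
  next
    case False
    then show ?thesis
      using order_trans[OF norm_ge_zero le[of 0]] by (simp add: not_integrable_integral)
  qed
  have int_diff: "(\<lambda>t. \<Gamma> (t *\<^sub>R x) x (Y k (t *\<^sub>R x))) integrable_on {0..1}" if x: "x \<in> S" for x k
    by (intro integrable_continuous_interval continuous_on_compose2[OF smooth_on_continuous_on[OF sm\<alpha>[OF smY]]])
      (use star[OF x] in \<open>auto intro!: continuous_intros\<close>)
  have step: "norm (Y (Suc k) x - Y k x) \<le> norm w * (1/2) ^ k" if "x \<in> S" for k x
    using that
  proof (induction k arbitrary: x)
    case 0
    have "norm (integral {0..1} (\<lambda>t. \<Gamma> (t *\<^sub>R x) x w)) \<le> norm w"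
    proof (rule int_bound)
      fix t :: real assume t: "t \<in> {0..1}"
      have "norm (\<Gamma> (t *\<^sub>R x) x w) \<le> C * norm x * norm w" by (rule CS[OF star[OF 0 t]])
      also have "\<dots> \<le> 1 * norm w" using C8[OF 0] by (intro mult_right_mono) auto
      finally show "norm (\<Gamma> (t *\<^sub>R x) x w) \<le> norm w" by simp
    qed
    then show ?case by (simp add: YS Y0)
  next
    case (Suc k)
    have "Y (Suc (Suc k)) x - Y (Suc k) x = - integral {0..1} (\<lambda>t. \<Gamma> (t *\<^sub>R x) x (Y (Suc k) (t *\<^sub>R x) - Y k (t *\<^sub>R x)))"
      using integral_diff[OF int_diff[OF Suc.prems, of "Suc k"] int_diff[OF Suc.prems, of k]]
      by (simp add: YS[of "Suc k"] YS[of k, THEN fun_cong, of x] linear_diff[OF lin(1)])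
    moreover have "norm (integral {0..1} (\<lambda>t. \<Gamma> (t *\<^sub>R x) x (Y (Suc k) (t *\<^sub>R x) - Y k (t *\<^sub>R x)))) \<le> norm w * (1/2) ^ Suc k"
    proof (rule int_bound)
      fix t :: real assume t: "t \<in> {0..1}"
      have "norm (\<Gamma> (t *\<^sub>R x) x (Y (Suc k) (t *\<^sub>R x) - Y k (t *\<^sub>R x)))
          \<le> C * norm x * norm (Y (Suc k) (t *\<^sub>R x) - Y k (t *\<^sub>R x))"
        by (rule CS[OF star[OF Suc.prems t]])
      also have "\<dots> \<le> 1/2 * (norm w * (1/2) ^ k)"
        using C8[OF Suc.prems] Suc.IH[OF star[OF Suc.prems t]] C(1) by (intro mult_mono) auto
      finally show "norm (\<Gamma> (t *\<^sub>R x) x (Y (Suc k) (t *\<^sub>R x) - Y k (t *\<^sub>R x))) \<le> norm w * (1/2) ^ Suc k"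
        by simp
    qed
    ultimately show ?case by simp
  qed
  \<comment> \<open>With a constant \<open>k\<close> in place of 4, the recursion bounds the next
    defect by \<open>(1 + k/4) q\<close>, while the claim allows \<open>k q / 2\<close>. The value 4
    is the smallest for which the induction closes.\<close>
  have E_bound: "norm (E k x v) \<le> 4 * C * norm w * (1/2) ^ k * norm v" if "x \<in> S" for k x v
    using that
  proof (induction k arbitrary: x v)
    case 0
    have "E 0 x v = \<Gamma> x v w" by (simp add: E_def Y'_def Y0)
    then have "norm (E 0 x v) \<le> C * norm v * norm w" using CS[OF 0] by simp
    also have "\<dots> \<le> 4 * (C * norm v * norm w)" using C(1) by simp
    finally show ?case by (simp add: mult_ac)
  next
    case (Suc k)
    define q where "q = C * norm w * (1/2) ^ k * norm v"
    have q: "q \<ge> 0" using C(1) by (simp add: q_def)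
    have "norm (\<Gamma> x v (Y (Suc k) x) - \<Gamma> x v (Y k x)) \<le> C * norm v * norm (Y (Suc k) x - Y k x)"
      using CS[OF Suc.prems, of v "Y (Suc k) x - Y k x"] by (simp add: linear_diff[OF lin(1)])
    also have "\<dots> \<le> C * norm v * (norm w * (1/2) ^ k)"
      using step[OF Suc.prems, of k] C(1) by (intro mult_left_mono) auto
    also have "\<dots> = q" by (simp add: q_def mult_ac)
    finally have 1: "norm (\<Gamma> x v (Y (Suc k) x) - \<Gamma> x v (Y k x)) \<le> q" .
    have 2: "norm (integral {0..1} (\<lambda>t. t *\<^sub>R (\<Gamma> (t *\<^sub>R x) x (E k (t *\<^sub>R x) v) - \<Gamma> (t *\<^sub>R x) v (E k (t *\<^sub>R x) x)))) \<le> q"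
    proof (rule int_bound)
      fix t :: real assume t: "t \<in> {0..1}"
      let ?z = "t *\<^sub>R x"
      note z = star[OF Suc.prems t]
      have "norm (\<Gamma> ?z x (E k ?z v)) \<le> (C * norm x) * norm (E k ?z v)" by (rule CS[OF z])
      also have "\<dots> \<le> 1/8 * (4 * C * norm w * (1/2) ^ k * norm v)"
        using C8[OF Suc.prems] Suc.IH[OF z] C(1) by (intro mult_mono) auto
      finally have a: "norm (\<Gamma> ?z x (E k ?z v)) \<le> q / 2" by (simp add: q_def mult_ac)
      have "norm (\<Gamma> ?z v (E k ?z x)) \<le> C * norm v * norm (E k ?z x)" by (rule CS[OF z])
      also have "\<dots> \<le> C * norm v * (4 * C * norm w * (1/2) ^ k * norm x)"
        using Suc.IH[OF z] C(1) by (intro mult_left_mono) auto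
      also have "\<dots> = (C * norm x) * (4 * q)" by (simp add: q_def)
      also have "\<dots> \<le> 1/8 * (4 * q)" using C8[OF Suc.prems] q by (intro mult_right_mono) auto
      finally have b: "norm (\<Gamma> ?z v (E k ?z x)) \<le> q / 2" by simp
      have "norm (\<Gamma> ?z x (E k ?z v) - \<Gamma> ?z v (E k ?z x)) \<le> q"
        using a b norm_triangle_ineq4[of "\<Gamma> ?z x (E k ?z v)" "\<Gamma> ?z v (E k ?z x)"] by linarith
      then have "\<bar>t\<bar> * norm (\<Gamma> ?z x (E k ?z v) - \<Gamma> ?z v (E k ?z x)) \<le> 1 * q"
        using t by (intro mult_mono) auto
      then show "norm (t *\<^sub>R (\<Gamma> ?z x (E k ?z v) - \<Gamma> ?z v (E k ?z x))) \<le> q" by simp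
    qed
    have "norm (E (Suc k) x v) \<le> q + q"
      unfolding E_Suc[OF Suc.prems] by (rule order_trans[OF norm_triangle_ineq4 add_mono[OF 1 2]])
    then show ?case by (simp add: q_def mult_ac)
  qed
  have lim: "\<exists>l. (\<lambda>k. Y k x) \<longlonglongrightarrow> l \<and> (\<forall>k. norm (Y k x - l) \<le> 2 * norm w * (1/2) ^ k)" if x: "x \<in> S" for x
  proof -
    define d where "d k = Y (Suc k) x - Y k x" for k
    have geo: "summable (\<lambda>k. norm w * (1/2) ^ k :: real)" by (intro summable_mult summable_geometric) simp
    have sd: "summable (\<lambda>k. d (k + j))" for j
    proof -
      have "summable d"
        by (rule summable_comparison_test'[OF geo, of 0]) (simp add: d_def step[OF x])
      then show ?thesis by (simp add: summable_iff_shift)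
    qed
    have tele: "(\<Sum>k<n. d (k + j)) = Y (n + j) x - Y j x" for n j
      by (induction n) (auto simp: d_def)
    have L: "(\<lambda>n. Y (n + j) x) \<longlonglongrightarrow> Y j x + (\<Sum>k. d (k + j))" for j
      using tendsto_add[OF tendsto_const summable_LIMSEQ[OF sd[of j]], of "Y j x"] by (simp add: tele)
    define l where "l = Y 0 x + (\<Sum>k. d k)"
    have l: "(\<lambda>n. Y n x) \<longlonglongrightarrow> l" using L[of 0] by (simp add: l_def)
    \<comment> \<open>The distance to the limit is the tail of a telescoping series dominated by a
      geometric one; the factor 2 is the sum of the powers of one half.\<close>
    have "norm (Y j x - l) \<le> 2 * norm w * (1/2) ^ j" for j
    proof -
      have le: "norm (d (k + j)) \<le> norm w * (1/2) ^ j * (1/2) ^ k" for k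
        using step[OF x, of "k + j"] by (simp add: d_def power_add mult_ac)
      have s1: "summable (\<lambda>k. norm w * (1/2) ^ j * (1/2) ^ k)"
        by (intro summable_mult summable_geometric) simp
      have s2: "summable (\<lambda>k. norm (d (k + j)))"
        by (rule summable_comparison_test'[OF s1, of 0]) (simp add: le)
      have "l = Y j x + (\<Sum>k. d (k + j))"
        using LIMSEQ_unique[OF LIMSEQ_ignore_initial_segment[OF l] L] .
      then have "norm (Y j x - l) = norm (\<Sum>k. d (k + j))" by simp
      also have "\<dots> \<le> (\<Sum>k. norm w * (1/2) ^ j * (1/2) ^ k)"
        by (intro order_trans[OF summable_norm] suminf_le le s1 s2)
      also have "\<dots> = norm w * (1/2) ^ j * 2"
        by (subst suminf_mult) (auto simp: suminf_geometric intro: summable_geometric)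
      finally show ?thesis by simp
    qed
    with l show ?thesis by blast
  qed
  then obtain Z where Z: "\<And>x. x \<in> S \<Longrightarrow> (\<lambda>k. Y k x) \<longlonglongrightarrow> Z x"
    "\<And>x k. x \<in> S \<Longrightarrow> norm (Y k x - Z x) \<le> 2 * norm w * (1/2) ^ k"
    by metis
  \<comment> \<open>The derivatives of the iterates are the defects minus \<open>\<Gamma>\<close> on
    the iterates. Since the defects tend to 0 and the iterates to \<open>Z\<close>, both uniformly
    on \<open>S\<close>, the limit may be differentiated and satisfies the parallel equation
    exactly.\<close>
  have "\<exists>g. \<forall>x\<in>S. (\<lambda>n. Y n x) \<longlonglongrightarrow> g x \<and> (g has_derivative (\<lambda>v. - \<Gamma> x v (Z x))) (at x within S)"
  proof (rule has_derivative_sequence[where f = Y and f' = Y', OF S(2) _ _ S(3) Z(1)[OF S(3)]])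
    show "(Y n has_derivative Y' n x) (at x within S)" if "x \<in> S" for n x
      using dY[OF that] by (rule has_derivative_at_withinI)
    fix e :: real assume e: "e > 0"
    \<comment> \<open>The constant 6 is the 4 from the defect bound plus the 2 from the distance
      between iterate and limit.\<close>
    have est: "norm (Y' n x h - - \<Gamma> x h (Z x)) \<le> 6 * C * norm w * (1/2) ^ n * norm h" if x: "x \<in> S" for n x h
    proof -
      have "Y' n x h - - \<Gamma> x h (Z x) = E n x h - \<Gamma> x h (Y n x - Z x)"
        by (simp add: E_def linear_diff[OF lin(1)])
      moreover define p where "p = C * norm w * (1/2) ^ n * norm h"
      have "norm (\<Gamma> x h (Y n x - Z x)) \<le> C * norm h * (2 * norm w * (1/2) ^ n)"
        using order_trans[OF CS[OF x] mult_left_mono[OF Z(2)[OF x]]] C(1) by simp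
      then have "norm (\<Gamma> x h (Y n x - Z x)) \<le> 2 * p" by (simp add: p_def mult_ac)
      moreover have "norm (E n x h) \<le> 4 * p"
        using E_bound[OF x, of n h] by (simp add: p_def mult_ac)
      ultimately have "norm (Y' n x h - - \<Gamma> x h (Z x)) \<le> 6 * p"
        using norm_triangle_ineq4[of "E n x h" "\<Gamma> x h (Y n x - Z x)"] by simp
      then show ?thesis by (simp add: p_def mult_ac)
    qed
    have "(\<lambda>n. 6 * C * norm w * (1/2) ^ n) \<longlonglongrightarrow> 6 * C * norm w * 0"
      by (intro tendsto_intros LIMSEQ_power_zero) simp
    then have "\<forall>\<^sub>F n in sequentially. 6 * C * norm w * (1/2) ^ n < e"
      using e order_tendstoD(2) by fastforce
    then show "\<forall>\<^sub>F n in sequentially. \<forall>x\<in>S. \<forall>h. norm (Y' n x h - - \<Gamma> x h (Z x)) \<le> e * norm h"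
    proof eventually_elim
      case (elim n)
      then show ?case
        using order_trans[OF est mult_right_mono[OF less_imp_le norm_ge_zero]] by blast
    qed
  qed
  then obtain g where g: "\<And>x. x \<in> S \<Longrightarrow> (\<lambda>n. Y n x) \<longlonglongrightarrow> g x"
    "\<And>x. x \<in> S \<Longrightarrow> (g has_derivative (\<lambda>v. - \<Gamma> x v (Z x))) (at x within S)"
    by metis
  have gZ: "g x = Z x" if "x \<in> S" for x
    using LIMSEQ_unique[OF g(1) Z(1)] that by blast
  have dg: "(g has_derivative (\<lambda>v. - \<Gamma> x v (g x))) (at x)" if "x \<in> S" for x
    using g(2)[OF that] by (simp add: gZ[OF that] at_within_open[OF that S(1)])
  have "smooth_on S g"
  proof (rule smooth_on_bootstrap[OF S(1) dg])
    fix k v assume k: "Ck_on k S g"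
    have "Ck_on k S (\<lambda>x. \<Sum>b\<in>Basis. (g x \<bullet> b) *\<^sub>R \<Gamma> x v b)"
      using Ck_on_subset[OF _ S\<Omega>] sm[unfolded smooth_on_def]
      by (intro Ck_on_sum S Ck_on_bounded_bilinear[OF S(1) bounded_bilinear_scaleR]
          Ck_on_linear_comp[OF S(1) bounded_linear_inner_left] k) blast+
    then show "Ck_on k S (\<lambda>x. - \<Gamma> x v (g x))"
      using Ck_on_linear_comp[OF S(1) bounded_linear_minus[OF bounded_linear_ident]]
      by (simp add: linear_eq_sum_Basis[OF lin(1), symmetric])
  qed
  moreover have "g 0 = w"
  proof -
    \<comment> \<open>At the centre the direction argument of \<open>\<Gamma>\<close> is 0, so the
      integral vanishes and every iterate keeps the prescribed value.\<close>
    have "Y k 0 = w" for k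
      by (cases k) (simp_all add: Y0 YS linear_0[OF lin(2)])
    then show ?thesis using LIMSEQ_unique[OF g(1)[OF S(3)]] by simp
  qed
  ultimately show thesis
    using that[of r g] r S\<Omega> dg unfolding S_def by blast
qed

text \<open>Rays were taken from the origin; translating by \<open>a\<close> moves the centre to an
  arbitrary point, and derivatives are unaffected by the shift.\<close>

lemma flat_section_exists:
  fixes \<Gamma> :: "'v::euclidean_space \<Rightarrow> 'v \<Rightarrow> 'w::euclidean_space \<Rightarrow> 'w"
  assumes \<Omega>: "open \<Omega>" "a \<in> \<Omega>"
    and sm: "\<And>u w. smooth_on \<Omega> (\<lambda>x. \<Gamma> x u w)"
    and lin: "\<And>x u. linear (\<Gamma> x u)" "\<And>x w. linear (\<lambda>u. \<Gamma> x u w)"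
    and flat: "\<And>x u v w. x \<in> \<Omega> \<Longrightarrow>
      frechet_derivative (\<lambda>y. \<Gamma> y v w) (at x) u + \<Gamma> x u (\<Gamma> x v w) =
      frechet_derivative (\<lambda>y. \<Gamma> y u w) (at x) v + \<Gamma> x v (\<Gamma> x u w)"
  obtains S Y where "open S" "a \<in> S" "S \<subseteq> \<Omega>" "smooth_on S Y" "Y a = w"
    "\<And>x. x \<in> S \<Longrightarrow> (Y has_derivative (\<lambda>v. - \<Gamma> x v (Y x))) (at x)"
proof -
  define \<Omega>0 where "\<Omega>0 = (\<lambda>x. a + x) -` \<Omega>"
  have o: "open \<Omega>0" unfolding \<Omega>0_def by (intro open_vimage \<Omega> continuous_intros)
  have tr: "smooth_on T (\<lambda>x. b + x)" if "open T" for T and b :: 'v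
    by (intro smooth_on_add smooth_on_const smooth_on_ident that)
  have dtr: "((\<lambda>x. b + x) has_derivative (\<lambda>x. x)) (at x)" for b x :: 'v
    by (auto intro!: derivative_eq_intros)
  have d: "frechet_derivative (\<lambda>y. \<Gamma> (a + y) u w) (at x) = frechet_derivative (\<lambda>y. \<Gamma> y u w) (at (a + x))"
    if "a + x \<in> \<Omega>" for x u w
    using has_derivative_compose[OF dtr smooth_on_has_derivative[OF sm that]]
    by (rule frechet_derivative_at[symmetric])
  obtain r Y where Y: "r > 0" "ball 0 r \<subseteq> \<Omega>0" "smooth_on (ball 0 r) Y" "Y 0 = w"
    "\<And>x. x \<in> ball 0 r \<Longrightarrow> (Y has_derivative (\<lambda>v. - \<Gamma> (a + x) v (Y x))) (at x)"
  proof (rule flat_section_exists_at_0[OF o, where \<Gamma> = "\<lambda>x. \<Gamma> (a + x)" and w = w])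
    show "0 \<in> \<Omega>0" using \<Omega> by (simp add: \<Omega>0_def)
    show "smooth_on \<Omega>0 (\<lambda>x. \<Gamma> (a + x) u w)" for u w
      by (rule smooth_on_compose[OF o sm tr[OF o]]) (auto simp: \<Omega>0_def)
  qed (use lin flat d in \<open>auto simp: \<Omega>0_def\<close>)
  show thesis
  proof (rule that[of "ball a r" "\<lambda>x. Y (- a + x)"])
    have sh: "- a + x \<in> ball 0 r" if "x \<in> ball a r" for x
      using that by (simp add: dist_norm norm_minus_commute)
    show "smooth_on (ball a r) (\<lambda>x. Y (- a + x))"
      by (rule smooth_on_compose[OF open_ball Y(3) tr]) (use sh in auto)
    show "((\<lambda>x. Y (- a + x)) has_derivative (\<lambda>v. - \<Gamma> x v (Y (- a + x)))) (at x)" if "x \<in> ball a r" for x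
      using has_derivative_compose[OF dtr Y(5)[OF sh[OF that]]] by simp
    show "ball a r \<subseteq> \<Omega>"
    proof
      fix x assume "x \<in> ball a r"
      from sh[OF this] Y(2) have "- a + x \<in> \<Omega>0" by blast
      then show "x \<in> \<Omega>" by (simp add: \<Omega>0_def)
    qed
  qed (use Y in auto)
qed

section \<open>Tangent vectors and fields in charts\<close>

lemma sum_fun_apply: "(\<Sum>i\<in>I. f i) x = (\<Sum>i\<in>I. f i x)"
  by (induction I rule: infinite_finite_induct) auto

lemma bounded_linear_vector_smult: "bounded_linear (\<lambda>v::complex^'n. z *s v)"
proof (rule bounded_linear_intro[where K = "norm z"])
  show "norm (z *s v) \<le> norm v * norm z" for v :: "complex^'n"
  proof -
    have "norm (z *s v) = L2_set (\<lambda>i. norm z * norm (v $ i)) UNIV"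
      by (simp add: norm_vec_def norm_mult)
    also have "\<dots> = norm z * norm v"
      by (simp add: L2_set_right_distrib norm_vec_def)
    finally show ?thesis by simp
  qed
qed (auto simp: vec_eq_iff algebra_simps)

context complex_manifold
begin

section \<open>Charts as homeomorphisms onto open sets\<close>

lemma topspace_chart: "c \<in> A \<Longrightarrow> topspace (subtopology X (cdom c)) = cdom c"
  using chart_open[of c] openin_subset[of X "cdom c"] by (simp add: Int_absorb1)

lemma chart_inj: "c \<in> A \<Longrightarrow> inj_on (cmap c) (cdom c)"
  using chart_homeo[of c] topspace_chart[of c] by (simp add: homeomorphic_map_def)

lemma cinv_cmap: "c \<in> A \<Longrightarrow> p \<in> cdom c \<Longrightarrow> cinv c (cmap c p) = p"
  by (rule inv_into_f_f[OF chart_inj])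

lemma cmap_cinv: "x \<in> cmap c ` cdom c \<Longrightarrow> cmap c (cinv c x) = x"
  by (rule f_inv_into_f)

lemma cinv_in: "x \<in> cmap c ` cdom c \<Longrightarrow> cinv c x \<in> cdom c"
  by (rule inv_into_into)

lemma cdom_subset: "c \<in> A \<Longrightarrow> cdom c \<subseteq> topspace X"
  using chart_open openin_subset by blast

lemma open_chart_range: "c \<in> A \<Longrightarrow> open (cmap c ` cdom c)"
  using chart_open by blast

lemma open_chart_image:
  assumes "c \<in> A" "openin X U"
  shows "open (cmap c ` (U \<inter> cdom c))"
proof -
  have "openin (subtopology X (cdom c)) (U \<inter> cdom c)"
    using assms by (auto simp: openin_subtopology)
  then have "openin (top_of_set (cmap c ` cdom c)) (cmap c ` (U \<inter> cdom c))"
    using homeomorphic_imp_open_map[OF chart_homeo[OF assms(1)]] unfolding open_map_def by blast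
  then show ?thesis by (rule openin_open_trans[OF _ open_chart_range[OF assms(1)]])
qed

lemma cinv_image:
  assumes "c \<in> A" "S \<subseteq> cmap c ` cdom c"
  shows "cinv c ` S = {p \<in> cdom c. cmap c p \<in> S}"
proof (intro equalityI subsetI)
  fix p assume "p \<in> cinv c ` S"
  then obtain x where x: "x \<in> S" "p = cinv c x" by blast
  then have "x \<in> cmap c ` cdom c" using assms(2) by blast
  then show "p \<in> {p \<in> cdom c. cmap c p \<in> S}"
    using x by (simp add: cinv_in cmap_cinv)
next
  fix p assume p: "p \<in> {p \<in> cdom c. cmap c p \<in> S}"
  then have "p = cinv c (cmap c p)" using cinv_cmap[OF assms(1)] by simp
  then show "p \<in> cinv c ` S" using p by blast
qed

lemma cinv_image_subset: "S \<subseteq> cmap c ` cdom c \<Longrightarrow> cinv c ` S \<subseteq> cdom c"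
  using cinv_in[of _ c] by blast

lemma cinv_chart_range: "c \<in> A \<Longrightarrow> cinv c ` (cmap c ` cdom c) = cdom c"
  by (auto simp only: cinv_image)

lemma continuous_map_cmap: "c \<in> A \<Longrightarrow> continuous_map (subtopology X (cdom c)) euclidean (cmap c)"
  using homeomorphic_imp_continuous_map[OF chart_homeo] by (simp add: continuous_map_in_subtopology)

lemma open_cinv_image:
  assumes "c \<in> A" "open S" "S \<subseteq> cmap c ` cdom c"
  shows "openin X (cinv c ` S)"
proof -
  have "openin (subtopology X (cdom c)) {p \<in> topspace (subtopology X (cdom c)). cmap c p \<in> S}"
    using openin_continuous_map_preimage[OF continuous_map_cmap[OF assms(1)], of S] assms(2) by simp
  then have "openin X {p \<in> topspace (subtopology X (cdom c)). cmap c p \<in> S}"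
    by (rule openin_trans_full) (use chart_open[OF assms(1)] in blast)
  then show ?thesis
    unfolding cinv_image[OF assms(1,3)] topspace_chart[OF assms(1)] .
qed

section \<open>Coordinate changes and tangent spaces\<close>

definition dtrans :: "('a, 'n) chart \<Rightarrow> ('a, 'n) chart \<Rightarrow> 'a \<Rightarrow> complex^'n \<Rightarrow> complex^'n"
  where "dtrans c d p = frechet_derivative (cmap d \<circ> cinv c) (at (cmap c p))"

lemma open_overlap: "c \<in> A \<Longrightarrow> d \<in> A \<Longrightarrow> open (cmap c ` (cdom c \<inter> cdom d))"
  using open_chart_image[of c "cdom d"] chart_open[of d] by (simp add: Int_commute)

lemma smooth_on_trans:
  "c \<in> A \<Longrightarrow> d \<in> A \<Longrightarrow> smooth_on (cmap c ` (cdom c \<inter> cdom d)) (cmap d \<circ> cinv c)"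
  using charts_compatible unfolding holomorphic_map_on_def by blast

lemma has_derivative_trans:
  assumes "c \<in> A" "d \<in> A" "p \<in> cdom c" "p \<in> cdom d"
  shows "((cmap d \<circ> cinv c) has_derivative dtrans c d p) (at (cmap c p))"
  unfolding dtrans_def
  by (rule smooth_on_has_derivative[OF smooth_on_trans[OF assms(1,2)]]) (use assms in auto)

lemma linear_dtrans:
  "c \<in> A \<Longrightarrow> d \<in> A \<Longrightarrow> p \<in> cdom c \<Longrightarrow> p \<in> cdom d \<Longrightarrow> linear (dtrans c d p)"
  using has_derivative_trans has_derivative_linear by blast

text \<open>Holomorphic compatibility of the charts, read on differentials. This is what makes
  \<open>J\<close>, defined as multiplication by \<open>\<i>\<close> in every chart, preserve
  tangent spaces.\<close>

lemma dtrans_holomorphic: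
  assumes "c \<in> A" "d \<in> A" "p \<in> cdom c" "p \<in> cdom d"
  shows "dtrans c d p (\<i> *s v) = \<i> *s dtrans c d p v"
  using charts_compatible[OF assms(1,2)] assms unfolding holomorphic_map_on_def dtrans_def by blast

text \<open>The cocycle rule: on the open overlap of \<open>c\<close> and \<open>d\<close> the
  coordinate changes compose, and the chain rule passes this to differentials.\<close>

lemma dtrans_comp:
  assumes "c \<in> A" "d \<in> A" "e \<in> A" "p \<in> cdom c" "p \<in> cdom d" "p \<in> cdom e"
  shows "dtrans d e p (dtrans c d p v) = dtrans c e p v"
proof -
  have p: "(cmap d \<circ> cinv c) (cmap c p) = cmap d p" using cinv_cmap assms by simp
  have "((\<lambda>x. (cmap e \<circ> cinv d) ((cmap d \<circ> cinv c) x)) has_derivative (\<lambda>v. dtrans d e p (dtrans c d p v))) (at (cmap c p))"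
    by (rule has_derivative_compose[OF has_derivative_trans[of c d p]])
      (use has_derivative_trans[of d e p] assms p in \<open>simp_all only:\<close>)
  then have "((cmap e \<circ> cinv c) has_derivative (\<lambda>v. dtrans d e p (dtrans c d p v))) (at (cmap c p))"
    by (rule has_derivative_transform_within_open[OF _ open_overlap[OF assms(1,2)]])
      (use assms cinv_cmap in auto)
  from has_derivative_unique[OF this has_derivative_trans] assms show ?thesis by metis
qed

lemma dtrans_self:
  assumes "c \<in> A" "p \<in> cdom c"
  shows "dtrans c c p v = v"
proof -
  have "((cmap c \<circ> cinv c) has_derivative (\<lambda>x. x)) (at (cmap c p))"
    by (rule has_derivative_transform_within_open[OF has_derivative_ident open_chart_range[OF assms(1)]])
      (use assms cmap_cinv[of _ c] in \<open>auto simp del: split_paired_All simp: cinv_cmap\<close>)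
  from has_derivative_unique[OF this has_derivative_trans] assms show ?thesis by metis
qed

lemma tangent_spaceD:
  assumes "v \<in> tangent_space p" "c \<in> A" "d \<in> A" "p \<in> cdom c" "p \<in> cdom d"
  shows "v d = dtrans c d p (v c)"
  using assms unfolding tangent_space_def dtrans_def by blast

lemma tangent_space_outside: "v \<in> tangent_space p \<Longrightarrow> \<not> (c \<in> A \<and> p \<in> cdom c) \<Longrightarrow> v c = 0"
  unfolding tangent_space_def by blast

lemma tangent_spaceI:
  assumes "\<And>c d. c \<in> A \<Longrightarrow> d \<in> A \<Longrightarrow> p \<in> cdom c \<Longrightarrow> p \<in> cdom d \<Longrightarrow> v d = dtrans c d p (v c)"
    and "\<And>c. \<not> (c \<in> A \<and> p \<in> cdom c) \<Longrightarrow> v c = 0"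
  shows "v \<in> tangent_space p"
  using assms unfolding tangent_space_def dtrans_def by blast

text \<open>One component determines all others through the coordinate changes, and the components
  outside the charts around \<open>p\<close> are 0 by definition. Hence every identity between
  tangent vectors can be checked in a single chart.\<close>

lemma tangent_eqI:
  assumes "v \<in> tangent_space p" "w \<in> tangent_space p" "c \<in> A" "p \<in> cdom c" "v c = w c"
  shows "v = w"
proof
  fix d
  show "v d = w d"
    using tangent_spaceD[OF assms(1,3) _ assms(4)] tangent_spaceD[OF assms(2,3) _ assms(4)]
      tangent_space_outside[OF assms(1)] tangent_space_outside[OF assms(2)] assms(5)
    by (cases "d \<in> A \<and> p \<in> cdom d") auto
qed

lemma tangent_zero: "0 \<in> tangent_space p"
  by (rule tangent_spaceI) (auto simp: linear_0[OF linear_dtrans])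

lemma tangent_add:
  assumes "v \<in> tangent_space p" "w \<in> tangent_space p"
  shows "v + w \<in> tangent_space p"
proof (rule tangent_spaceI)
  show "(v + w) d = dtrans c d p ((v + w) c)"
    if "c \<in> A" "d \<in> A" "p \<in> cdom c" "p \<in> cdom d" for c d
    using tangent_spaceD[OF assms(1) that] tangent_spaceD[OF assms(2) that]
    by (simp add: linear_add[OF linear_dtrans[OF that]])
qed (simp add: tangent_space_outside[OF assms(1)] tangent_space_outside[OF assms(2)])

lemma tangent_scaleR:
  assumes "v \<in> tangent_space p"
  shows "r *\<^sub>R v \<in> tangent_space p"
proof (rule tangent_spaceI)
  show "(r *\<^sub>R v) d = dtrans c d p ((r *\<^sub>R v) c)"
    if "c \<in> A" "d \<in> A" "p \<in> cdom c" "p \<in> cdom d" for c d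
    using tangent_spaceD[OF assms that]
    by (simp add: scaleR_fun_def linear_scale[OF linear_dtrans[OF that]])
qed (simp add: scaleR_fun_def tangent_space_outside[OF assms])

lemma tangent_diff: "v \<in> tangent_space p \<Longrightarrow> w \<in> tangent_space p \<Longrightarrow> v - w \<in> tangent_space p"
  using tangent_add[OF _ tangent_scaleR[of w p "-1"], of v] by simp

lemma tangent_sum: "(\<And>i. i \<in> I \<Longrightarrow> v i \<in> tangent_space p) \<Longrightarrow> (\<Sum>i\<in>I. v i) \<in> tangent_space p"
  by (induction I rule: infinite_finite_induct) (simp_all add: tangent_zero tangent_add)

lemma tangent_J:
  assumes "v \<in> tangent_space p"
  shows "J v \<in> tangent_space p"
proof (rule tangent_spaceI)
  show "J v d = dtrans c d p (J v c)"
    if "c \<in> A" "d \<in> A" "p \<in> cdom c" "p \<in> cdom d" for c d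
    using tangent_spaceD[OF assms that] by (simp add: J_def dtrans_holomorphic[OF that])
qed (simp add: J_def tangent_space_outside[OF assms])

text \<open>Passes from a vector-valued function in the coordinates of \<open>c\<close> to a field.
  The default 0 is forced by \<open>tangent_space\<close>, where components in charts not containing
  the point vanish.\<close>

definition lift :: "('a, 'n) chart \<Rightarrow> (complex^'n \<Rightarrow> complex^'n) \<Rightarrow> ('a, 'n) vfield"
  where "lift c g p = (\<lambda>d. if d \<in> A \<and> p \<in> cdom d then dtrans c d p (g (cmap c p)) else 0)"

lemma lift_tangent: "c \<in> A \<Longrightarrow> p \<in> cdom c \<Longrightarrow> lift c g p \<in> tangent_space p"
  by (rule tangent_spaceI) (auto simp: lift_def dtrans_comp)

lemma lift_self: "c \<in> A \<Longrightarrow> p \<in> cdom c \<Longrightarrow> lift c g p c = g (cmap c p)"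
  by (simp add: lift_def dtrans_self)

lemma open_chart_image_cinv:
  assumes "c \<in> A" "d \<in> A" "open S" "S \<subseteq> cmap c ` cdom c"
  shows "open (cmap d ` (cinv c ` S \<inter> cdom d))"
  using open_chart_image[OF assms(2) open_cinv_image[OF assms(1,3,4)]] .

text \<open>Composition with the coordinate change. Smoothness of \<open>g\<close> is required only
  over the overlap with \<open>d\<close>, because the functions to which this is applied may involve
  the coordinate change to \<open>d\<close> and be meaningless elsewhere.\<close>

lemma smooth_on_other_chart:
  assumes "c \<in> A" "d \<in> A" "open S" "S \<subseteq> cmap c ` cdom c" "smooth_on (S \<inter> cmap c ` (cdom c \<inter> cdom d)) g"
  shows "smooth_on (cmap d ` (cinv c ` S \<inter> cdom d)) (\<lambda>x. g (cmap c (cinv d x)))"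
proof (rule smooth_on_compose[OF open_chart_image_cinv[OF assms(1-4)] assms(5)])
  have S: "cinv c ` S \<subseteq> cdom c" using cinv_image_subset[OF assms(4)] .
  show "smooth_on (cmap d ` (cinv c ` S \<inter> cdom d)) (\<lambda>x. cmap c (cinv d x))"
    by (rule smooth_on_subset[OF smooth_on_trans[OF assms(2,1), unfolded o_def]]) (use S in blast)
  show "(\<lambda>x. cmap c (cinv d x)) ` (cmap d ` (cinv c ` S \<inter> cdom d)) \<subseteq> S \<inter> cmap c ` (cdom c \<inter> cdom d)"
  proof clarify
    fix x assume x: "x \<in> S" "cinv c x \<in> cdom d"
    then have "x \<in> cmap c ` cdom c" using assms by blast
    then have "cmap c (cinv c x) = x" "cinv c x \<in> cdom c"
      using cmap_cinv[of x c] cinv_in[of x c] by blast+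
    moreover have "cmap c (cinv c x) \<in> cmap c ` (cdom c \<inter> cdom d)"
      using calculation(2) x(2) by (intro imageI IntI)
    ultimately show "cmap c (cinv d (cmap d (cinv c x))) \<in> S \<inter> cmap c ` (cdom c \<inter> cdom d)"
      using cinv_cmap[OF assms(2) x(2)] x(1) by simp
  qed
qed

lemma smooth_field_lift:
  assumes c: "c \<in> A" and S: "open S" "S \<subseteq> cmap c ` cdom c" and g: "smooth_on S g"
  shows "smooth_field (cinv c ` S) (lift c g)"
  unfolding smooth_field_def
proof (intro conjI ballI)
  have cS: "cinv c ` S \<subseteq> cdom c" using cinv_image_subset[OF S(2)] .
  show "lift c g p \<in> tangent_space p" if "p \<in> cinv c ` S" for p
    using lift_tangent c cS that by blast
  fix d assume d: "d \<in> A"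
  let ?T = "S \<inter> cmap c ` (cdom c \<inter> cdom d)"
  have T: "open ?T" using S(1) open_overlap[OF c d] by blast
  \<comment> \<open>In the coordinates of \<open>c\<close>, the \<open>d\<close>-component of the
    lifted field is the derivative of the coordinate change applied to \<open>g\<close>; the result
    is then rewritten in the coordinates of \<open>d\<close>.\<close>
  have "smooth_on ?T (\<lambda>y. frechet_derivative (cmap d \<circ> cinv c) (at y) (g y))"
    by (rule smooth_on_derivative_along[OF T smooth_on_subset[OF smooth_on_trans[OF c d]] smooth_on_subset[OF g]]) auto
  from smooth_on_other_chart[OF c d S this]
  show "smooth_on (cmap d ` (cinv c ` S \<inter> cdom d)) (\<lambda>x. lift c g (cinv d x) d)"
  proof (rule smooth_on_cong[OF open_chart_image_cinv[OF c d S], rotated])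
    fix x assume "x \<in> cmap d ` (cinv c ` S \<inter> cdom d)"
    then have "cinv d x \<in> cdom d" using cinv_cmap[OF d] by auto
    then show "frechet_derivative (cmap d \<circ> cinv c) (at (cmap c (cinv d x))) (g (cmap c (cinv d x))) = lift c g (cinv d x) d"
      by (simp add: lift_def dtrans_def d)
  qed
qed

section \<open>Smooth fields and functions\<close>

lemma smooth_field_tangent: "smooth_field U Y \<Longrightarrow> p \<in> U \<Longrightarrow> Y p \<in> tangent_space p"
  unfolding smooth_field_def by blast

lemma smooth_field_chart:
  "smooth_field U Y \<Longrightarrow> c \<in> A \<Longrightarrow> smooth_on (cmap c ` (U \<inter> cdom c)) (\<lambda>x. Y (cinv c x) c)"
  unfolding smooth_field_def by blast

lemma smooth_field_subset: "smooth_field U Y \<Longrightarrow> V \<subseteq> U \<Longrightarrow> smooth_field V Y"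
  unfolding smooth_field_def
  by (auto intro: smooth_on_subset[OF _ image_mono[OF Int_mono[OF _ order_refl]]])

lemma chart_image_open_cong:
  assumes "openin X U" "c \<in> A" "\<And>p. p \<in> U \<Longrightarrow> f p = g p" "smooth_on (cmap c ` (U \<inter> cdom c)) (\<lambda>x. f (cinv c x))"
  shows "smooth_on (cmap c ` (U \<inter> cdom c)) (\<lambda>x. g (cinv c x))"
  by (rule smooth_on_cong[OF open_chart_image[OF assms(2,1)] _ assms(4)])
    (use assms(3) cinv_cmap[OF assms(2)] in auto)

lemma smooth_field_cong:
  assumes "openin X U" "\<And>p. p \<in> U \<Longrightarrow> Y p = Z p" "smooth_field U Y"
  shows "smooth_field U Z"
  unfolding smooth_field_def
proof (intro conjI ballI)
  show "Z p \<in> tangent_space p" if "p \<in> U" for p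
    using smooth_field_tangent[OF assms(3) that] assms(2)[OF that] by simp
  show "smooth_on (cmap c ` (U \<inter> cdom c)) (\<lambda>x. Z (cinv c x) c)" if "c \<in> A" for c
    by (rule chart_image_open_cong[where f = "\<lambda>p. Y p c", OF assms(1) that])
      (use assms(2) smooth_field_chart[OF assms(3) that] in auto)
qed

lemma smooth_fun_cong:
  assumes "openin X U" "\<And>p. p \<in> U \<Longrightarrow> f p = g p" "smooth_fun U f"
  shows "smooth_fun U g"
  unfolding smooth_fun_def o_def
proof
  show "smooth_on (cmap c ` (U \<inter> cdom c)) (\<lambda>x. g (cinv c x))" if "c \<in> A" for c
    by (rule chart_image_open_cong[where f = f, OF assms(1) that assms(2)])
      (use assms(3) that in \<open>auto simp: smooth_fun_def o_def\<close>)
qed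

lemma smooth_field_scaleR:
  assumes "openin X U" "smooth_fun U f" "smooth_field U Y"
  shows "smooth_field U (\<lambda>p. f p *\<^sub>R Y p)"
  using assms(2,3) unfolding smooth_field_def smooth_fun_def o_def scaleR_fun_def
  by (auto intro!: smooth_on_scaleR open_chart_image[OF _ assms(1)] tangent_scaleR[unfolded scaleR_fun_def])

lemma smooth_field_zero: "smooth_field U (\<lambda>p. 0)"
  unfolding smooth_field_def by (auto simp: tangent_zero)

lemma smooth_field_add:
  assumes "openin X U" "smooth_field U Y" "smooth_field U Z"
  shows "smooth_field U (\<lambda>p. Y p + Z p)"
  using assms(2,3) unfolding smooth_field_def
  by (auto intro!: smooth_on_add open_chart_image[OF _ assms(1)] tangent_add)

lemma smooth_field_sum:
  assumes "openin X U"
  shows "(\<And>i. i \<in> I \<Longrightarrow> smooth_field U (Y i)) \<Longrightarrow> smooth_field U (\<lambda>p. \<Sum>i\<in>I. Y i p)"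
  by (induction I rule: infinite_finite_induct) (simp_all add: smooth_field_zero smooth_field_add[OF assms])

lemma smooth_field_J:
  assumes "openin X U" "smooth_field U Y"
  shows "smooth_field U (\<lambda>p. J (Y p))"
  unfolding smooth_field_def
proof (intro conjI ballI)
  show "J (Y p) \<in> tangent_space p" if "p \<in> U" for p
    using tangent_J smooth_field_tangent[OF assms(2) that] by blast
  show "smooth_on (cmap c ` (U \<inter> cdom c)) (\<lambda>x. J (Y (cinv c x)) c)" if "c \<in> A" for c
    unfolding J_def
    by (rule smooth_on_linear_comp[OF open_chart_image[OF that assms(1)] bounded_linear_vector_smult
          smooth_field_chart[OF assms(2) that]])
qed

lemma smooth_fun_chart:
  assumes c: "c \<in> A" and S: "open S" "S \<subseteq> cmap c ` cdom c" and g: "smooth_on S g"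
  shows "smooth_fun (cinv c ` S) (\<lambda>p. g (cmap c p))"
  unfolding smooth_fun_def o_def
proof
  show "smooth_on (cmap d ` (cinv c ` S \<inter> cdom d)) (\<lambda>x. g (cmap c (cinv d x)))" if "d \<in> A" for d
    by (rule smooth_on_other_chart[OF c that S smooth_on_subset[OF g]]) auto
qed

lemma smooth_fun_component:
  assumes c: "c \<in> A" and U: "openin X U" "U \<subseteq> cdom c" and Y: "smooth_field U Y"
  shows "smooth_fun U (\<lambda>p. Y p c \<bullet> b)"
proof -
  have Uc: "U \<inter> cdom c = U" using U by blast
  have o: "open (cmap c ` U)" using open_chart_image[OF c U(1)] Uc by simp
  have im: "cinv c ` cmap c ` U = U"
    using cinv_image[OF c, of "cmap c ` U"] U chart_inj[OF c] by (auto simp: inj_on_def)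
  have "smooth_on (cmap c ` U) (\<lambda>x. Y (cinv c x) c \<bullet> b)"
    using smooth_on_inner_const[OF o smooth_field_chart[OF Y c, unfolded Uc]] .
  from smooth_fun_chart[OF c o _ this] have "smooth_fun U (\<lambda>p. Y (cinv c (cmap c p)) c \<bullet> b)"
    using U im by auto
  then show ?thesis
    by (rule smooth_fun_cong[OF U(1), rotated]) (use U cinv_cmap[OF c] in auto)
qed

lemma chart_exists:
  assumes "p \<in> topspace X"
  obtains c where "c \<in> A" "p \<in> cdom c"
proof -
  have "p \<in> (\<Union>c\<in>A. cdom c)" unfolding charts_cover by (rule assms)
  then show thesis using that by (elim UN_E)
qed

lemma chart_at: "p \<in> topspace X \<Longrightarrow> chart_at p \<in> A \<and> p \<in> cdom (chart_at p)"
  unfolding chart_at_def by (rule someI_ex, erule chart_exists) (intro exI conjI)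

text \<open>\<open>deriv_along\<close> is defined through the arbitrarily chosen
  \<open>chart_at p\<close>. The chain rule, together with the transformation of the tangent vector,
  frees it from that choice.\<close>

lemma deriv_along_chart:
  assumes c: "c \<in> A" "p \<in> cdom c" and Y: "Y p \<in> tangent_space p"
    and f: "(f \<circ> cinv c) differentiable (at (cmap c p))"
  shows "deriv_along Y f p = frechet_derivative (f \<circ> cinv c) (at (cmap c p)) (Y p c)"
proof -
  let ?e = "chart_at p"
  have e: "?e \<in> A" "p \<in> cdom ?e" using chart_at cdom_subset c by blast+
  have p: "(cmap c \<circ> cinv ?e) (cmap ?e p) = cmap c p" using cinv_cmap e by simp
  have "((\<lambda>x. (f \<circ> cinv c) ((cmap c \<circ> cinv ?e) x)) has_derivative
      (\<lambda>v. frechet_derivative (f \<circ> cinv c) (at (cmap c p)) (dtrans ?e c p v))) (at (cmap ?e p))"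
    by (rule has_derivative_compose[OF has_derivative_trans[OF e(1) c(1) e(2) c(2)]])
      (unfold p, rule f[unfolded frechet_derivative_works])
  then have "((f \<circ> cinv ?e) has_derivative
      (\<lambda>v. frechet_derivative (f \<circ> cinv c) (at (cmap c p)) (dtrans ?e c p v))) (at (cmap ?e p))"
    by (rule has_derivative_transform_within_open[OF _ open_overlap[OF e(1) c(1)]])
      (use cinv_cmap e c in auto)
  from frechet_derivative_at[OF this] show ?thesis
    unfolding deriv_along_def tangent_spaceD[OF Y e(1) c(1) e(2) c(2)] by metis
qed

end

section \<open>The connection in a chart\<close>

context flat_complex_manifold
begin

section \<open>The connection axioms and finite sums\<close>

lemma
  assumes U: "openin X U"
  shows nabla_smooth: "smooth_field U Y \<Longrightarrow> smooth_field U Z \<Longrightarrow> smooth_field U (nabla Y Z)"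
    and nabla_cong: "smooth_field U Y \<Longrightarrow> smooth_field U Z \<Longrightarrow> (\<And>q. q \<in> U \<Longrightarrow> Y' q = Y q) \<Longrightarrow>
      (\<And>q. q \<in> U \<Longrightarrow> Z' q = Z q) \<Longrightarrow> p \<in> U \<Longrightarrow> nabla Y' Z' p = nabla Y Z p"
    and nabla_add_left: "smooth_field U Y \<Longrightarrow> smooth_field U Y' \<Longrightarrow> smooth_field U Z \<Longrightarrow> p \<in> U \<Longrightarrow>
      nabla (\<lambda>q. Y q + Y' q) Z p = nabla Y Z p + nabla Y' Z p"
    and nabla_scaleR_left: "smooth_fun U f \<Longrightarrow> smooth_field U Y \<Longrightarrow> smooth_field U Z \<Longrightarrow> p \<in> U \<Longrightarrow>
      nabla (\<lambda>q. f q *\<^sub>R Y q) Z p = f p *\<^sub>R nabla Y Z p"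
    and nabla_add_right: "smooth_field U Y \<Longrightarrow> smooth_field U Z \<Longrightarrow> smooth_field U Z' \<Longrightarrow> p \<in> U \<Longrightarrow>
      nabla Y (\<lambda>q. Z q + Z' q) p = nabla Y Z p + nabla Y Z' p"
    and nabla_scaleR_right: "smooth_fun U f \<Longrightarrow> smooth_field U Y \<Longrightarrow> smooth_field U Z \<Longrightarrow> p \<in> U \<Longrightarrow>
      nabla Y (\<lambda>q. f q *\<^sub>R Z q) p = deriv_along Y f p *\<^sub>R Z p + f p *\<^sub>R nabla Y Z p"
proof -
  have plus: "(\<lambda>q. F q + G q) = F + G" for F G :: "('a, 'n) vfield"
    by (simp add: fun_eq_iff)
  note C = nabla_connection[unfolded connection_def, THEN spec, THEN mp, OF U]
  show "smooth_field U Y \<Longrightarrow> smooth_field U Z \<Longrightarrow> smooth_field U (nabla Y Z)"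
    using C[THEN conjunct1] by blast
  show "smooth_field U Y \<Longrightarrow> smooth_field U Z \<Longrightarrow> (\<And>q. q \<in> U \<Longrightarrow> Y' q = Y q) \<Longrightarrow>
      (\<And>q. q \<in> U \<Longrightarrow> Z' q = Z q) \<Longrightarrow> p \<in> U \<Longrightarrow> nabla Y' Z' p = nabla Y Z p"
    using C[THEN conjunct2, THEN conjunct1] by blast
  show "smooth_field U Y \<Longrightarrow> smooth_field U Y' \<Longrightarrow> smooth_field U Z \<Longrightarrow> p \<in> U \<Longrightarrow>
      nabla (\<lambda>q. Y q + Y' q) Z p = nabla Y Z p + nabla Y' Z p"
    unfolding plus using C[THEN conjunct2, THEN conjunct2, THEN conjunct1] by blast
  show "smooth_fun U f \<Longrightarrow> smooth_field U Y \<Longrightarrow> smooth_field U Z \<Longrightarrow> p \<in> U \<Longrightarrow>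
      nabla (\<lambda>q. f q *\<^sub>R Y q) Z p = f p *\<^sub>R nabla Y Z p"
    using C[THEN conjunct2, THEN conjunct2, THEN conjunct2, THEN conjunct1] by blast
  show "smooth_field U Y \<Longrightarrow> smooth_field U Z \<Longrightarrow> smooth_field U Z' \<Longrightarrow> p \<in> U \<Longrightarrow>
      nabla Y (\<lambda>q. Z q + Z' q) p = nabla Y Z p + nabla Y Z' p"
    unfolding plus using C[THEN conjunct2, THEN conjunct2, THEN conjunct2, THEN conjunct2, THEN conjunct1] by blast
  show "smooth_fun U f \<Longrightarrow> smooth_field U Y \<Longrightarrow> smooth_field U Z \<Longrightarrow> p \<in> U \<Longrightarrow>
      nabla Y (\<lambda>q. f q *\<^sub>R Z q) p = deriv_along Y f p *\<^sub>R Z p + f p *\<^sub>R nabla Y Z p"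
    using C[THEN conjunct2, THEN conjunct2, THEN conjunct2, THEN conjunct2, THEN conjunct2] by blast
qed

lemma smooth_fun_const: "smooth_fun U (\<lambda>_. r)"
  by (simp add: smooth_fun_def o_def)

lemma deriv_along_const: "deriv_along Y (\<lambda>_. r) p = 0"
  by (simp add: deriv_along_def o_def)

lemma nabla_zero_left:
  assumes "openin X U" "smooth_field U Z" "p \<in> U"
  shows "nabla (\<lambda>q. 0) Z p = 0"
  using nabla_scaleR_left[OF assms(1) smooth_fun_const assms(2,2,3), of 0] by simp

lemma nabla_zero_right:
  assumes "openin X U" "smooth_field U Y" "p \<in> U"
  shows "nabla Y (\<lambda>q. 0) p = 0"
  using nabla_scaleR_right[OF assms(1) smooth_fun_const assms(2,2,3), of 0]
  by (simp add: deriv_along_const)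

lemma nabla_sum_left:
  assumes U: "openin X U" "p \<in> U" and Z: "smooth_field U Z"
  shows "(\<And>i. i \<in> I \<Longrightarrow> smooth_fun U (f i)) \<Longrightarrow> (\<And>i. i \<in> I \<Longrightarrow> smooth_field U (Y i)) \<Longrightarrow>
    nabla (\<lambda>q. \<Sum>i\<in>I. f i q *\<^sub>R Y i q) Z p = (\<Sum>i\<in>I. f i p *\<^sub>R nabla (Y i) Z p)"
proof (induction I rule: infinite_finite_induct)
  case (insert i I)
  have s2: "smooth_field U (\<lambda>q. \<Sum>i\<in>I. f i q *\<^sub>R Y i q)"
    using insert.prems by (intro smooth_field_sum smooth_field_scaleR U) auto
  have s1: "smooth_field U (\<lambda>q. f i q *\<^sub>R Y i q)"
    using insert.prems by (intro smooth_field_scaleR U) auto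
  have s: "smooth_fun U (f i)" "smooth_field U (Y i)"
    using insert.prems by auto
  have "nabla (\<lambda>q. f i q *\<^sub>R Y i q + (\<Sum>i\<in>I. f i q *\<^sub>R Y i q)) Z p =
      f i p *\<^sub>R nabla (Y i) Z p + nabla (\<lambda>q. \<Sum>i\<in>I. f i q *\<^sub>R Y i q) Z p"
    by (simp only: nabla_add_left[OF U(1) s1 s2 Z U(2)] nabla_scaleR_left[OF U(1) s Z U(2)])
  also have "nabla (\<lambda>q. \<Sum>i\<in>I. f i q *\<^sub>R Y i q) Z p = (\<Sum>i\<in>I. f i p *\<^sub>R nabla (Y i) Z p)"
    by (rule insert.IH) (simp_all add: insert.prems)
  finally show ?case by (simp only: sum.insert[OF insert.hyps])
qed (simp_all add: nabla_zero_left[OF U(1) Z U(2)])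

lemma nabla_sum_right:
  assumes U: "openin X U" "p \<in> U" and Y: "smooth_field U Y"
  shows "(\<And>i. i \<in> I \<Longrightarrow> smooth_fun U (f i)) \<Longrightarrow> (\<And>i. i \<in> I \<Longrightarrow> smooth_field U (Z i)) \<Longrightarrow>
    nabla Y (\<lambda>q. \<Sum>i\<in>I. f i q *\<^sub>R Z i q) p =
      (\<Sum>i\<in>I. deriv_along Y (f i) p *\<^sub>R Z i p + f i p *\<^sub>R nabla Y (Z i) p)"
proof (induction I rule: infinite_finite_induct)
  case (insert i I)
  have s2: "smooth_field U (\<lambda>q. \<Sum>i\<in>I. f i q *\<^sub>R Z i q)"
    using insert.prems by (intro smooth_field_sum smooth_field_scaleR U) auto
  have s1: "smooth_field U (\<lambda>q. f i q *\<^sub>R Z i q)"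
    using insert.prems by (intro smooth_field_scaleR U) auto
  have s: "smooth_fun U (f i)" "smooth_field U (Z i)"
    using insert.prems by auto
  have "nabla Y (\<lambda>q. f i q *\<^sub>R Z i q + (\<Sum>i\<in>I. f i q *\<^sub>R Z i q)) p =
      (deriv_along Y (f i) p *\<^sub>R Z i p + f i p *\<^sub>R nabla Y (Z i) p) + nabla Y (\<lambda>q. \<Sum>i\<in>I. f i q *\<^sub>R Z i q) p"
    by (simp only: nabla_add_right[OF U(1) Y s1 s2 U(2)] nabla_scaleR_right[OF U(1) s(1) Y s(2) U(2)])
  also have "nabla Y (\<lambda>q. \<Sum>i\<in>I. f i q *\<^sub>R Z i q) p =
      (\<Sum>i\<in>I. deriv_along Y (f i) p *\<^sub>R Z i p + f i p *\<^sub>R nabla Y (Z i) p)"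
    by (rule insert.IH) (simp_all add: insert.prems)
  finally show ?case by (simp only: sum.insert[OF insert.hyps])
qed (simp_all add: nabla_zero_right[OF U(1) Y U(2)])

section \<open>Christoffel symbols\<close>

abbreviation coord_field :: "('a, 'n) chart \<Rightarrow> complex^'n \<Rightarrow> ('a, 'n) vfield"
  where "coord_field c u \<equiv> lift c (\<lambda>_. u)"

text \<open>Summing over basis vectors makes the Christoffel symbols bilinear even outside the
  range of the chart.\<close>

definition christoffel :: "('a, 'n) chart \<Rightarrow> complex^'n \<Rightarrow> complex^'n \<Rightarrow> complex^'n \<Rightarrow> complex^'n"
  where "christoffel c x u w = (\<Sum>a\<in>Basis. \<Sum>b\<in>Basis.
    ((u \<bullet> a) * (w \<bullet> b)) *\<^sub>R nabla (coord_field c a) (coord_field c b) (cinv c x) c)"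

lemma linear_christoffel: "linear (christoffel c x u)" "linear (\<lambda>u. christoffel c x u w)"
  unfolding christoffel_def
  by (intro linearI; simp add: inner_add_left algebra_simps sum.distrib scaleR_sum_right)+

lemma openin_cdom: "c \<in> A \<Longrightarrow> openin X (cdom c)"
  using chart_open[of c] by simp

lemma smooth_coord_field: "c \<in> A \<Longrightarrow> smooth_field (cdom c) (coord_field c u)"
  using smooth_field_lift[OF _ open_chart_range order_refl smooth_on_const, of c u]
  by (simp only: cinv_chart_range)

lemma smooth_christoffel:
  assumes "c \<in> A"
  shows "smooth_on (cmap c ` cdom c) (\<lambda>x. christoffel c x u w)"
  unfolding christoffel_def
proof (intro smooth_on_sum smooth_on_scaleR smooth_on_const open_chart_range assms)
  show "smooth_on (cmap c ` cdom c) (\<lambda>x. nabla (coord_field c a) (coord_field c b) (cinv c x) c)" for a b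
    using smooth_field_chart[OF nabla_smooth[OF openin_cdom[OF assms]
          smooth_coord_field[OF assms] smooth_coord_field[OF assms]] assms, of a b]
    by simp
qed

lemma field_decomposition:
  assumes "c \<in> A" "p \<in> cdom c" "Y p \<in> tangent_space p"
  shows "Y p = (\<Sum>b\<in>Basis. (Y p c \<bullet> b) *\<^sub>R coord_field c b p)"
proof (rule tangent_eqI[OF assms(3) _ assms(1,2)])
  show "(\<Sum>b\<in>Basis. (Y p c \<bullet> b) *\<^sub>R coord_field c b p) \<in> tangent_space p"
    by (intro tangent_sum tangent_scaleR lift_tangent assms)
  show "Y p c = (\<Sum>b\<in>Basis. (Y p c \<bullet> b) *\<^sub>R coord_field c b p) c"
    by (simp add: sum_fun_apply scaleR_fun_def lift_self assms euclidean_representation)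
qed

text \<open>Expanding both fields over coordinate fields, linearity over functions in the first
  argument and the Leibniz rule in the second split the covariant derivative into a directional
  derivative of the components and a bilinear term. All later arguments about the connection go
  through this formula.\<close>

lemma nabla_chart:
  assumes c: "c \<in> A" and U: "openin X U" "U \<subseteq> cdom c" "p \<in> U"
    and Y: "smooth_field U Y" and Z: "smooth_field U Z"
  shows "nabla Y Z p c = frechet_derivative (\<lambda>x. Z (cinv c x) c) (at (cmap c p)) (Y p c)
    + christoffel c (cmap c p) (Y p c) (Z p c)"
proof -
  let ?e = "coord_field c"
  let ?z = "\<lambda>x. Z (cinv c x) c"
  have pc: "p \<in> cdom c" using U by blast
  have e: "smooth_field U (?e b)" for b
    by (rule smooth_field_subset[OF smooth_coord_field[OF c] U(2)])
  note fY = smooth_fun_component[OF c U(1,2) Y] and fZ = smooth_fun_component[OF c U(1,2) Z]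
  have dec: "W q = (\<Sum>b\<in>Basis. (W q c \<bullet> b) *\<^sub>R ?e b q)" if "smooth_field U W" "q \<in> U" for W q
    by (rule field_decomposition[where Y = W, OF c _ smooth_field_tangent[OF that]]) (use that U in blast)
  have sY: "smooth_field U (\<lambda>q. \<Sum>b\<in>Basis. (Y q c \<bullet> b) *\<^sub>R ?e b q)"
    by (rule smooth_field_cong[OF U(1) dec[OF Y] Y])
  have sZ: "smooth_field U (\<lambda>q. \<Sum>b\<in>Basis. (Z q c \<bullet> b) *\<^sub>R ?e b q)"
    by (rule smooth_field_cong[OF U(1) dec[OF Z] Z])
  have Uc: "U \<inter> cdom c = U" using U by blast
  have cp: "cmap c p \<in> cmap c ` (U \<inter> cdom c)" using U by blast
  note dz = smooth_on_has_derivative[OF smooth_field_chart[OF Z c] cp]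
  have dzb: "deriv_along (?e a) (\<lambda>q. Z q c \<bullet> b) p = frechet_derivative ?z (at (cmap c p)) a \<bullet> b" for a b
  proof -
    have d: "((\<lambda>q. Z q c \<bullet> b) \<circ> cinv c has_derivative (\<lambda>v. frechet_derivative ?z (at (cmap c p)) v \<bullet> b)) (at (cmap c p))"
      unfolding o_def by (intro has_derivative_inner_left dz)
    have "deriv_along (?e a) (\<lambda>q. Z q c \<bullet> b) p =
        frechet_derivative ((\<lambda>q. Z q c \<bullet> b) \<circ> cinv c) (at (cmap c p)) (?e a p c)"
      by (rule deriv_along_chart[where Y = "?e a", OF c pc lift_tangent[OF c pc]]) (use d in \<open>auto simp: differentiable_def\<close>)
    then show ?thesis
      using frechet_derivative_at[OF d] lift_self[OF c pc, of "\<lambda>_. a"] by metis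
  qed
  \<comment> \<open>The fields agree with their expansions on \<open>U\<close> but possibly not
    outside it, so the replacement rests on the locality clause of
    \<open>connection\<close>.\<close>
  have "nabla Y Z p = nabla (\<lambda>q. \<Sum>a\<in>Basis. (Y q c \<bullet> a) *\<^sub>R ?e a q) (\<lambda>q. \<Sum>b\<in>Basis. (Z q c \<bullet> b) *\<^sub>R ?e b q) p"
    by (rule nabla_cong[OF U(1) sY sZ dec[OF Y] dec[OF Z] U(3)])
  also have "\<dots> = (\<Sum>a\<in>Basis. (Y p c \<bullet> a) *\<^sub>R nabla (?e a) (\<lambda>q. \<Sum>b\<in>Basis. (Z q c \<bullet> b) *\<^sub>R ?e b q) p)"
    by (rule nabla_sum_left[OF U(1,3) sZ fY e])
  also have "\<dots> = (\<Sum>a\<in>Basis. (Y p c \<bullet> a) *\<^sub>R (\<Sum>b\<in>Basis. deriv_along (?e a) (\<lambda>q. Z q c \<bullet> b) p *\<^sub>R ?e b p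
      + (Z p c \<bullet> b) *\<^sub>R nabla (?e a) (?e b) p))"
    by (simp add: nabla_sum_right[OF U(1,3) e fZ e])
  finally have N: "nabla Y Z p c = (\<Sum>a\<in>Basis. (Y p c \<bullet> a) *\<^sub>R (\<Sum>b\<in>Basis. (frechet_derivative ?z (at (cmap c p)) a \<bullet> b) *\<^sub>R b
      + (Z p c \<bullet> b) *\<^sub>R nabla (?e a) (?e b) p c))"
    by (simp add: sum_fun_apply scaleR_fun_def dzb lift_self[OF c pc])
  have "(\<Sum>a\<in>Basis. (Y p c \<bullet> a) *\<^sub>R frechet_derivative ?z (at (cmap c p)) a) = frechet_derivative ?z (at (cmap c p)) (Y p c)"
    using linear_eq_sum_Basis[OF has_derivative_linear[OF dz]] by metis
  then show ?thesis
    unfolding N christoffel_def cinv_cmap[OF c pc]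
    by (simp add: sum.distrib euclidean_representation scaleR_add_right scaleR_sum_right)
qed

lemma coord_field_chart: "c \<in> A \<Longrightarrow> x \<in> cmap c ` cdom c \<Longrightarrow> coord_field c u (cinv c x) c = u"
  by (simp add: lift_self cinv_in)

lemma frechet_derivative_coord_field:
  assumes "c \<in> A" "x \<in> cmap c ` cdom c"
  shows "frechet_derivative (\<lambda>x. coord_field c u (cinv c x) c) (at x) v = 0"
proof -
  have "((\<lambda>x. coord_field c u (cinv c x) c) has_derivative (\<lambda>_. 0)) (at x)"
    by (rule has_derivative_transform_within_open[OF has_derivative_const[of u] open_chart_range[OF assms(1)] assms(2)])
      (simp add: coord_field_chart[OF assms(1)])
  from frechet_derivative_at[OF this, THEN fun_cong, of v] show ?thesis by simp
qed

lemma christoffel_coord_field: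
  assumes "c \<in> A" "x \<in> cmap c ` cdom c"
  shows "nabla (coord_field c u) (coord_field c w) (cinv c x) c = christoffel c x u w"
  using nabla_chart[OF assms(1) openin_cdom[OF assms(1)] order_refl cinv_in[OF assms(2)]
      smooth_coord_field[OF assms(1)] smooth_coord_field[OF assms(1)], of u w]
  by (simp add: cmap_cinv[OF assms(2)] coord_field_chart[OF assms] frechet_derivative_coord_field[OF assms])

section \<open>Torsionfreeness and flatness in coordinates\<close>

lemma bracket_nabla:
  assumes "openin X U" "smooth_field U Y" "smooth_field U Z" "p \<in> U"
  shows "bracket Y Z p = nabla Y Z p - nabla Z Y p"
  using nabla_torsionfree[unfolded torsionfree_def, rule_format, OF conjI[OF assms(1) conjI[OF assms(2,3)]] assms(4)]
  by simp

text \<open>In the chart \<open>c\<close> both fields have constant components. The bracket is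
  defined chart by chart, so its tangency is not immediate; torsionfreeness writes it as a
  difference of covariant derivatives, which are tangent, and then the one chart suffices.\<close>

lemma bracket_coord_field:
  assumes "c \<in> A" "p \<in> cdom c"
  shows "bracket (coord_field c u) (coord_field c v) p = 0"
proof (rule tangent_eqI[OF _ tangent_zero assms])
  note s = smooth_coord_field[OF assms(1)]
  show "bracket (coord_field c u) (coord_field c v) p \<in> tangent_space p"
    unfolding bracket_nabla[OF openin_cdom[OF assms(1)] s s assms(2)]
    by (intro tangent_diff smooth_field_tangent[OF nabla_smooth[OF openin_cdom[OF assms(1)] s s] assms(2)])
  show "bracket (coord_field c u) (coord_field c v) p c = 0 c"
    using assms frechet_derivative_coord_field[OF assms(1) imageI[OF assms(2)]]
    by (simp add: bracket_def)
qed

text \<open>The vanishing of the torsion on coordinate fields, which commute.\<close>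

lemma christoffel_symmetric:
  assumes "c \<in> A" "x \<in> cmap c ` cdom c"
  shows "christoffel c x u v = christoffel c x v u"
proof -
  note s = smooth_coord_field[OF assms(1)]
  have "nabla (coord_field c u) (coord_field c v) (cinv c x) - nabla (coord_field c v) (coord_field c u) (cinv c x) = 0"
    using bracket_nabla[OF openin_cdom[OF assms(1)] s s cinv_in[OF assms(2)]]
      bracket_coord_field[OF assms(1) cinv_in[OF assms(2)]] by simp
  then show ?thesis
    using christoffel_coord_field[OF assms] by (metis eq_iff_diff_eq_0)
qed

text \<open>The vanishing of the curvature on coordinate fields. The second covariant derivative
  contributes a derivative of the symbols and a quadratic term, and the bracket term drops out. This
  is the integrability condition assumed in \<open>flat_section_exists\<close>.\<close>

lemma christoffel_flat:
  assumes c: "c \<in> A" and x: "x \<in> cmap c ` cdom c"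
  shows "frechet_derivative (\<lambda>y. christoffel c y v w) (at x) u + christoffel c x u (christoffel c x v w) =
    frechet_derivative (\<lambda>y. christoffel c y u w) (at x) v + christoffel c x v (christoffel c x u w)"
proof -
  let ?e = "coord_field c" and ?p = "cinv c x"
  note s = smooth_coord_field[OF c] and o = openin_cdom[OF c] and p = cinv_in[OF x]
  have N: "nabla (?e u) (nabla (?e v) (?e w)) ?p c =
    frechet_derivative (\<lambda>y. christoffel c y v w) (at x) u + christoffel c x u (christoffel c x v w)" for u v
  proof -
    have "frechet_derivative (\<lambda>y. nabla (?e v) (?e w) (cinv c y) c) (at x) = frechet_derivative (\<lambda>y. christoffel c y v w) (at x)"
    proof (rule frechet_derivative_transform_within_open[symmetric, OF _ open_chart_range[OF c] x])
      show "(\<lambda>y. christoffel c y v w) differentiable at x"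
        using smooth_on_has_derivative[OF smooth_christoffel[OF c] x] by (auto simp: differentiable_def)
    qed (simp add: christoffel_coord_field[OF c])
    then show ?thesis
      using nabla_chart[OF c o order_refl p s nabla_smooth[OF o s s], of u v w]
      by (simp add: cmap_cinv[OF x] coord_field_chart[OF c x] christoffel_coord_field[OF c x])
  qed
  \<comment> \<open>The bracket is known to vanish on the chart domain only, so it is exchanged for
    the zero field by locality.\<close>
  have "nabla (bracket (?e u) (?e v)) (?e w) ?p = nabla (\<lambda>q. 0) (?e w) ?p"
    by (rule nabla_cong[OF o smooth_field_zero s _ _ p]) (simp_all add: bracket_coord_field[OF c])
  also have "\<dots> = 0" by (rule nabla_zero_left[OF o s p])
  finally have "nabla (?e u) (nabla (?e v) (?e w)) ?p - nabla (?e v) (nabla (?e u) (?e w)) ?p = 0"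
    using nabla_flat[unfolded flat_def, rule_format, OF conjI[OF o conjI[OF s conjI[OF s s]]] p, of u v w] by simp
  then show ?thesis using N by (metis eq_iff_diff_eq_0)
qed

text \<open>By \<open>nabla_chart\<close>, the differential equation for \<open>y\<close> says that
  the derivative term and the Christoffel term of the lifted field cancel in every
  direction.\<close>

lemma parallel_field_lift:
  assumes c: "c \<in> A" and S: "open S" "S \<subseteq> cmap c ` cdom c" and y: "smooth_on S y"
    and dy: "\<And>x. x \<in> S \<Longrightarrow> (y has_derivative (\<lambda>v. - christoffel c x v (y x))) (at x)"
  shows "parallel_field nabla (cinv c ` S) (lift c y)"
  unfolding parallel_field_def
proof (intro conjI allI impI ballI)
  show sY: "smooth_field (cinv c ` S) (lift c y)"
    by (rule smooth_field_lift[OF c S y])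
  fix V Z p
  assume "openin X V \<and> V \<subseteq> cinv c ` S \<and> smooth_field V Z" and p: "p \<in> V"
  then have V: "openin X V" "V \<subseteq> cinv c ` S" and Z: "smooth_field V Z" by blast+
  note Y = smooth_field_subset[OF sY V(2)]
  have Vc: "V \<subseteq> cdom c" using V(2) cinv_image_subset[OF S(2)] by blast
  then have pc: "p \<in> cdom c" using p by blast
  have pS: "cmap c p \<in> S" using V(2) p cinv_image[OF c S(2)] by blast
  have "((\<lambda>x. lift c y (cinv c x) c) has_derivative (\<lambda>v. - christoffel c (cmap c p) v (y (cmap c p)))) (at (cmap c p))"
  proof (rule has_derivative_transform_within_open[OF dy[OF pS] S(1) pS])
    fix x assume "x \<in> S"
    then have "x \<in> cmap c ` cdom c" using S by blast
    then show "y x = lift c y (cinv c x) c"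
      by (simp add: lift_self[OF c] cinv_in cmap_cinv)
  qed
  from frechet_derivative_at[OF this, symmetric] have "nabla Z (lift c y) p c = 0"
    unfolding nabla_chart[OF c V(1) Vc p Z Y] lift_self[OF c pc] by simp
  then show "nabla Z (lift c y) p = 0"
    by (intro tangent_eqI[OF smooth_field_tangent[OF nabla_smooth[OF V(1) Z Y] p] tangent_zero c pc]) simp
qed

text \<open>Multiplication by \<open>\<i>\<close> is constant in a chart, so the derivatives of the
  components cancel and only an algebraic expression in the Christoffel symbols is left.\<close>

lemma nabla_J_chart:
  assumes c: "c \<in> A" and U: "openin X U" "U \<subseteq> cdom c" "p \<in> U"
    and Y: "smooth_field U Y" and Z: "smooth_field U Z"
  shows "nabla_J nabla Y Z p c = christoffel c (cmap c p) (Y p c) (\<i> *s Z p c)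
    - \<i> *s christoffel c (cmap c p) (Y p c) (Z p c)"
proof -
  have "cmap c p \<in> cmap c ` (U \<inter> cdom c)" using U by blast
  note dz = smooth_on_has_derivative[OF smooth_field_chart[OF Z c] this]
  from frechet_derivative_at[OF bounded_linear.has_derivative[OF bounded_linear_vector_smult dz], of \<i>]
  have "frechet_derivative (\<lambda>x. J (Z (cinv c x)) c) (at (cmap c p)) v =
      \<i> *s frechet_derivative (\<lambda>x. Z (cinv c x) c) (at (cmap c p)) v" for v
    by (simp add: J_def fun_eq_iff)
  then show ?thesis
    using nabla_chart[OF c U Y smooth_field_J[OF U(1) Z]] nabla_chart[OF c U Y Z]
    by (simp add: nabla_J_def J_def vector_add_ldistrib)
qed

text \<open>In the formula of \<open>nabla_J_chart\<close> the second term is symmetric in the two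
  fields, as the Christoffel symbols are, so the special condition amounts to the symmetry of the
  first term.\<close>

lemma special_complex_manifoldI:
  assumes "\<And>c x u v. c \<in> A \<Longrightarrow> x \<in> cmap c ` cdom c \<Longrightarrow>
    christoffel c x u (\<i> *s v) = christoffel c x v (\<i> *s u)"
  shows "special_complex_manifold X A nabla"
proof
  fix U Y Z p
  assume U: "openin X U" "p \<in> U" and Y: "smooth_field U Y" and Z: "smooth_field U Z"
  have pX: "p \<in> topspace X" using U openin_subset by blast
  obtain c where c: "c \<in> A" "p \<in> cdom c" by (rule chart_exists[OF pX])
  define V where "V = U \<inter> cdom c"
  have V: "openin X V" "V \<subseteq> cdom c" "p \<in> V" "V \<subseteq> U"
    using openin_Int[OF U(1) openin_cdom[OF c(1)]] U c by (auto simp: V_def)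
  note Y' = smooth_field_subset[OF Y V(4)] and Z' = smooth_field_subset[OF Z V(4)]
  have t: "nabla_J nabla Y Z p \<in> tangent_space p" if Y: "smooth_field U Y" and Z: "smooth_field U Z" for Y Z
    unfolding nabla_J_def
    by (intro tangent_diff tangent_J smooth_field_tangent[OF nabla_smooth[OF U(1)] U(2)] Y Z smooth_field_J U(1))
  show "nabla_J nabla Y Z p = nabla_J nabla Z Y p"
  proof (rule tangent_eqI[OF t[OF Y Z] t[OF Z Y] c])
    have x: "cmap c p \<in> cmap c ` cdom c" using c by blast
    show "nabla_J nabla Y Z p c = nabla_J nabla Z Y p c"
      unfolding nabla_J_chart[OF c(1) V(1-3) Y' Z'] nabla_J_chart[OF c(1) V(1-3) Z' Y']
      using assms[OF c(1) x, of "Y p c" "Z p c"] christoffel_symmetric[OF c(1) x, of "Y p c" "Z p c"] by simp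
  qed
qed

end

section \<open>Local actions\<close>

context complex_manifold
begin

section \<open>The action in coordinates\<close>

lemma continuous_map_cinv:
  assumes "c \<in> A"
  shows "continuous_map (top_of_set (cmap c ` cdom c)) X (cinv c)"
  unfolding continuous_map_def
proof (intro conjI allI impI)
  show "cinv c \<in> topspace (top_of_set (cmap c ` cdom c)) \<rightarrow> topspace X"
    using cinv_in[of _ c] cdom_subset[OF assms] by auto
  fix U assume U: "openin X U"
  have "{x \<in> cmap c ` cdom c. cinv c x \<in> U} = cmap c ` (U \<inter> cdom c)"
    by (auto simp: cinv_cmap[OF assms])
  then show "openin (top_of_set (cmap c ` cdom c)) {x \<in> topspace (top_of_set (cmap c ` cdom c)). cinv c x \<in> U}"
    using open_chart_image[OF assms U] by (simp add: openin_open_eq[OF open_chart_range[OF assms]] image_mono)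
qed

text \<open>\<open>diffeo_onto_image\<close> refers to \<open>inv_into\<close>, which coincides with
  the map of the inverse group element only on the image; this transfers smoothness from one to the
  other.\<close>

lemma smooth_map_cong:
  assumes U: "openin X U" and eq: "\<And>p. p \<in> U \<Longrightarrow> f p = g p" and f: "smooth_map U f"
  shows "smooth_map U g"
  unfolding smooth_map_def
proof (intro conjI ballI)
  have cf: "continuous_map (subtopology X U) X f" using f by (simp add: smooth_map_def)
  then show "continuous_map (subtopology X U) X g"
    by (rule continuous_map_eq) (simp add: eq)
  fix c d assume c: "c \<in> A" and d: "d \<in> A"
  have "openin (subtopology X U) {p \<in> topspace (subtopology X U). f p \<in> cdom d}"
    by (rule openin_continuous_map_preimage[OF cf]) (use chart_open[OF d] in blast)
  then have "openin X {p \<in> topspace (subtopology X U). f p \<in> cdom d}"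
    using U by (rule openin_trans_full)
  from open_chart_image[OF c this]
  have "open (cmap c ` ({p \<in> topspace (subtopology X U). f p \<in> cdom d} \<inter> cdom c))" .
  also have "{p \<in> topspace (subtopology X U). f p \<in> cdom d} \<inter> cdom c = {p \<in> U \<inter> cdom c. f p \<in> cdom d}"
    using openin_subset[OF U] by auto
  finally have o: "open (cmap c ` {p \<in> U \<inter> cdom c. f p \<in> cdom d})" .
  have "{p \<in> U \<inter> cdom c. g p \<in> cdom d} = {p \<in> U \<inter> cdom c. f p \<in> cdom d}"
    using eq by auto
  moreover have "smooth_on (cmap c ` {p \<in> U \<inter> cdom c. f p \<in> cdom d}) (cmap d \<circ> g \<circ> cinv c)"
  proof (rule smooth_on_cong[OF o])
    show "smooth_on (cmap c ` {p \<in> U \<inter> cdom c. f p \<in> cdom d}) (cmap d \<circ> f \<circ> cinv c)"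
      using f c d unfolding smooth_map_def by blast
  qed (auto simp: cinv_cmap[OF c] eq)
  ultimately show "smooth_on (cmap c ` {p \<in> U \<inter> cdom c. g p \<in> cdom d}) (cmap d \<circ> g \<circ> cinv c)"
    by simp
qed

lemma
  assumes "local_Cstar_action W \<phi>"
  shows action_open: "openin (prod_topology euclidean X) W"
    and action_one: "p \<in> topspace X \<Longrightarrow> (1, p) \<in> W" "p \<in> topspace X \<Longrightarrow> \<phi> 1 p = p"
    and action_subset: "(l, p) \<in> W \<Longrightarrow> l \<noteq> 0 \<and> p \<in> topspace X"
    and action_continuous: "continuous_map (subtopology (prod_topology euclidean X) W) X (\<lambda>(l, p). \<phi> l p)"
    and action_mult: "(m, p) \<in> W \<Longrightarrow> (l, \<phi> m p) \<in> W \<Longrightarrow> (l * m, p) \<in> W \<Longrightarrow> \<phi> l (\<phi> m p) = \<phi> (l * m) p"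
    and action_smooth: "c \<in> A \<Longrightarrow> d \<in> A \<Longrightarrow> smooth_on
      ((\<lambda>(l, p). (l, cmap c p)) ` {(l, p) \<in> W. p \<in> cdom c \<and> \<phi> l p \<in> cdom d})
      (\<lambda>(l, x). cmap d (\<phi> l (cinv c x)))"
  using assms unfolding local_Cstar_action_def holomorphic_map_on_def by blast+

text \<open>The smoothness of the action in coordinates is stated on this set, and calculus with
  \<open>smooth_on\<close> requires it to be open.\<close>

lemma action_domain_open:
  assumes "local_Cstar_action W \<phi>" "c \<in> A" "d \<in> A"
  shows "open ((\<lambda>(l, p). (l, cmap c p)) ` {(l, p) \<in> W. p \<in> cdom c \<and> \<phi> l p \<in> cdom d})"
proof -
  let ?P = "prod_topology (euclidean :: complex topology) X"
  let ?R = "cmap c ` cdom c"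
  have "openin (subtopology ?P W) {z \<in> topspace (subtopology ?P W). (case z of (l, p) \<Rightarrow> \<phi> l p) \<in> cdom d}"
    by (rule openin_continuous_map_preimage[OF action_continuous[OF assms(1)]]) (use chart_open[OF assms(3)] in blast)
  then have W': "openin ?P {z \<in> topspace (subtopology ?P W). (case z of (l, p) \<Rightarrow> \<phi> l p) \<in> cdom d}" (is "openin _ ?W'")
    using action_open[OF assms(1)] by (rule openin_trans_full)
  \<comment> \<open>The set is the preimage of an open part of \<open>W\<close> under the map that
    applies the inverse chart to the second factor, which is continuous on the product of the plane
    with the chart range.\<close>
  have "continuous_map (top_of_set (UNIV \<times> ?R)) ?P (\<lambda>z. (fst z, cinv c (snd z)))"
  proof (intro continuous_map_pairedI)
    show "continuous_map (top_of_set (UNIV \<times> ?R)) euclidean fst"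
      by (simp add: continuous_on_fst)
    have "continuous_map (top_of_set (UNIV \<times> ?R)) (top_of_set ?R) snd"
      by (auto simp: continuous_map_in_subtopology continuous_on_snd)
    from continuous_map_compose[OF this continuous_map_cinv[OF assms(2)]]
    show "continuous_map (top_of_set (UNIV \<times> ?R)) X (\<lambda>z. cinv c (snd z))" by (simp add: o_def)
  qed
  from openin_continuous_map_preimage[OF this W']
  have "openin (top_of_set (UNIV \<times> ?R)) {z \<in> UNIV \<times> ?R. (fst z, cinv c (snd z)) \<in> ?W'}" by simp
  then have "open {z \<in> UNIV \<times> ?R. (fst z, cinv c (snd z)) \<in> ?W'}"
    by (rule openin_open_trans) (intro open_Times open_UNIV open_chart_range assms)
  moreover have "{z \<in> UNIV \<times> ?R. (fst z, cinv c (snd z)) \<in> ?W'} =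
      (\<lambda>(l, p). (l, cmap c p)) ` {(l, p) \<in> W. p \<in> cdom c \<and> \<phi> l p \<in> cdom d}" (is "?L = ?I")
  proof (intro equalityI subsetI)
    fix z assume "z \<in> ?L"
    then have z: "snd z \<in> ?R" "(fst z, cinv c (snd z)) \<in> W" "\<phi> (fst z) (cinv c (snd z)) \<in> cdom d" by auto
    then show "z \<in> ?I"
      by (intro image_eqI[of _ _ "(fst z, cinv c (snd z))"]) (auto simp: cmap_cinv cinv_in)
  next
    fix z assume "z \<in> ?I"
    then obtain l p where z: "z = (l, cmap c p)" "(l, p) \<in> W" "p \<in> cdom c" "\<phi> l p \<in> cdom d" by auto
    then show "z \<in> ?L"
      using action_subset[OF assms(1) z(2)] by (simp add: cinv_cmap[OF assms(2)])
  qed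
  ultimately show ?thesis by simp
qed

section \<open>The maps \<open>\<phi> l\<close> for a fixed group element\<close>

lemma action_slice_open:
  assumes "local_Cstar_action W \<phi>"
  shows "openin X {p. (l, p) \<in> W}"
proof -
  have "continuous_map X (prod_topology euclidean X) (\<lambda>p. (l, p))"
    by (intro continuous_map_pairedI) auto
  from openin_continuous_map_preimage[OF this action_open[OF assms]]
  have "openin X {p \<in> topspace X. (l, p) \<in> W}" .
  moreover have "{p \<in> topspace X. (l, p) \<in> W} = {p. (l, p) \<in> W}"
    using action_subset[OF assms] by blast
  ultimately show ?thesis by simp
qed

lemma action_slice_continuous:
  assumes "local_Cstar_action W \<phi>" "openin X Q" "Q \<subseteq> {p. (l, p) \<in> W}"
  shows "continuous_map (subtopology X Q) X (\<phi> l)"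
proof -
  have "continuous_map (subtopology X Q) (prod_topology euclidean X) (\<lambda>p. (l, p))"
    by (intro continuous_map_pairedI) auto
  then have "continuous_map (subtopology X Q) (subtopology (prod_topology euclidean X) W) (\<lambda>p. (l, p))"
    using assms(3) by (auto simp: continuous_map_in_subtopology)
  from continuous_map_compose[OF this action_continuous[OF assms(1)]] show ?thesis by (simp add: o_def)
qed

lemma action_slice_preimage:
  assumes "local_Cstar_action W \<phi>" "openin X Q" "Q \<subseteq> {p. (l, p) \<in> W}" "openin X V"
  shows "openin X {p \<in> Q. \<phi> l p \<in> V}"
proof -
  have "topspace (subtopology X Q) = Q" using openin_subset[OF assms(2)] by auto
  with openin_continuous_map_preimage[OF action_slice_continuous[OF assms(1-3)] assms(4)]
  have "openin (subtopology X Q) {p \<in> Q. \<phi> l p \<in> V}" by (simp only:)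
  then show ?thesis using assms(2) by (rule openin_trans_full)
qed

lemma action_slice_smooth:
  assumes "local_Cstar_action W \<phi>" "openin X Q" "Q \<subseteq> {p. (l, p) \<in> W}"
  shows "smooth_map Q (\<phi> l)"
  unfolding smooth_map_def
proof (intro conjI ballI)
  show "continuous_map (subtopology X Q) X (\<phi> l)" by (rule action_slice_continuous[OF assms])
  fix c d assume c: "c \<in> A" and d: "d \<in> A"
  have "openin X {p \<in> Q. \<phi> l p \<in> cdom d}"
    by (rule action_slice_preimage[OF assms]) (use chart_open[OF d] in blast)
  from open_chart_image[OF c this] have o: "open (cmap c ` {p \<in> Q \<inter> cdom c. \<phi> l p \<in> cdom d})"
    by (simp add: Int_def conj_ac)
  have "smooth_on (cmap c ` {p \<in> Q \<inter> cdom c. \<phi> l p \<in> cdom d}) (\<lambda>x. (\<lambda>(l, x). cmap d (\<phi> l (cinv c x))) (l, x))"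
  proof (rule smooth_on_compose[OF o action_smooth[OF assms(1) c d]])
    show "smooth_on (cmap c ` {p \<in> Q \<inter> cdom c. \<phi> l p \<in> cdom d}) (Pair l)"
      by (rule smooth_on_Pair[OF o smooth_on_const smooth_on_ident[OF o]])
    show "Pair l ` (cmap c ` {p \<in> Q \<inter> cdom c. \<phi> l p \<in> cdom d}) \<subseteq>
        (\<lambda>(l, p). (l, cmap c p)) ` {(l, p) \<in> W. p \<in> cdom c \<and> \<phi> l p \<in> cdom d}"
      using assms(3) by force
  qed
  then show "smooth_on (cmap c ` {p \<in> Q \<inter> cdom c. \<phi> l p \<in> cdom d}) (cmap d \<circ> \<phi> l \<circ> cinv c)"
    by (simp add: o_def)
qed

text \<open>On this set \<open>\<phi>\<^sub>l\<close> is a diffeomorphism with inverse given by the action of \<open>1/l\<close>, so that no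
  inverse function theorem is needed.\<close>

definition action_domain :: "(complex \<times> 'a) set \<Rightarrow> (complex \<Rightarrow> 'a \<Rightarrow> 'a) \<Rightarrow> 'a set \<Rightarrow> complex \<Rightarrow> 'a set"
  where "action_domain W \<phi> V l = {p \<in> V. (l, p) \<in> W \<and> \<phi> l p \<in> V \<and> (inverse l, \<phi> l p) \<in> W}"

lemma action_inverse:
  assumes "local_Cstar_action W \<phi>" "(l, p) \<in> W" "(inverse l, \<phi> l p) \<in> W"
  shows "\<phi> (inverse l) (\<phi> l p) = p"
proof -
  have p: "l \<noteq> 0" "p \<in> topspace X" using action_subset[OF assms(1,2)] by auto
  then have l: "inverse l * l = 1" by simp
  have "\<phi> (inverse l) (\<phi> l p) = \<phi> (inverse l * l) p"
    by (rule action_mult[OF assms]) (simp only: l action_one(1)[OF assms(1) p(2)])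
  then show ?thesis using action_one(2)[OF assms(1) p(2)] l by simp
qed

lemma action_domain_openin:
  assumes "local_Cstar_action W \<phi>" "openin X V"
  shows "openin X (action_domain W \<phi> V l)"
proof -
  have "openin X {p \<in> V \<inter> {p. (l, p) \<in> W}. \<phi> l p \<in> V \<inter> {p. (inverse l, p) \<in> W}}"
    by (intro action_slice_preimage[OF assms(1)] openin_Int assms action_slice_open[OF assms(1)]) auto
  moreover have "{p \<in> V \<inter> {p. (l, p) \<in> W}. \<phi> l p \<in> V \<inter> {p. (inverse l, p) \<in> W}} = action_domain W \<phi> V l"
    by (auto simp: action_domain_def)
  ultimately show ?thesis by simp
qed

text \<open>The conditions defining \<open>action_domain\<close> are exchanged when \<open>l\<close>
  is replaced by its inverse and the point by its image. So the image is a set of the same kind, and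
  in particular open when \<open>V\<close> is.\<close>

lemma action_domain_image:
  assumes "local_Cstar_action W \<phi>"
  shows "\<phi> l ` action_domain W \<phi> V l = action_domain W \<phi> V (inverse l)"
proof -
  have sub: "\<phi> l ` action_domain W \<phi> V l \<subseteq> action_domain W \<phi> V (inverse l)" for l
    by (auto simp: action_domain_def action_inverse[OF assms])
  show ?thesis
  proof (rule equalityI[OF sub subsetI])
    fix q assume q: "q \<in> action_domain W \<phi> V (inverse l)"
    then have "\<phi> (inverse l) q \<in> action_domain W \<phi> V l" using sub[of "inverse l"] by auto
    moreover have "\<phi> l (\<phi> (inverse l) q) = q"
      using q action_inverse[OF assms, of "inverse l" q] by (simp add: action_domain_def)
    ultimately show "q \<in> \<phi> l ` action_domain W \<phi> V l" by (metis image_eqI)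
  qed
qed

lemma action_diffeo:
  assumes \<phi>: "local_Cstar_action W \<phi>" and V: "openin X V"
  shows "diffeo_onto_image (action_domain W \<phi> V l) (\<phi> l)"
proof -
  let ?Q = "action_domain W \<phi> V"
  have inv: "\<phi> (inverse l) (\<phi> l p) = p" if "p \<in> ?Q l" for p
    using that by (simp add: action_domain_def action_inverse[OF \<phi>])
  have inj: "inj_on (\<phi> l) (?Q l)" by (rule inj_on_inverseI[where g = "\<phi> (inverse l)"]) (rule inv)
  have sub: "?Q l \<subseteq> {p. (l, p) \<in> W}" for l by (auto simp: action_domain_def)
  note o = action_domain_openin[OF \<phi> V]
  \<comment> \<open>On the image the inverse map is the action of \<open>inverse l\<close>, so its
    smoothness is another instance of the smoothness of the action for a fixed group
    element.\<close>
  have "smooth_map (?Q (inverse l)) (inv_into (?Q l) (\<phi> l))"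
  proof (rule smooth_map_cong[OF o _ action_slice_smooth[OF \<phi> o sub]])
    fix q assume "q \<in> ?Q (inverse l)"
    then obtain p where "p \<in> ?Q l" "q = \<phi> l p" using action_domain_image[OF \<phi>, of l V] by auto
    then show "\<phi> (inverse l) q = inv_into (?Q l) (\<phi> l) q" using inv inj by simp
  qed
  then show ?thesis
    unfolding diffeo_onto_image_def action_domain_image[OF \<phi>]
    using o inj action_slice_smooth[OF \<phi> o sub] by blast
qed

end

section \<open>Conic manifolds\<close>

text \<open>Stated for \<open>nhds 0\<close> instead of \<open>at 0\<close>: comparing derivatives
  of two curves at 0 also needs their values there to agree.\<close>

lemma eventually_at_0_preimage:
  fixes g :: "real \<Rightarrow> 'b::topological_space"
  assumes "isCont g 0" "open S" "g 0 \<in> S"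
  shows "\<forall>\<^sub>F t in nhds 0. g t \<in> S"
  using assms by (metis isCont_def tendsto_at_iff_tendsto_nhds topological_tendstoD)

context flat_complex_manifold
begin

text \<open>In a chart, let \<open>F (l, x) = \<phi>\<^sub>l x\<close> and let \<open>\<eta>\<close> generate the circle action. Differentiating
  the conic condition for a parallel field through \<open>v\<close> gives \<open>\<nabla>\<^sub>v \<eta> = J v\<close>.\<close>

lemma conic_rotation_field:
  assumes \<phi>: "local_Cstar_action W \<phi>" and con: "conic_action nabla W \<phi>" and c: "c \<in> A"
  obtains \<eta> where "smooth_on (cmap c ` cdom c) \<eta>"
    "\<And>x v. x \<in> cmap c ` cdom c \<Longrightarrow>
      frechet_derivative \<eta> (at x) v + christoffel c x v (\<eta> x) = \<i> *s v"
proof -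
  let ?\<Omega> = "cmap c ` cdom c"
  define G where "G = (\<lambda>(l, p). (l, cmap c p)) ` {(l, p) \<in> W. p \<in> cdom c \<and> \<phi> l p \<in> cdom c}"
  define F where "F = (\<lambda>(l, x). cmap c (\<phi> l (cinv c x)))"
  have oG: "open G" unfolding G_def by (rule action_domain_open[OF \<phi> c c])
  have F: "smooth_on G F" unfolding G_def F_def by (rule action_smooth[OF \<phi> c c])
  note o\<Omega> = open_chart_range[OF c]
  have G_iff: "(l, x) \<in> G \<longleftrightarrow> x \<in> ?\<Omega> \<and> (l, cinv c x) \<in> W \<and> \<phi> l (cinv c x) \<in> cdom c" for l x
  proof
    assume "(l, x) \<in> G"
    then obtain p where "x = cmap c p" "(l, p) \<in> W" "p \<in> cdom c" "\<phi> l p \<in> cdom c"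
      by (auto simp: G_def)
    then show "x \<in> ?\<Omega> \<and> (l, cinv c x) \<in> W \<and> \<phi> l (cinv c x) \<in> cdom c"
      by (simp add: cinv_cmap[OF c])
  next
    assume "x \<in> ?\<Omega> \<and> (l, cinv c x) \<in> W \<and> \<phi> l (cinv c x) \<in> cdom c"
    then show "(l, x) \<in> G"
      unfolding G_def by (intro image_eqI[of _ _ "(l, cinv c x)"]) (auto simp: cmap_cinv cinv_in)
  qed
  have inX: "cinv c x \<in> topspace X" if "x \<in> ?\<Omega>" for x
    using cinv_in[OF that] cdom_subset[OF c] by blast
  have G1: "(1, x) \<in> G" if "x \<in> ?\<Omega>" for x
    using action_one[OF \<phi> inX[OF that]] cinv_in[OF that] that by (simp add: G_iff)
  have F1: "F (1, x) = x" if "x \<in> ?\<Omega>" for x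
    using action_one(2)[OF \<phi> inX[OF that]] cmap_cinv[OF that] by (simp add: F_def)
  \<comment> \<open>The vector \<open>\<i>\<close> is the velocity of \<open>cis\<close> at 0, so
    this is the velocity of the circle orbit through \<open>x\<close>.\<close>
  define \<eta> where "\<eta> x = frechet_derivative F (at (1, x)) (\<i>, 0)" for x
  have P1: "smooth_on ?\<Omega> (Pair (1::complex))"
    by (rule smooth_on_Pair[OF o\<Omega> smooth_on_const smooth_on_ident[OF o\<Omega>]])
  have P1im: "Pair 1 ` ?\<Omega> \<subseteq> G" using G1 by blast
  have \<eta>: "smooth_on ?\<Omega> \<eta>"
    unfolding \<eta>_def by (rule smooth_on_compose[OF o\<Omega> smooth_on_derivative[OF F] P1 P1im])
  have "frechet_derivative \<eta> (at x) v + christoffel c x v (\<eta> x) = \<i> *s v" if x: "x \<in> ?\<Omega>" for x v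
  proof -
    \<comment> \<open>The parallel field with value \<open>v\<close> at \<open>x\<close>; the conic
      condition can now be tested on an arbitrary tangent vector.\<close>
    obtain S y where S: "open S" "x \<in> S" "S \<subseteq> ?\<Omega>" and y: "smooth_on S y" "y x = v"
      and dy: "\<And>x. x \<in> S \<Longrightarrow> (y has_derivative (\<lambda>v. - christoffel c x v (y x))) (at x)"
      using flat_section_exists[OF o\<Omega> x smooth_christoffel[OF c] linear_christoffel christoffel_flat[OF c], of v]
      by blast
    define Y where "Y = lift c y"
    define p where "p = cinv c x"
    let ?U = "cinv c ` S"
    have par: "parallel_field nabla ?U Y"
      unfolding Y_def by (rule parallel_field_lift[OF c S(1,3) y(1) dy])
    have oU: "openin X ?U" by (rule open_cinv_image[OF c S(1,3)])
    have pU: "p \<in> ?U" using S(2) by (simp add: p_def)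
    have pc: "p \<in> cdom c" "cmap c p = x" using cinv_in[OF x] cmap_cinv[OF x] by (simp_all add: p_def)
    obtain N V where N: "open N" "1 \<in> N" and V: "openin X V" "p \<in> V" "V \<subseteq> ?U"
      and NV: "\<And>r t Q. r > 0 \<and> rcis r t \<in> N \<and> Q \<subseteq> V \<and> {rcis r t} \<times> Q \<subseteq> W \<and>
        diffeo_onto_image Q (\<phi> (rcis r t)) \<and> \<phi> (rcis r t) ` Q \<subseteq> V \<Longrightarrow> \<forall>q\<in>Q.
        differential (\<phi> (rcis r t)) q (Y q) =
          (r * cos t) *\<^sub>R Y (\<phi> (rcis r t) q) + (r * sin t) *\<^sub>R J (Y (\<phi> (rcis r t) q))"
      using con[unfolded conic_action_def, THEN spec, THEN spec, THEN mp, OF conjI[OF oU par], THEN bspec, OF pU]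
      by (elim exE conjE) (rule that, assumption+, erule allE, erule allE, erule allE, erule mp, assumption)
    have Vc: "V \<subseteq> cdom c" using V(3) cinv_image_subset[OF S(3)] by blast
    define SV where "SV = cmap c ` V"
    have oSV: "open SV"
      using open_chart_image[OF c V(1)] Vc by (simp add: SV_def Int_absorb2)
    have xSV: "x \<in> SV" using V(2) pc by (auto simp: SV_def)
    have Vx: "cinv c z \<in> V" if "z \<in> SV" for z
      using that Vc by (auto simp: SV_def cinv_cmap[OF c])
    have dcis: "((\<lambda>t. (cis t, x)) has_derivative (\<lambda>s. s *\<^sub>R (\<i>, 0))) (at 0)"
    proof -
      have "(cis has_derivative (\<lambda>s. s *\<^sub>R (\<i> * cis 0))) (at 0)"
        by (rule has_derivative_cis[OF has_derivative_ident])
      from has_derivative_Pair[OF this has_derivative_const[of x]] show ?thesis by simp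
    qed
    \<comment> \<open>The orbit of \<open>x\<close> under the circle, in coordinates.\<close>
    define f where "f t = F (cis t, x)" for t
    have df: "(f has_derivative (\<lambda>s. s *\<^sub>R \<eta> x)) (at 0)"
    proof -
      note d = smooth_on_has_derivative[OF F G1[OF x]]
      have "(f has_derivative (\<lambda>s. frechet_derivative F (at (1, x)) (s *\<^sub>R (\<i>, 0)))) (at 0)"
        unfolding f_def by (rule has_derivative_compose[OF dcis]) (use d in simp)
      then show ?thesis
        by (simp only: linear_scale[OF has_derivative_linear[OF d]] \<eta>_def)
    qed
    have f0: "f 0 = x" by (simp add: f_def F1[OF x])
    have cf: "isCont f 0" using has_derivative_continuous[OF df] .
    have ccis: "isCont cis 0" "isCont (\<lambda>t. cis (- t)) 0"
      by (rule has_derivative_continuous[OF has_derivative_cis[OF has_derivative_ident]])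
        (rule has_derivative_continuous[OF has_derivative_cis[OF has_derivative_minus[OF has_derivative_ident]]])
    have key: "\<forall>\<^sub>F t in nhds 0. frechet_derivative F (at (cis t, x)) (0, v) =
        cos t *\<^sub>R y (f t) + sin t *\<^sub>R (\<i> *s y (f t))"
    proof -
      have "\<forall>\<^sub>F t in nhds 0. (cis t, x) \<in> G"
        by (rule eventually_at_0_preimage[OF _ oG]) (use G1[OF x] in \<open>auto intro!: continuous_intros ccis\<close>)
      moreover have "\<forall>\<^sub>F t in nhds 0. (inverse (cis t), f t) \<in> G"
        by (rule eventually_at_0_preimage[OF _ oG]) (use G1[OF x] in \<open>auto simp: f0 intro!: continuous_intros cf ccis\<close>)
      moreover have "\<forall>\<^sub>F t in nhds 0. f t \<in> SV"
        by (rule eventually_at_0_preimage[OF cf oSV]) (simp add: f0 xSV)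
      moreover have "\<forall>\<^sub>F t in nhds 0. cis t \<in> N"
        by (rule eventually_at_0_preimage[OF ccis(1) N(1)]) (simp add: N(2))
      \<comment> \<open>The first three conditions put \<open>p\<close> into
        \<open>action_domain\<close>: the action by \<open>cis t\<close> is defined at
        \<open>p\<close>, its inverse is defined at the image, and the image lies in
        \<open>V\<close>. The fourth admits \<open>cis t\<close> in the conic condition, which is
        used with \<open>r = 1\<close>.\<close>
      ultimately show ?thesis
      proof eventually_elim
        case (elim t)
        let ?l = "cis t"
        let ?Q = "action_domain W \<phi> V ?l"
        have lp: "(?l, p) \<in> W" "\<phi> ?l p \<in> cdom c"
          using elim(1) by (auto simp: G_iff p_def)
        have ft: "f t = cmap c (\<phi> ?l p)" by (simp add: f_def F_def p_def)
        then have cft: "cinv c (f t) = \<phi> ?l p" using lp(2) by (simp add: cinv_cmap[OF c])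
        have pQ: "p \<in> ?Q"
          using V(2) lp(1) Vx[OF elim(3)] elim(2) by (simp add: action_domain_def cft G_iff)
        have r: "rcis 1 t = ?l" by (simp add: rcis_def)
        have "differential (\<phi> ?l) p (Y p) = (1 * cos t) *\<^sub>R Y (\<phi> ?l p) + (1 * sin t) *\<^sub>R J (Y (\<phi> ?l p))"
        proof (rule NV[of 1 t ?Q, unfolded r, THEN bspec, OF _ pQ], intro conjI)
          show "\<phi> ?l ` ?Q \<subseteq> V"
            unfolding action_domain_image[OF \<phi>] by (auto simp: action_domain_def)
          show "diffeo_onto_image ?Q (\<phi> ?l)" by (rule action_diffeo[OF \<phi> V(1)])
        qed (use elim(4) in \<open>auto simp: action_domain_def\<close>)
        then have D: "differential (\<phi> ?l) p (Y p) c = cos t *\<^sub>R y (f t) + sin t *\<^sub>R (\<i> *s y (f t))"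
          by (simp add: scaleR_fun_def J_def Y_def lift_self[OF c lp(2)] ft)
        \<comment> \<open>\<open>differential\<close> is computed in \<open>chart_at p\<close>,
          whereas \<open>F\<close> uses the chart \<open>c\<close> on both sides. The chain rule
          inserts the coordinate change, which carries the component of \<open>Y p\<close> in
          \<open>chart_at p\<close> to its component \<open>v\<close> in \<open>c\<close>.\<close>
        let ?e = "chart_at p"
        have e: "?e \<in> A" "p \<in> cdom ?e"
          using chart_at[of p] cdom_subset[OF c] pc(1) by auto
        have dF: "((\<lambda>z. F (?l, z)) has_derivative (\<lambda>w. frechet_derivative F (at (?l, x)) (0, w))) (at x)"
        proof -
          have "((\<lambda>z. (?l, z)) has_derivative (\<lambda>w. (0, w))) (at x)"
            by (auto intro!: derivative_eq_intros)
          from has_derivative_compose[OF this smooth_on_has_derivative[OF F elim(1)]] show ?thesis .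
        qed
        have px: "(cmap c \<circ> cinv ?e) (cmap ?e p) = x" using cinv_cmap[OF e] pc by simp
        have "((\<lambda>z. F (?l, (cmap c \<circ> cinv ?e) z)) has_derivative
            (\<lambda>w. frechet_derivative F (at (?l, x)) (0, dtrans ?e c p w))) (at (cmap ?e p))"
          by (rule has_derivative_compose[OF has_derivative_trans[OF e(1) c e(2) pc(1)]])
            (unfold px, rule dF)
        then have "((cmap c \<circ> \<phi> ?l \<circ> cinv ?e) has_derivative
            (\<lambda>w. frechet_derivative F (at (?l, x)) (0, dtrans ?e c p w))) (at (cmap ?e p))"
          by (rule has_derivative_transform_within_open[OF _ open_overlap[OF e(1) c]])
            (use e pc in \<open>auto simp: F_def cinv_cmap[OF c] cinv_cmap[OF e(1)]\<close>)
        from frechet_derivative_at[OF this, symmetric]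
        have "differential (\<phi> ?l) p (Y p) c = frechet_derivative F (at (?l, x)) (0, dtrans ?e c p (Y p ?e))"
          using c lp(2) by (simp add: differential_def)
        also have "dtrans ?e c p (Y p ?e) = v"
          using tangent_spaceD[OF lift_tangent[OF c pc(1), of y] e(1) c e(2) pc(1)] lift_self[OF c pc(1), of y]
            y(2) pc(2) by (simp add: Y_def)
        finally show ?case using D by simp
      qed
    qed
    \<comment> \<open>The left side of \<open>key\<close> is a space derivative of \<open>F\<close>,
      so its time derivative at 0 is a mixed second derivative. Exchanging the order makes it the
      space derivative of the velocity, that is of \<open>\<eta>\<close>.\<close>
    have L: "((\<lambda>t. frechet_derivative F (at (cis t, x)) (0, v)) has_derivative
        (\<lambda>s. s *\<^sub>R frechet_derivative \<eta> (at x) v)) (at 0)"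
    proof -
      have d: "((\<lambda>z. frechet_derivative F (at z) w) has_derivative
          frechet_derivative (\<lambda>z. frechet_derivative F (at z) w) (at (1, x))) (at (1, x))" for w
        by (rule smooth_on_has_derivative[OF smooth_on_derivative[OF F] G1[OF x]])
      have "((\<lambda>t. (cis t, x)) has_derivative (\<lambda>s. s *\<^sub>R (\<i>, 0))) (at 0)" by (rule dcis)
      then have 1: "((\<lambda>t. frechet_derivative F (at (cis t, x)) (0, v)) has_derivative
          (\<lambda>s. frechet_derivative (\<lambda>z. frechet_derivative F (at z) (0, v)) (at (1, x)) (s *\<^sub>R (\<i>, 0)))) (at 0)"
        by (rule has_derivative_compose[of "\<lambda>t. (cis t, x)"]) (use d in simp)
      have "((\<lambda>z. (1::complex, z)) has_derivative (\<lambda>w. (0, w))) (at x)"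
        by (auto intro!: derivative_eq_intros)
      from has_derivative_compose[OF this d[of "(\<i>, 0)"]]
      have "(\<eta> has_derivative (\<lambda>w. frechet_derivative (\<lambda>z. frechet_derivative F (at z) (\<i>, 0)) (at (1, x)) (0, w))) (at x)"
        by (simp add: \<eta>_def[abs_def])
      from frechet_derivative_at[OF this, THEN fun_cong, of v]
      have "frechet_derivative \<eta> (at x) v = frechet_derivative (\<lambda>z. frechet_derivative F (at z) (0, v)) (at (1, x)) (\<i>, 0)"
        using smooth_on_derivative_commute[OF oG F G1[OF x]] by metis
      with 1 show ?thesis
        by (simp only: linear_scale[OF has_derivative_linear[OF d]])
    qed
    \<comment> \<open>The sine contributes \<open>\<i> *s v\<close>. The cosine has derivative 0,
      but \<open>y\<close> moves along the orbit and contributes minus the Christoffel term in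
      direction \<open>\<eta> x\<close>, because it is parallel.\<close>
    have R: "((\<lambda>t. cos t *\<^sub>R y (f t) + sin t *\<^sub>R (\<i> *s y (f t))) has_derivative
        (\<lambda>s. s *\<^sub>R (\<i> *s v - christoffel c x (\<eta> x) v))) (at 0)"
    proof -
      have "(y has_derivative (\<lambda>w. - christoffel c (f 0) w (y (f 0)))) (at (f 0))"
        unfolding f0 by (rule dy[OF S(2)])
      from has_derivative_compose[OF df this]
      have yf: "((\<lambda>t. y (f t)) has_derivative (\<lambda>s. - (s *\<^sub>R christoffel c x (\<eta> x) v))) (at 0)"
        by (simp add: f0 y(2) linear_scale[OF linear_christoffel(2)])
      have c0: "(cos has_derivative (\<lambda>s. 0)) (at (0::real))" "(sin has_derivative (\<lambda>s. s)) (at (0::real))"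
        by (rule has_derivative_eq_rhs[OF has_field_derivative_imp_has_derivative[OF DERIV_cos]]
            has_derivative_eq_rhs[OF has_field_derivative_imp_has_derivative[OF DERIV_sin]]; simp add: fun_eq_iff)+
      have "((\<lambda>t. cos t *\<^sub>R y (f t) + sin t *\<^sub>R (\<i> *s y (f t))) has_derivative
        (\<lambda>s. (cos 0 *\<^sub>R - (s *\<^sub>R christoffel c x (\<eta> x) v) + 0 *\<^sub>R y (f 0)) +
          (sin 0 *\<^sub>R (\<i> *s - (s *\<^sub>R christoffel c x (\<eta> x) v)) + s *\<^sub>R (\<i> *s y (f 0))))) (at 0)"
        by (intro has_derivative_add has_derivative_scaleR c0 yf
            bounded_linear.has_derivative[OF bounded_linear_vector_smult])
      then show ?thesis by (simp add: f0 y(2) scaleR_diff_right)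
    qed
    \<comment> \<open>Since \<open>key\<close> holds on a full neighbourhood of 0, including 0, the
      derivative found for its left side is also one for its right side; uniqueness then equates the
      two at the increment 1.\<close>
    have "((\<lambda>t. cos t *\<^sub>R y (f t) + sin t *\<^sub>R (\<i> *s y (f t))) has_derivative
        (\<lambda>s. s *\<^sub>R frechet_derivative \<eta> (at x) v)) (at 0)"
      by (rule has_derivative_transform_eventually[OF L])
        (use key in \<open>auto simp: eventually_at_filter elim: eventually_mono dest: eventually_nhds_x_imp_x\<close>)
    from has_derivative_unique[OF this R]
    have "1 *\<^sub>R frechet_derivative \<eta> (at x) v = 1 *\<^sub>R (\<i> *s v - christoffel c x (\<eta> x) v)" by metis
    then show ?thesis
      using christoffel_symmetric[OF c x, of "\<eta> x" v] by simp
  qed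
  with \<eta> show thesis by (rule that)
qed

text \<open>The second derivative of \<open>\<eta>\<close> is symmetric. Written through the
  first-order equation for \<open>\<eta>\<close>, its antisymmetric part consists of the curvature
  applied to \<open>\<eta>\<close>, which is zero, and of the expression whose vanishing is the
  special condition.\<close>

lemma conic_imp_special:
  assumes \<phi>: "local_Cstar_action W \<phi>" and con: "conic_action nabla W \<phi>"
  shows "special_complex_manifold X A nabla"
proof (rule special_complex_manifoldI)
  fix c x u v assume c: "c \<in> A" and x: "x \<in> cmap c ` cdom c"
  let ?\<Gamma> = "christoffel c"
  note o = open_chart_range[OF c] and sm = smooth_christoffel[OF c]
  obtain \<eta> where \<eta>: "smooth_on (cmap c ` cdom c) \<eta>"
    and eq: "\<And>x v. x \<in> cmap c ` cdom c \<Longrightarrow> frechet_derivative \<eta> (at x) v + ?\<Gamma> x v (\<eta> x) = \<i> *s v"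
    using conic_rotation_field[OF \<phi> con c] by blast
  have d\<eta>: "frechet_derivative \<eta> (at y) v = \<i> *s v - ?\<Gamma> y v (\<eta> y)" if "y \<in> cmap c ` cdom c" for y v
    using eq[OF that, of v] by (simp add: algebra_simps)
  \<comment> \<open>The first-order equation is used twice: it is differentiated in direction
    \<open>u\<close>, and it replaces the derivative of \<open>\<eta>\<close> which then appears
    inside the Christoffel term.\<close>
  have dd: "frechet_derivative (\<lambda>y. frechet_derivative \<eta> (at y) v) (at x) u =
      - (frechet_derivative (\<lambda>y. ?\<Gamma> y v (\<eta> x)) (at x) u + ?\<Gamma> x v (\<i> *s u) - ?\<Gamma> x v (?\<Gamma> x u (\<eta> x)))" for u v
  proof -
    have "((\<lambda>y. ?\<Gamma> y v (\<eta> y)) has_derivative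
       (\<lambda>w. frechet_derivative (\<lambda>y. ?\<Gamma> y v (\<eta> x)) (at x) w + ?\<Gamma> x v (frechet_derivative \<eta> (at x) w))) (at x)"
      by (rule has_derivative_linear_family[OF sm linear_christoffel(1) has_derivative_ident smooth_on_has_derivative[OF \<eta> x] x])
    from has_derivative_diff[OF has_derivative_const[of "\<i> *s v"] this]
    have "((\<lambda>y. frechet_derivative \<eta> (at y) v) has_derivative
       (\<lambda>w. 0 - (frechet_derivative (\<lambda>y. ?\<Gamma> y v (\<eta> x)) (at x) w + ?\<Gamma> x v (frechet_derivative \<eta> (at x) w)))) (at x)"
      by (rule has_derivative_transform_within_open[OF _ o x]) (simp add: d\<eta>)
    from frechet_derivative_at[OF this, THEN fun_cong, of u] show ?thesis
      by (simp add: d\<eta>[OF x] linear_diff[OF linear_christoffel(1)] algebra_simps)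
  qed
  have "frechet_derivative (\<lambda>y. ?\<Gamma> y v (\<eta> x)) (at x) u + ?\<Gamma> x v (\<i> *s u) - ?\<Gamma> x v (?\<Gamma> x u (\<eta> x)) =
      frechet_derivative (\<lambda>y. ?\<Gamma> y u (\<eta> x)) (at x) v + ?\<Gamma> x u (\<i> *s v) - ?\<Gamma> x u (?\<Gamma> x v (\<eta> x))"
    using smooth_on_derivative_commute[OF o \<eta> x, of v u] unfolding dd neg_equal_iff_equal .
  \<comment> \<open>Flatness on the vector \<open>\<eta> x\<close> cancels the derivatives of the
    symbols against the quadratic terms, leaving exactly the two terms that contain
    \<open>\<i>\<close>.\<close>
  with christoffel_flat[OF c x, of v "\<eta> x" u]
  show "?\<Gamma> x u (\<i> *s v) = ?\<Gamma> x v (\<i> *s u)"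
    by (simp add: algebra_simps)
qed

end

text \<open>The symplectic and Kaehler versions put the same conditions on \<open>\<omega>\<close>
  on both sides, so they follow from the complex case by carrying these conditions over.\<close>

theorem proposition7:
  fixes X :: "'a topology" and A :: "('a, 'n::finite) chart set"
    and nabla :: "('a, 'n) vfield \<Rightarrow> ('a, 'n) vfield \<Rightarrow> ('a, 'n) vfield"
    and \<omega> :: "'a \<Rightarrow> ('a, 'n) tvec \<Rightarrow> ('a, 'n) tvec \<Rightarrow> real"
  shows "(conic_complex_manifold X A nabla \<longrightarrow> special_complex_manifold X A nabla) \<and>
    (conic_symplectic_manifold X A nabla \<omega> \<longrightarrow> special_symplectic_manifold X A nabla \<omega>) \<and>
    (conic_Kaehler_manifold X A nabla \<omega> \<longrightarrow> special_Kaehler_manifold X A nabla \<omega>)"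
proof (intro conjI impI)
  show special: "special_complex_manifold X A nabla" if "conic_complex_manifold X A nabla"
  proof -
    interpret conic_complex_manifold X A nabla by (rule that)
    show ?thesis using conic conic_imp_special by blast
  qed
  show symplectic: "special_symplectic_manifold X A nabla \<omega>" if "conic_symplectic_manifold X A nabla \<omega>"
  proof -
    interpret conic_symplectic_manifold X A nabla \<omega> by (rule that)
    interpret special_complex_manifold X A nabla by (rule special) unfold_locales
    show ?thesis by unfold_locales (rule omega_symplectic omega_parallel)+
  qed
  show "special_Kaehler_manifold X A nabla \<omega>" if "conic_Kaehler_manifold X A nabla \<omega>"
  proof -
    interpret conic_Kaehler_manifold X A nabla \<omega> by (rule that)
    interpret special_symplectic_manifold X A nabla \<omega> by (rule symplectic) unfold_locales
    show ?thesis by unfold_locales (rule omega_J_invariant)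
  qed
qed

end
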